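(* Let $G$ be a connected cactus network with effective resistance matrix $R$, and set $L^*_{ij}=\tfrac12(R_{ij}+R_{i+1,j+1}-R_{i+1,j}-R_{i,j+1})$ for $i,j\in[n]$ (indices modulo $n$). Let $X_G$ be the point of $\mathrm{Gr}(n+1,2n)$ with Plücker vector $[\sum_\sigma\Lambda_\sigma(G)f_\sigma]$. Then $X_G\in U_{\text{connected}}$, and writing $X_G$ as the row span of $M'D$ with $M'$ of the form below (with matrix $T$), the symmetric matrix $Q$ with $Q_{ab}=T_{b,a+1}-T_{b,a}$ (indices modulo $n$) equals $L^*$. Here $M'$ is the $(n+1)\times 2n$ matrix whose first row is $(1,0,1,0,\dots,1,0)$ and whose $(i+1)$-st row has entry $T_{ij}$ in column $j\in[n]$, $1$ in column $\tilde i$, and $0$ in the other columns $\tilde j$; $D$ is diagonal with $D_{ii}=D_{\tilde i\tilde i}=(-1)^{i-1}$.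
   Context: Setup: $V=\mathbb{R}^{2n}$ with basis $e_1,e_{\tilde1},\dots,e_n,e_{\tilde n}$ ordered $1<\tilde1<\dots<n<\tilde n$; $e_{I,\tilde I}$ is the ordered wedge of the $e_i$, $i\in I\sqcup\tilde I$; Plücker coordinates $\Delta_{I,\tilde I}$ are the coefficients of $e_{I,\tilde I}$ (maximal minors in columns $I\sqcup\tilde I$ of a matrix whose row span is the point). For a noncrossing partition $\sigma$ of $[n]$, its Kreweras complement $\tilde\sigma$ is the unique noncrossing partition of $[\tilde n]$ such that $\sigma\sqcup\tilde\sigma$ is noncrossing on $[n]\sqcup[\tilde n]$ in the circular order $1,\tilde1,\dots,n,\tilde n$; $(I,\tilde I)$ is concordant with $(\sigma,\tilde\sigma)$ if $I$ meets each block of $\sigma$ in exactly one element and $\tilde I$ meets each block of $\tilde\sigma$ in exactly one element; $f_\sigma=\sum_{(I,\tilde I)\text{ concordant}}e_{I,\tilde I}$. Cactus networks: for a disk $\mathbb{D}$ with boundary points $1,\dots,n$ clockwise and a noncrossing partition $\tau$ of $[n]$, the cactus $\mathbb{D}/\tau$ glues boundary points in the same block; a cactus network of shape $\tau$ is a graph embedded in $\mathbb{D}/\tau$ with boundary vertices the images of $1,\dots,n$ and positive edge conductances $c(e)$. Let $\Gamma$ be the graph obtained by treating glued boundary points as a single vertex; its boundary vertices correspond to blocks of $\tau$. $G$ is connected if $\Gamma$ is connected. A grove is a spanning acyclic subgraph $F$ of $\Gamma$ with every component containing a boundary vertex; $w(F)=\prod_{e\in F}c(e)$; $\sigma(F)$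 is the partition of $[n]$ with $i,j$ in the same block iff their images lie in the same component of $F$; $\Lambda_\sigma(G)=\sum_{\sigma(F)=\sigma}w(F)$ (by earlier work of Lam, $[\sum_\sigma\Lambda_\sigma(G) f_\sigma]$ is the Plücker image of a point of $\mathrm{Gr}(n+1,2n)$). The response matrix $L$ of $\Gamma$ (on its boundary vertices) is defined by $(LV)_u=\sum_{w\sim u}c(uw)(V(w)-V(u))$ where $V$ is the harmonic extension of boundary values (harmonic: $\sum_{w\sim u}c(uw)(V(u)-V(w))=0$ at interior vertices $u$). For boundary labels $i,j$ with corresponding boundary vertices $u,v$ of $\Gamma$, choose $V$ with $LV=e_u-e_v$ (possible since $\Gamma$ is connected) and set $R_{ij}=V(v)-V(u)$; this is the effective resistance matrix ($R_{ii}=0$). $\Omega$ is the skew form $\Omega(x,y)=\sum_{i=1}^n(x_iy_{\tilde i}-x_{\tilde i}y_i)+\sum_{j=1}^{n-1}(x_{j+1}y_{\tilde j}-x_{\tilde j}y_{j+1})+(-1)^n(x_1y_{\tilde n}-x_{\tilde n}y_1)$ on $V$; $U_{\text{connected}}$ is the set of $(n+1)$-dimensional $\Omega$-isotropic subspaces $X$ with $\Delta_{\{k\},[\tilde n]}(X)\neq0$ for all $k$. *)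

theory Defs
  imports
    "HOL-Analysis.Analysis"
    "HOL-Library.Disjoint_Sets"
    "Jordan_Normal_Form.VS_Connect"
    "Jordan_Normal_Form.DL_Submatrix"
begin

unbundle no vec_syntax

text \<open>
  Labels are counted from 0: the label \<open>i < n\<close> stands for the boundary label \<open>i + 1\<close> of the
  mathematical text, and indices modulo \<open>n\<close> become \<open>_ mod n\<close>.  The ordered basis
  \<open>e\<^sub>1, e\<^sub>1~, \<dots>, e\<^sub>n, e\<^sub>n~\<close> of \<open>V = R\<^sup>2\<^sup>n\<close> is the standard basis of \<open>carrier_vec (2 * n)\<close>:
  label \<open>i\<close> has coordinate \<open>2 * i\<close> and the tilde label \<open>i\<close> has coordinate \<open>2 * i + 1\<close>.
\<close>


section \<open>Noncrossing partitions and Kreweras complements\<close>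

definition noncrossing_partition :: "nat set \<Rightarrow> nat set set \<Rightarrow> bool" where
  "noncrossing_partition A P \<longleftrightarrow> partition_on A P \<and>
     (\<forall>B\<in>P. \<forall>C\<in>P. \<forall>a b c d.
        a < b \<and> b < c \<and> c < d \<and> a \<in> B \<and> c \<in> B \<and> b \<in> C \<and> d \<in> C \<longrightarrow> B = C)"

definition interleave :: "nat set set \<Rightarrow> nat set set \<Rightarrow> nat set set" where
  "interleave P Q = (\<lambda>B. (\<lambda>i. 2 * i) ` B) ` P \<union> (\<lambda>B. (\<lambda>i. 2 * i + 1) ` B) ` Q"

definition kreweras_compatible :: "nat \<Rightarrow> nat set set \<Rightarrow> nat set set \<Rightarrow> bool" where
  "kreweras_compatible n P Q \<longleftrightarrow>
     noncrossing_partition {..<n} Q \<and> noncrossing_partition {..<2 * n} (interleave P Q)"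

text \<open>
  Many partitions are compatible with \<open>P\<close> (the partition into singletons always is); the Kreweras
  complement is the coarsest of them.
\<close>

definition kreweras :: "nat \<Rightarrow> nat set set \<Rightarrow> nat set set" where
  "kreweras n P = (THE Q. kreweras_compatible n P Q \<and>
     (\<forall>Q'. kreweras_compatible n P Q' \<longrightarrow> refines {..<n} Q' Q))"

definition concordant :: "nat \<Rightarrow> nat set set \<Rightarrow> nat set \<Rightarrow> nat set \<Rightarrow> bool" where
  "concordant n P I J \<longleftrightarrow> I \<subseteq> {..<n} \<and> J \<subseteq> {..<n} \<and>
     (\<forall>B\<in>P. card (I \<inter> B) = 1) \<and> (\<forall>B\<in>kreweras n P. card (J \<inter> B) = 1)"

text \<open>
  An element of the \<open>(n + 1)\<close>-st exterior power of \<open>V\<close> is given by its coefficients with respect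
  to the basis of ordered wedges \<open>e\<^bsub>I,J~\<^esub>\<close>, where \<open>I\<close> and \<open>J\<close> are subsets of
  \<open>{..<n}\<close> with \<open>card I + card J = n + 1\<close>.
\<close>

type_synonym wedge_coeffs = "nat set \<Rightarrow> nat set \<Rightarrow> real"

definition f_vec :: "nat \<Rightarrow> nat set set \<Rightarrow> wedge_coeffs" where
  "f_vec n P I J = of_bool (concordant n P I J)"


section \<open>Points of the Grassmannian and Pluecker coordinates\<close>

definition row_span :: "nat \<Rightarrow> real mat \<Rightarrow> real vec set" where
  "row_span m A = vec_space.row_space m A"

definition grassmannian :: "nat \<Rightarrow> nat \<Rightarrow> real vec set set" where
  "grassmannian k m = {X. VectorSpace.subspace class_ring X (module_vec TYPE(real) m) \<and>
     vectorspace.dim class_ring (module_vec TYPE(real) m\<lparr>carrier := X\<rparr>) = k}"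

definition minor :: "real mat \<Rightarrow> wedge_coeffs" where
  "minor A I J =
     Determinant.det (submatrix A UNIV ((\<lambda>i. 2 * i) ` I \<union> (\<lambda>i. 2 * i + 1) ` J))"

text \<open>
  Homogeneous coordinates: the choice of the matrix only affects a common nonzero factor.
\<close>

definition pluecker :: "nat \<Rightarrow> real vec set \<Rightarrow> wedge_coeffs" where
  "pluecker n X = minor (SOME A. A \<in> carrier_mat (n + 1) (2 * n) \<and> row_span (2 * n) A = X)"

definition has_pluecker_vector :: "nat \<Rightarrow> real vec set \<Rightarrow> wedge_coeffs \<Rightarrow> bool" where
  "has_pluecker_vector n X p \<longleftrightarrow>
     (\<exists>s. s \<noteq> 0 \<and> (\<forall>I J. I \<subseteq> {..<n} \<and> J \<subseteq> {..<n} \<and> card I + card J = n + 1 \<longrightarrow>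
        pluecker n X I J = s * p I J))"

definition skew_form :: "nat \<Rightarrow> real vec \<Rightarrow> real vec \<Rightarrow> real" where
  "skew_form n x y =
     (\<Sum>i<n. x $ (2 * i) * y $ (2 * i + 1) - x $ (2 * i + 1) * y $ (2 * i)) +
     (\<Sum>j<n - 1. x $ (2 * (j + 1)) * y $ (2 * j + 1) - x $ (2 * j + 1) * y $ (2 * (j + 1))) +
     (- 1) ^ n * (x $ 0 * y $ (2 * (n - 1) + 1) - x $ (2 * (n - 1) + 1) * y $ 0)"

definition U_connected :: "nat \<Rightarrow> real vec set set" where
  "U_connected n = {X \<in> grassmannian (n + 1) (2 * n).
     (\<forall>x\<in>X. \<forall>y\<in>X. skew_form n x y = 0) \<and>
     (\<forall>k<n. pluecker n X {k} {..<n} \<noteq> 0)}"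

definition M'_mat :: "nat \<Rightarrow> real mat \<Rightarrow> real mat" where
  "M'_mat n T = Matrix.mat (n + 1) (2 * n) (\<lambda>(r, c).
     if r = 0 then (if even c then 1 else 0)
     else if even c then T $$ (r - 1, c div 2)
     else if c div 2 = r - 1 then 1 else 0)"

definition D_mat :: "nat \<Rightarrow> real mat" where
  "D_mat n = mat_diag (2 * n) (\<lambda>c. (- 1) ^ (c div 2))"

definition Q_mat :: "nat \<Rightarrow> real mat \<Rightarrow> real mat" where
  "Q_mat n T = Matrix.mat n n (\<lambda>(a, b). T $$ (b, (a + 1) mod n) - T $$ (b, a))"


section \<open>Cactus networks\<close>

definition boundary_point :: "nat \<Rightarrow> nat \<Rightarrow> complex" where
  "boundary_point n i = cis (- (2 * pi * real i / real n))"

text \<open>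
  The cactus is the tree of disks bounded by the circle with the boundary points of each block
  glued.  Gluing in the filled disk has to carry along the chords between the glued points
  (otherwise two glued points would merely pinch the disk, and the graph could still cross the
  chord between them), so the convex hull of each block is collapsed to a point.  For a
  noncrossing partition these hulls are pairwise disjoint.
\<close>

definition cactus_rel :: "nat \<Rightarrow> nat set set \<Rightarrow> (complex \<times> complex) set" where
  "cactus_rel n P = {(x, y). x \<in> cball 0 1 \<and> y \<in> cball 0 1 \<and>
     (x = y \<or> (\<exists>B\<in>P. x \<in> convex hull (boundary_point n ` B) \<and>
                      y \<in> convex hull (boundary_point n ` B)))}"

definition cactus_class :: "nat \<Rightarrow> nat set set \<Rightarrow> complex \<Rightarrow> complex set" where
  "cactus_class n P x = cactus_rel n P `` {x}"

definition cactus_topology :: "nat \<Rightarrow> nat set set \<Rightarrow> complex set topology" where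
  "cactus_topology n P = topology (\<lambda>U. U \<subseteq> cactus_class n P ` cball 0 1 \<and>
     openin (top_of_set (cball 0 1)) {x \<in> cball 0 1. cactus_class n P x \<in> U})"

lemma openin_cactus_topology:
  "openin (cactus_topology n P) U \<longleftrightarrow> U \<subseteq> cactus_class n P ` cball 0 1 \<and>
     openin (top_of_set (cball 0 1)) {x \<in> cball 0 1. cactus_class n P x \<in> U}"
proof -
  let ?q = "cactus_class n P" and ?D = "cball 0 1 :: complex set"
  let ?L = "\<lambda>U. U \<subseteq> ?q ` ?D \<and> openin (top_of_set ?D) {x \<in> ?D. ?q x \<in> U}"
  have inter: "{x \<in> ?D. ?q x \<in> S \<inter> T} = {x \<in> ?D. ?q x \<in> S} \<inter> {x \<in> ?D. ?q x \<in> T}" for S T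
    by auto
  have union: "{x \<in> ?D. ?q x \<in> \<Union>K} = \<Union>((\<lambda>U. {x \<in> ?D. ?q x \<in> U}) ` K)" for K
    by auto
  have "istopology ?L"
    unfolding istopology_def
  proof (intro conjI allI impI)
    fix S T
    assume "?L S" "?L T"
    then show "S \<inter> T \<subseteq> ?q ` ?D" "openin (top_of_set ?D) {x \<in> ?D. ?q x \<in> S \<inter> T}"
      unfolding inter by (blast, blast intro: openin_Int)
  next
    fix K
    assume K: "\<forall>U\<in>K. ?L U"
    then show "\<Union>K \<subseteq> ?q ` ?D"
      by blast
    show "openin (top_of_set ?D) {x \<in> ?D. ?q x \<in> \<Union>K}"
      unfolding union using K by (intro openin_Union) blast
  qed
  then show ?thesis
    unfolding cactus_topology_def by simp
qed

lemma topspace_cactus_topology: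
  "topspace (cactus_topology n P) = cactus_class n P ` cball 0 1"
proof
  show "topspace (cactus_topology n P) \<subseteq> cactus_class n P ` cball 0 1"
    using openin_cactus_topology openin_topspace by blast
  have "{x \<in> cball 0 1. cactus_class n P x \<in> cactus_class n P ` cball 0 1} = cball 0 1"
    by auto
  then have "openin (cactus_topology n P) (cactus_class n P ` cball 0 1)"
    unfolding openin_cactus_topology by (metis openin_subtopology_self order_refl)
  then show "cactus_class n P ` cball 0 1 \<subseteq> topspace (cactus_topology n P)"
    by (rule openin_subset)
qed

lemma quotient_map_cactus_class:
  "quotient_map (top_of_set (cball 0 1)) (cactus_topology n P) (cactus_class n P)"
  unfolding quotient_map_def topspace_cactus_topology openin_cactus_topology by auto

text \<open>
  A cactus network is drawn in the cactus: its vertices are points of the cactus and each edge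
  \<open>e\<close> is drawn as the curve \<open>curve G e\<close> on the unit interval.  Boundary points in the same block
  are one point of the cactus, so the graph on \<open>verts G\<close> and \<open>edges G\<close> already is the graph
  in which glued boundary points form a single vertex.  Parallel edges and loops are allowed.
\<close>

record 'e cactus_network =
  shape :: "nat set set"
  verts :: "complex set set"
  edges :: "'e set"
  curve :: "'e \<Rightarrow> real \<Rightarrow> complex set"
  conductance :: "'e \<Rightarrow> real"

definition boundary_vertex :: "nat \<Rightarrow> 'e cactus_network \<Rightarrow> nat \<Rightarrow> complex set" where
  "boundary_vertex n G i = cactus_class n (shape G) (boundary_point n i)"

definition boundary_verts :: "nat \<Rightarrow> 'e cactus_network \<Rightarrow> complex set set" where
  "boundary_verts n G = boundary_vertex n G ` {..<n}"

definition is_cactus_network :: "nat \<Rightarrow> 'e cactus_network \<Rightarrow> bool" where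
  "is_cactus_network n G \<longleftrightarrow>
     noncrossing_partition {..<n} (shape G) \<and>
     finite (verts G) \<and> finite (edges G) \<and>
     verts G \<subseteq> topspace (cactus_topology n (shape G)) \<and>
     boundary_verts n G \<subseteq> verts G \<and>
     (\<forall>e\<in>edges G. conductance G e > 0) \<and>
     (\<forall>e\<in>edges G. pathin (cactus_topology n (shape G)) (curve G e) \<and>
        curve G e 0 \<in> verts G \<and> curve G e 1 \<in> verts G \<and>
        inj_on (curve G e) {0<..<1} \<and> curve G e ` {0<..<1} \<inter> verts G = {}) \<and>
     (\<forall>e\<in>edges G. \<forall>e'\<in>edges G. e \<noteq> e' \<longrightarrow>
        curve G e ` {0<..<1} \<inter> curve G e' ` {0<..<1} = {})"

definition ends :: "'e cactus_network \<Rightarrow> 'e \<Rightarrow> complex set set" where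
  "ends G e = {curve G e 0, curve G e 1}"

definition same_component ::
    "'e cactus_network \<Rightarrow> 'e set \<Rightarrow> complex set \<Rightarrow> complex set \<Rightarrow> bool" where
  "same_component G F u v \<longleftrightarrow> (u, v) \<in> {(x, y). \<exists>e\<in>F. ends G e = {x, y}}\<^sup>*"

definition network_connected :: "'e cactus_network \<Rightarrow> bool" where
  "network_connected G \<longleftrightarrow> (\<forall>u\<in>verts G. \<forall>v\<in>verts G. same_component G (edges G) u v)"

definition is_cycle ::
    "'e cactus_network \<Rightarrow> 'e set \<Rightarrow> complex set list \<Rightarrow> 'e list \<Rightarrow> bool" where
  "is_cycle G F vs es \<longleftrightarrow> es \<noteq> [] \<and> length vs = length es \<and> distinct vs \<and> distinct es \<and>
     set es \<subseteq> F \<and>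
     (\<forall>i<length es. ends G (es ! i) = {vs ! i, vs ! ((i + 1) mod length vs)})"


section \<open>Groves\<close>

definition grove :: "nat \<Rightarrow> 'e cactus_network \<Rightarrow> 'e set \<Rightarrow> bool" where
  "grove n G F \<longleftrightarrow> F \<subseteq> edges G \<and> (\<nexists>vs es. is_cycle G F vs es) \<and>
     (\<forall>v\<in>verts G. \<exists>u\<in>boundary_verts n G. same_component G F v u)"

definition grove_weight :: "'e cactus_network \<Rightarrow> 'e set \<Rightarrow> real" where
  "grove_weight G F = (\<Prod>e\<in>F. conductance G e)"

definition grove_partition :: "nat \<Rightarrow> 'e cactus_network \<Rightarrow> 'e set \<Rightarrow> nat set set" where
  "grove_partition n G F = {..<n} // {(i, j). i < n \<and> j < n \<and>
     same_component G F (boundary_vertex n G i) (boundary_vertex n G j)}"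

definition grove_measurement :: "nat \<Rightarrow> 'e cactus_network \<Rightarrow> nat set set \<Rightarrow> real" where
  "grove_measurement n G P = (\<Sum>F | grove n G F \<and> grove_partition n G F = P. grove_weight G F)"

definition grove_vector :: "nat \<Rightarrow> 'e cactus_network \<Rightarrow> wedge_coeffs" where
  "grove_vector n G I J =
     (\<Sum>P | noncrossing_partition {..<n} P. grove_measurement n G P * f_vec n P I J)"


section \<open>Response and effective resistance\<close>

definition total_conductance :: "'e cactus_network \<Rightarrow> complex set \<Rightarrow> complex set \<Rightarrow> real" where
  "total_conductance G u w = (\<Sum>e | e \<in> edges G \<and> ends G e = {u, w}. conductance G e)"

definition laplacian ::
    "'e cactus_network \<Rightarrow> (complex set \<Rightarrow> real) \<Rightarrow> complex set \<Rightarrow> real" where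
  "laplacian G V u = (\<Sum>w\<in>verts G. total_conductance G u w * (V w - V u))"

definition harmonic :: "nat \<Rightarrow> 'e cactus_network \<Rightarrow> (complex set \<Rightarrow> real) \<Rightarrow> bool" where
  "harmonic n G V \<longleftrightarrow> (\<forall>u\<in>verts G - boundary_verts n G. laplacian G V u = 0)"

definition harmonic_extension ::
    "nat \<Rightarrow> 'e cactus_network \<Rightarrow> (complex set \<Rightarrow> real) \<Rightarrow> complex set \<Rightarrow> real" where
  "harmonic_extension n G g =
     (SOME V. harmonic n G V \<and> (\<forall>u\<in>boundary_verts n G. V u = g u))"

definition response ::
    "nat \<Rightarrow> 'e cactus_network \<Rightarrow> (complex set \<Rightarrow> real) \<Rightarrow> complex set \<Rightarrow> real" where
  "response n G g u = laplacian G (harmonic_extension n G g) u"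

definition resistance :: "nat \<Rightarrow> 'e cactus_network \<Rightarrow> nat \<Rightarrow> nat \<Rightarrow> real" where
  "resistance n G i j =
     (let u = boundary_vertex n G i; v = boundary_vertex n G j;
          g = (SOME g. \<forall>x\<in>boundary_verts n G.
                 response n G g x = of_bool (x = u) - of_bool (x = v))
      in g v - g u)"

definition L_star :: "nat \<Rightarrow> 'e cactus_network \<Rightarrow> real mat" where
  "L_star n G = (let R = resistance n G; s = (\<lambda>i. (i + 1) mod n) in
     Matrix.mat n n (\<lambda>(i, j). (R i j + R (s i) (s j) - R (s i) j - R i (s j)) / 2))"

end

theory Submission
  imports Defs "Jordan_Normal_Form.DL_Rank"
begin

text \<open>
  A grove with two components is encoded, through its partition of the labels into two cyclic
  intervals, by the two positions at which the intervals are cut; the Kreweras complement of the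
  partition has these two positions as its only block with more than one element.  Hence the
  Pluecker coordinate \<open>\<Delta>\<close> at \<open>{a, a + 1}\<close> and all tilde labels except \<open>b\<close> is the weight of the
  two-component groves that are cut at \<open>a\<close> and at \<open>b\<close>, while \<open>\<Delta>\<close> at one label and all tilde
  labels is the weight \<open>Z\<close> of the spanning trees.  Up to a sign these quotients are the differences
  of entries of \<open>T\<close>, because they are the coefficients of linear relations satisfied on \<open>X\<close>.

  On the electrical side, \<open>Z\<close> times the effective resistance of \<open>i\<close> and \<open>j\<close> is the weight of the
  two-component spanning forests separating \<open>i\<close> and \<open>j\<close> (Kirchhoff), and the second difference of
  the indicator of being separated is again supported on the forests cut at \<open>a\<close> and at \<open>b\<close>.

  Planarity enters only in showing that grove partitions are noncrossing: the quotient map from the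
  disk to the cactus is closed with connected fibres, so two disjoint components pull back to
  disjoint continua in the disk, which cannot join crossing pairs of boundary points.
\<close>

section \<open>Planarity of cactus networks\<close>

text \<open>Three points carry the work. Planarity: the preimage of a component in the disk is
  connected but not visibly path connected, so it is replaced by a path staying closer to it than
  half the distance between the two preimages; the crossing theorem concerns paths in a rectangle,
  and a Cayley transform carries the disk into a half-plane. Kirchhoff:
  \<open>harmonic_extension\<close> and \<open>resistance\<close> are choices, so existence, and
  uniqueness up to a constant, must be known before an explicit potential can stand for the chosen
  one; that potential is a sum over two-component forests, and an edge exchange turns its Laplacian
  into a unit flow on every spanning tree. Signs: on the electrical side the second difference of
  the separation indicator is -2 if a = b and 2 otherwise, when it does not vanish; on the
  Grassmannian side the sign counts columns to the left of a tilde column. That the two agree, also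
  where indices wrap around, is the heart of Q = L*. The matrix T is determined only up to a
  constant in each row, which the differences in Q cancel. In these coordinates the skew form is the
  antisymmetrization of Q, so isotropy follows from the symmetry of the resistance.\<close>

lemma inner_cis: "cis s \<bullet> cis t = cos (s - t)"
  by (simp add: inner_complex_def cos_diff)

lemma cos_le_outside_arc:
  fixes x h :: real
  assumes "0 \<le> h" "h \<le> \<bar>x\<bar>" "\<bar>x\<bar> \<le> 2 * pi - h"
  shows "cos x \<le> cos h"
proof (cases "\<bar>x\<bar> \<le> pi")
  case True
  then have "cos \<bar>x\<bar> \<le> cos h"
    using assms by (intro cos_monotone_0_pi_le) auto
  then show ?thesis by simp
next
  case False
  then have "cos (2 * pi - \<bar>x\<bar>) \<le> cos h"
    using assms by (intro cos_monotone_0_pi_le) auto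
  then show ?thesis by (simp add: cos_diff)
qed

text \<open>The line orthogonal to \<open>cis (- m)\<close> at signed distance \<open>cos h\<close>
  from the origin separates the two hulls: \<open>C\<close> lies strictly beyond it and
  \<open>B\<close> on it or before it. The angles are negated because the labels run
  clockwise.\<close>

lemma disjoint_hulls_of_arcs:
  fixes \<theta> :: "'i \<Rightarrow> real"
  assumes h: "0 \<le> h" "h \<le> pi"
    and C: "\<And>c. c \<in> C \<Longrightarrow> \<bar>\<theta> c - m\<bar> < h"
    and B: "\<And>b. b \<in> B \<Longrightarrow> h \<le> \<bar>\<theta> b - m\<bar> \<and> \<bar>\<theta> b - m\<bar> \<le> 2 * pi - h"
  shows "convex hull ((\<lambda>i. cis (- \<theta> i)) ` C) \<inter> convex hull ((\<lambda>i. cis (- \<theta> i)) ` B) = {}"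
proof -
  have "cos h < cos (\<theta> c - m)" if "c \<in> C" for c
    using cos_monotone_0_pi[of "\<bar>\<theta> c - m\<bar>" h] C[OF that] h by simp
  then have "convex hull ((\<lambda>i. cis (- \<theta> i)) ` C) \<subseteq> {z. cis (- m) \<bullet> z > cos h}"
    by (intro hull_minimal convex_halfspace_gt) (auto simp: inner_cis)
  moreover have "cos (\<theta> b - m) \<le> cos h" if "b \<in> B" for b
    using cos_le_outside_arc B[OF that] h by simp
  then have "convex hull ((\<lambda>i. cis (- \<theta> i)) ` B) \<subseteq> {z. cis (- m) \<bullet> z \<le> cos h}"
    by (intro hull_minimal convex_halfspace_le) (auto simp: inner_cis)
  ultimately show ?thesis by force
qed

text \<open>All of \<open>C\<close> lies in one cyclic gap between neighbours \<open>b1\<close> and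
  \<open>b2\<close> of \<open>B\<close>, namely the gap containing \<open>Min C\<close>; an element
  of \<open>C\<close> beyond it would produce the pattern B, C, B, C. The value \<open>b2\<close>
  may exceed \<open>n\<close>, which encodes a gap that passes the end of the label range.\<close>

lemma noncrossing_gap:
  fixes B C :: "nat set"
  assumes BC: "B \<subseteq> {..<n}" "C \<subseteq> {..<n}" "B \<inter> C = {}" "B \<noteq> {}" "C \<noteq> {}"
    and nc: "\<And>a b c d. a < b \<Longrightarrow> b < c \<Longrightarrow> c < d \<Longrightarrow> a \<in> B \<Longrightarrow> c \<in> B \<Longrightarrow> b \<in> C \<Longrightarrow> d \<in> C \<Longrightarrow> False"
    and first: "Min B < Min C"
  obtains b1 b2 where "b1 < b2" "b2 \<le> b1 + n" "\<And>c. c \<in> C \<Longrightarrow> b1 < c \<and> c < b2"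
    "\<And>b. b \<in> B \<Longrightarrow> b \<le> b1 \<and> b2 \<le> b + n \<or> b2 \<le> b \<and> b \<le> b1 + n"
proof -
  have fin: "finite B" "finite C"
    using BC finite_subset by blast+
  define c0 where "c0 = Min C"
  define b1 where "b1 = Max {b \<in> B. b < c0}"
  have c0: "c0 \<in> C" "\<And>c. c \<in> C \<Longrightarrow> c0 \<le> c"
    using fin BC by (auto simp: c0_def)
  have b0: "Min B \<in> B" "\<And>b. b \<in> B \<Longrightarrow> Min B \<le> b"
    using fin BC by auto
  have "b1 \<in> {b \<in> B. b < c0}"
    unfolding b1_def using fin b0 first c0_def by (intro Max_in) auto
  then have b1: "b1 \<in> B" "b1 < c0" by auto
  have b1_max: "b \<le> b1" if "b \<in> B" "b < c0" for b
    unfolding b1_def using fin that by (intro Max_ge) auto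
  have ne: "b \<noteq> c" if "b \<in> B" "c \<in> C" for b c
    using that BC by auto
  show thesis
  proof (cases "\<exists>b\<in>B. c0 < b")
    case True
    define b2 where "b2 = Min {b \<in> B. c0 < b}"
    have "b2 \<in> {b \<in> B. c0 < b}"
      unfolding b2_def using fin True by (intro Min_in) auto
    then have b2: "b2 \<in> B" "c0 < b2" by auto
    have b2_min: "b2 \<le> b" if "b \<in> B" "c0 < b" for b
      unfolding b2_def using fin that by (intro Min_le) auto
    show thesis
    proof (rule that)
      show "b1 < b2" using b1 b2 by simp
      show "b2 \<le> b1 + n" using b2 BC by force
      show "b1 < c \<and> c < b2" if "c \<in> C" for c
      proof -
        have "b1 < c" using b1 c0(2)[OF that] by simp
        moreover have "\<not> b2 < c"
          using nc[OF b1(2) b2(2) _ b1(1) b2(1) c0(1) that] by blast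
        ultimately show ?thesis using ne[OF b2(1) that] by simp
      qed
      show "b \<le> b1 \<and> b2 \<le> b + n \<or> b2 \<le> b \<and> b \<le> b1 + n" if "b \<in> B" for b
      proof -
        have "b < c0 \<or> c0 < b" "b < n" "b2 < n"
          using ne[OF that c0(1)] that b2 BC by auto
        then show ?thesis
          using b1_max[OF that] b2_min[OF that] by linarith
      qed
    qed
  next
    case False
    show thesis
    \<comment> \<open>No element of \<open>B\<close> follows \<open>C\<close>, so the gap closes
      only at the first element of \<open>B\<close> in the next turn.\<close>
    proof (rule that[of b1 "Min B + n"])
      show "b1 < Min B + n" using b1 BC by force
      show "Min B + n \<le> b1 + n" using b0 b1 by simp
      show "b1 < c \<and> c < Min B + n" if "c \<in> C" for c
        using c0(2)[OF that] b1 that BC by force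
      show "b \<le> b1 \<and> Min B + n \<le> b + n \<or> Min B + n \<le> b \<and> b \<le> b1 + n" if "b \<in> B" for b
        using b0 b1_max[OF that] ne[OF that c0(1)] False that linorder_neqE_nat by auto
    qed
  qed
qed

lemma noncrossing_hulls_disjoint:
  assumes P: "noncrossing_partition {..<n} P" and "B \<in> P" "C \<in> P" "B \<noteq> C"
  shows "convex hull (boundary_point n ` B) \<inter> convex hull (boundary_point n ` C) = {}"
proof -
  have part: "partition_on {..<n} P"
    using P unfolding noncrossing_partition_def by (rule conjunct1)
  have nc: "B = C" if "B \<in> P" "C \<in> P" "a < b" "b < c" "c < d" "a \<in> B" "c \<in> B" "b \<in> C" "d \<in> C"
    for B C a b c d
    using P that unfolding noncrossing_partition_def by meson
  have sub: "B \<subseteq> {..<n}" "B \<noteq> {}" if "B \<in> P" for B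
    using partition_onD1[OF part] partition_onD3[OF part] that by auto
  have main: "convex hull (boundary_point n ` C) \<inter> convex hull (boundary_point n ` B) = {}"
    if BC: "B \<in> P" "C \<in> P" "B \<noteq> C" and first: "Min B < Min C" for B C
  proof -
    have disj: "B \<inter> C = {}"
      using part BC unfolding partition_on_def disjoint_def by blast
    obtain b1 b2 where b: "b1 < b2" "b2 \<le> b1 + n" "\<And>c. c \<in> C \<Longrightarrow> b1 < c \<and> c < b2"
      "\<And>b. b \<in> B \<Longrightarrow> b \<le> b1 \<and> b2 \<le> b + n \<or> b2 \<le> b \<and> b \<le> b1 + n"
      using noncrossing_gap[OF sub(1)[OF BC(1)] sub(1)[OF BC(2)] disj sub(2)[OF BC(1)]
          sub(2)[OF BC(2)] _ first] nc[OF BC(1,2)] BC(3) by blast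
    have n: "real n > 0" using b by auto
    \<comment> \<open>Label \<open>i\<close> has angle 2 pi i / n, so the gap from \<open>b1\<close>
      to \<open>b2\<close> is an arc of half-width \<open>h\<close> around the angle
      \<open>m\<close>.\<close>
    define h where "h = pi / n * (real b2 - real b1)"
    define m where "m = pi / n * (real b1 + real b2)"
    have diff: "2 * pi * real i / real n - m = pi / n * (2 * real i - real b1 - real b2)" for i
      by (simp add: m_def diff_divide_distrib add_divide_distrib algebra_simps)
    have pos: "pi / n > 0" using n by simp
    have twopi: "2 * pi = pi / n * (2 * real n)" and pin: "pi = pi / n * real n" using n by auto
    have "convex hull ((\<lambda>i. cis (- (2 * pi * real i / real n))) ` C) \<inter>
      convex hull ((\<lambda>i. cis (- (2 * pi * real i / real n))) ` B) = {}"
    proof (rule disjoint_hulls_of_arcs[where h = h and m = m])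
      show "0 \<le> h" using b n by (simp add: h_def)
      have "pi / n * (real b2 - real b1) \<le> pi / n * n"
        using b pos by (intro mult_left_mono) auto
      then show "h \<le> pi" using pin by (simp add: h_def)
    next
      fix c assume "c \<in> C"
      then have "\<bar>2 * real c - real b1 - real b2\<bar> < real b2 - real b1"
        using b(3)[of c] by (simp add: abs_if)
      then show "\<bar>2 * pi * real c / real n - m\<bar> < h"
        unfolding diff h_def abs_mult abs_of_pos[OF pos] by (rule mult_strict_left_mono[OF _ pos])
    next
      fix x assume "x \<in> B"
      then have "real b2 - real b1 \<le> \<bar>2 * real x - real b1 - real b2\<bar>"
        and le: "\<bar>2 * real x - real b1 - real b2\<bar> \<le> 2 * real n - (real b2 - real b1)"
        using b(4)[of x] b(1,2) by (auto simp: abs_if)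
      then have "pi / n * (real b2 - real b1) \<le> pi / n * \<bar>2 * real x - real b1 - real b2\<bar>"
        using pos by (intro mult_left_mono) auto
      moreover have "pi / n * \<bar>2 * real x - real b1 - real b2\<bar> \<le> 2 * pi - h"
        using mult_left_mono[OF le, of "pi / n"] pos unfolding h_def twopi
        by (simp only: right_diff_distrib)
      ultimately show "h \<le> \<bar>2 * pi * real x / real n - m\<bar> \<and> \<bar>2 * pi * real x / real n - m\<bar> \<le> 2 * pi - h"
        unfolding diff h_def abs_mult abs_of_pos[OF pos] by simp
    qed
    then show ?thesis
      unfolding boundary_point_def .
  qed
  have "Min B \<in> B" "Min C \<in> C"
    using sub assms(2,3) finite_subset[OF _ finite_lessThan] by (metis Min_in)+
  moreover have "B \<inter> C = {}"
    using part assms unfolding partition_on_def disjoint_def by blast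
  ultimately have "Min B \<noteq> Min C" by auto
  then consider "Min B < Min C" | "Min C < Min B" by linarith
  then show ?thesis
    using main[OF assms(2-4)] main[OF assms(3,2)] assms(4) by cases blast+
qed

section \<open>The quotient map from the disk to the cactus\<close>

lemma norm_boundary_point [simp]: "norm (boundary_point n i) = 1"
  by (simp add: boundary_point_def)

lemma hull_boundary_points_subset: "convex hull (boundary_point n ` B) \<subseteq> cball 0 1"
  by (intro hull_minimal) auto

lemma equiv_cactus_rel:
  assumes "noncrossing_partition {..<n} P"
  shows "equiv (cball 0 1) (cactus_rel n P)"
proof (rule equivI)
  show "cactus_rel n P \<subseteq> cball 0 1 \<times> cball 0 1"
    unfolding cactus_rel_def by auto
  show "refl_on (cball 0 1) (cactus_rel n P)"
    unfolding refl_on_def cactus_rel_def by auto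
  show "sym (cactus_rel n P)"
    unfolding sym_def cactus_rel_def by blast
  show "trans (cactus_rel n P)"
    unfolding trans_def cactus_rel_def
    using noncrossing_hulls_disjoint[OF assms] by blast
qed

lemma cactus_class_eq_iff:
  assumes "noncrossing_partition {..<n} P" "x \<in> cball 0 1" "y \<in> cball 0 1"
  shows "cactus_class n P x = cactus_class n P y \<longleftrightarrow> (x = y \<or>
    (\<exists>B\<in>P. x \<in> convex hull (boundary_point n ` B) \<and> y \<in> convex hull (boundary_point n ` B)))"
  using eq_equiv_class_iff[OF equiv_cactus_rel[OF assms(1)] assms(2,3)] assms(2,3)
  by (simp add: cactus_class_def cactus_rel_def)

text \<open>A fibre is either a single point or the whole hull of one block, and both are convex.
  Connected fibres are what lets connected sets be pulled back to the disk.\<close>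

lemma monotone_map_cactus_class:
  assumes P: "noncrossing_partition {..<n} P"
  shows "monotone_map (top_of_set (cball 0 1)) (cactus_topology n P) (cactus_class n P)"
  unfolding monotone_map_def
proof (intro conjI ballI)
  show "cactus_class n P ` topspace (top_of_set (cball 0 1)) \<subseteq> topspace (cactus_topology n P)"
    by (simp add: topspace_cactus_topology)
  fix y assume "y \<in> topspace (cactus_topology n P)"
  then obtain z where z: "z \<in> cball 0 1" "y = cactus_class n P z"
    by (auto simp: topspace_cactus_topology)
  define S where "S = {x \<in> cball 0 1. cactus_class n P x = y}"
  have S: "S = {x \<in> cball 0 1. x = z \<or> (\<exists>B\<in>P. x \<in> convex hull (boundary_point n ` B) \<and>
      z \<in> convex hull (boundary_point n ` B))}"
    unfolding S_def z(2) using cactus_class_eq_iff[OF P _ z(1)] by blast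
  have "connected S"
  proof (cases "\<exists>B\<in>P. z \<in> convex hull (boundary_point n ` B)")
    case True
    then obtain B where B: "B \<in> P" "z \<in> convex hull (boundary_point n ` B)" by blast
    then have "S = convex hull (boundary_point n ` B)"
      unfolding S using noncrossing_hulls_disjoint[OF P] hull_boundary_points_subset by blast
    then show ?thesis by (simp add: convex_connected)
  next
    case False
    then have "S = {z}" unfolding S using z by blast
    then show ?thesis by simp
  qed
  moreover have "S \<subseteq> cball 0 1" unfolding S_def by blast
  ultimately have "connectedin (top_of_set (cball 0 1)) S"
    by (simp add: connectedin_subtopology)
  then show "connectedin (top_of_set (cball 0 1)) {x \<in> topspace (top_of_set (cball 0 1)). cactus_class n P x = y}"
    by (simp add: S_def)
qed

text \<open>Saturating a closed set only adds the hulls that it meets; these are finitely many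
  compact sets.\<close>

lemma closed_map_cactus_class:
  assumes P: "noncrossing_partition {..<n} P"
  shows "closed_map (top_of_set (cball 0 1)) (cactus_topology n P) (cactus_class n P)"
  unfolding closed_map_def
proof (intro allI impI)
  fix C :: "complex set" assume "closedin (top_of_set (cball 0 1)) C"
  then have C: "closed C" "C \<subseteq> cball 0 1"
    using closedin_closed_trans[OF _ closed_cball] closedin_imp_subset by (blast, blast)
  let ?h = "\<lambda>B. convex hull (boundary_point n ` B)"
  have part: "partition_on {..<n} P"
    using P unfolding noncrossing_partition_def by (rule conjunct1)
  then have "finite P" by (rule finite_elements[rotated]) simp
  have finB: "finite B" if "B \<in> P" for B
    using part that unfolding partition_on_def by (metis Union_upper finite_lessThan finite_subset)
  have "{x \<in> cball 0 1. cactus_class n P x \<in> cactus_class n P ` C} =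
      C \<union> \<Union>(?h ` {B \<in> P. ?h B \<inter> C \<noteq> {}})" (is "?L = ?R")
  proof (intro equalityI subsetI)
    fix x assume "x \<in> ?L"
    then obtain y where "x \<in> cball 0 1" "y \<in> C" "cactus_class n P x = cactus_class n P y" by blast
    moreover from this have "y \<in> cball 0 1" using C by blast
    ultimately show "x \<in> ?R"
      using cactus_class_eq_iff[OF P, of x y] by blast
  next
    fix x assume "x \<in> ?R"
    then show "x \<in> ?L"
    proof
      assume "x \<in> C" then show ?thesis using C by blast
    next
      assume "x \<in> \<Union>(?h ` {B \<in> P. ?h B \<inter> C \<noteq> {}})"
      then obtain B y where "B \<in> P" "x \<in> ?h B" "y \<in> ?h B" "y \<in> C" by blast
      then show ?thesis
        using cactus_class_eq_iff[OF P, of x y] hull_boundary_points_subset[of n B] by blast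
    qed
  qed
  moreover have "closed ?R"
    using C \<open>finite P\<close> finB
    by (intro closed_Un closed_Union) (auto intro!: compact_imp_closed finite_imp_compact_convex_hull)
  ultimately have "closed ?L" by metis
  then have "closedin (top_of_set (cball 0 1)) ?L"
    by (intro closed_subset) blast+
  moreover have "cactus_class n P ` C \<subseteq> topspace (cactus_topology n P)"
    using C by (auto simp: topspace_cactus_topology)
  ultimately show "closedin (cactus_topology n P) (cactus_class n P ` C)"
    using quotient_map_cactus_class[of n P] unfolding quotient_map_closedin by simp
qed

text \<open>Closed continuous images of normal Hausdorff spaces are Hausdorff. This makes compact
  subsets of the cactus, in particular drawn walks, closed.\<close>

lemma Hausdorff_space_cactus_topology:
  assumes P: "noncrossing_partition {..<n} P"
  shows "Hausdorff_space (cactus_topology n P)"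
proof -
  have "normal_space (top_of_set (cball (0::complex) 1))"
    by (simp add: metrizable_imp_normal_space metrizable_space_euclidean metrizable_space_subtopology)
  moreover have "Hausdorff_space (top_of_set (cball (0::complex) 1))"
    by (simp add: Hausdorff_space_subtopology)
  ultimately show ?thesis
    using normal_Hausdorff_space_closed_continuous_map_image[OF _ _ closed_map_cactus_class[OF P]]
      quotient_map_cactus_class[of n P] quotient_imp_continuous_map quotient_imp_surjective_map
    by blast
qed

section \<open>Crossing paths in the disk\<close>

text \<open>A connected set need not be path connected, but its open \<open>e\<close>-neighbourhood
  is. A path there may leave the disk; the nearest-point projection brings it back.\<close>

lemma thin_path_in_disc:
  fixes K :: "complex set"
  assumes "connected K" "K \<subseteq> cball 0 1" "a \<in> K" "c \<in> K" "e > 0"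
  obtains g where "path g" "pathstart g = a" "pathfinish g = c" "path_image g \<subseteq> cball 0 1"
    "\<And>z. z \<in> path_image g \<Longrightarrow> \<exists>x\<in>K. dist x z < e"
proof -
  define U where "U = (\<Union>x\<in>K. ball x e)"
  \<comment> \<open>As the image of a product of connected sets under addition, \<open>U\<close> is
    connected.\<close>
  have "U = (\<lambda>(x, y). x + y) ` (K \<times> ball 0 e)"
  proof (intro equalityI subsetI)
    fix z assume "z \<in> U"
    then obtain x where "x \<in> K" "dist x z < e" by (auto simp: U_def)
    then have "(x, z - x) \<in> K \<times> ball 0 e" "z = x + (z - x)"
      by (auto simp: dist_norm norm_minus_commute)
    then show "z \<in> (\<lambda>(x, y). x + y) ` (K \<times> ball 0 e)" by force
  next
    fix z assume "z \<in> (\<lambda>(x, y). x + y) ` (K \<times> ball 0 e)"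
    then obtain x y where "x \<in> K" "norm y < e" "z = x + y" by auto
    then show "z \<in> U" by (auto simp: U_def dist_norm intro!: bexI[of _ x])
  qed
  moreover have "connected ((\<lambda>(x, y). x + y) ` (K \<times> ball (0::complex) e))"
    using assms(1)
    by (intro connected_continuous_image connected_Times) (auto simp: case_prod_unfold intro!: continuous_intros)
  moreover have "open U" by (auto simp: U_def)
  ultimately have "path_connected U"
    using connected_open_path_connected by metis
  moreover have "a \<in> U" "c \<in> U"
    using assms by (auto simp: U_def intro: bexI[of _ a] bexI[of _ c])
  ultimately obtain g where g: "path g" "path_image g \<subseteq> U" "pathstart g = a" "pathfinish g = c"
    unfolding path_connected_def by blast
  \<comment> \<open>The projection is 1-Lipschitz and fixes \<open>K\<close>, so it keeps the path
    within distance \<open>e\<close> of \<open>K\<close>.\<close>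
  let ?p = "closest_point (cball (0::complex) 1)"
  have cont: "continuous_on S ?p" for S
    by (intro continuous_on_closest_point) auto
  have fixed: "?p x = x" if "x \<in> cball 0 1" for x
    by (rule closest_point_self[OF that])
  show thesis
  proof (rule that[of "?p \<circ> g"])
    show "path (?p \<circ> g)" by (intro path_continuous_image g(1) cont)
    show "pathstart (?p \<circ> g) = a" "pathfinish (?p \<circ> g) = c"
      using g fixed assms by (auto simp: pathstart_compose pathfinish_compose)
    show "path_image (?p \<circ> g) \<subseteq> cball 0 1"
      unfolding path_image_compose by (metis (no_types, lifting) ball_empty cball_eq_empty
        closed_cball closest_point_in_set image_subsetI not_one_less_zero)
    fix z assume "z \<in> path_image (?p \<circ> g)"
    then obtain w where w: "w \<in> U" "z = ?p w"
      unfolding path_image_compose using g by blast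
    then obtain x where x: "x \<in> K" "dist x w < e" by (auto simp: U_def)
    have "dist (?p x) (?p w) \<le> dist x w"
      by (intro closest_point_lipschitz) auto
    then show "\<exists>x\<in>K. dist x z < e"
      using x w fixed assms by (metis le_less_trans subsetD)
  qed
qed

text \<open>The Cayley transform sends the circle to the imaginary axis. Multiplying numerator and
  denominator by \<open>cis s\<close> turns them into 2 cos s and 2 i sin s.\<close>

lemma cayley_cis:
  assumes "sin s \<noteq> 0"
  shows "(1 + cis (- 2 * s)) / (1 - cis (- 2 * s)) = - \<i> * of_real (cot s)"
proof -
  have "cis s * cis (- 2 * s) = cis (- s)" by (simp add: cis_mult)
  moreover have "cis s \<noteq> 0" by simp
  ultimately have "(1 + cis (- 2 * s)) / (1 - cis (- 2 * s)) = (cis s + cis (- s)) / (cis s - cis (- s))"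
    using mult_divide_mult_cancel_left[of "cis s" "1 + cis (- 2 * s)" "1 - cis (- 2 * s)"]
    by (simp add: algebra_simps)
  also have "cis s + cis (- s) = of_real (2 * cos s)" by (simp add: complex_eq_iff)
  also have "cis s - cis (- s) = of_real (2 * sin s) * \<i>" by (simp add: complex_eq_iff)
  also have "of_real (2 * cos s) / (of_real (2 * sin s) * \<i>) = - \<i> * of_real (cot s)"
    using assms by (simp add: cot_def field_simps)
  finally show ?thesis .
qed

lemma cot_strict_antimono:
  fixes s t :: real
  assumes "0 < s" "s < t" "t < pi"
  shows "cot t < cot s"
proof -
  have pos: "sin s > 0" "sin t > 0" "sin (t - s) > 0"
    using assms by (auto intro!: sin_gt_zero)
  have "cot s - cot t = sin (t - s) / (sin s * sin t)"
    using pos by (simp add: cot_def sin_diff field_simps)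
  also have "\<dots> > 0" using pos by simp
  finally show ?thesis by simp
qed

text \<open>The crossing theorem \<open>fashoda_interlace\<close> wants paths in a rectangle with
  interlaced ends on its lower side. A Cayley transform maps the disk to a half-plane, but a path in
  the closed unit disk could run through a pole on the unit circle. Hence the paths are prolonged
  radially to the circle of radius 2, where the pole \<open>2 * \<omega>\<close> lies on none of the
  rays used.\<close>

lemma disc_chords_intersect:
  assumes lt: "a < b" "b < c" "c < d" "d < n"
    and f: "path f" "path_image f \<subseteq> cball 0 1" "pathstart f = boundary_point n a" "pathfinish f = boundary_point n c"
    and g: "path g" "path_image g \<subseteq> cball 0 1" "pathstart g = boundary_point n b" "pathfinish g = boundary_point n d"
  shows "path_image f \<inter> path_image g \<noteq> {}"
proof -
  \<comment> \<open>The direction \<open>\<omega>\<close> is halfway between the boundary points of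
    the labels n - 1 and 0. Measured from it, label \<open>i\<close> is
    \<open>cis (- 2 * s i)\<close> with \<open>s i\<close> strictly between 0 and pi and increasing
    in \<open>i\<close>, so the images \<open>- cot (s i)\<close> increase as well.\<close>
  define s where "s i = (2 * real i + 1) * pi / (2 * real n)" for i
  define \<omega> where "\<omega> = cis (pi / n)"
  define N where "N z = (2 * \<omega> + z) / (2 * \<omega> - z)" for z
  \<comment> \<open>Exchanging real and imaginary part turns the right half-plane into the upper
    one, with the image of the circle of radius 2 as the line where the second coordinate is
    0.\<close>
  define \<Phi> :: "complex \<Rightarrow> real^2" where "\<Phi> z = vector [Im (N z), Re (N z)]" for z
  define R where "R = cball 0 2 - {2 * \<omega>}"
  have n: "real n > 0" using lt by simp
  have s: "0 < s i" "s i < pi" if "i < n" for i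
  proof -
    have "(2 * real i + 1) * pi < (2 * real n) * pi"
      using that by (intro mult_strict_right_mono) auto
    then show "s i < pi" using n by (simp add: s_def pos_divide_less_eq mult.commute)
    show "0 < s i" using n by (auto simp: s_def intro!: divide_pos_pos mult_pos_pos)
  qed
  have s_mono: "s i < s j" if "i < j" for i j
    using that n pi_gt_zero by (auto simp: s_def divide_strict_right_mono)
  have bp: "boundary_point n i = \<omega> * cis (- 2 * s i)" if "i < n" for i
    using n by (simp add: boundary_point_def \<omega>_def cis_mult s_def field_simps)
  have norm_\<omega> [simp]: "norm \<omega> = 1" by (simp add: \<omega>_def)
  then have \<omega>0: "\<omega> \<noteq> 0" by force
  have N_bp: "N (2 * boundary_point n i) = - \<i> * of_real (cot (s i))" if "i < n" for i
  proof -
    have "N (2 * boundary_point n i) = (2 * \<omega> * (1 + cis (- 2 * s i))) / (2 * \<omega> * (1 - cis (- 2 * s i)))"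
      unfolding N_def bp[OF that] by (simp add: algebra_simps)
    also have "\<dots> = (1 + cis (- 2 * s i)) / (1 - cis (- 2 * s i))"
      using \<omega>0 by (intro mult_divide_mult_cancel_left) simp
    also have "\<dots> = - \<i> * of_real (cot (s i))"
      using sin_gt_zero s[OF that] by (intro cayley_cis) force
    finally show ?thesis .
  qed
  have \<Phi>_bp: "vec_nth (\<Phi> (2 * boundary_point n i)) 1 = - cot (s i)" "vec_nth (\<Phi> (2 * boundary_point n i)) 2 = 0" if "i < n" for i
    unfolding \<Phi>_def N_bp[OF that] by auto
  have bp_ne_\<omega>: "boundary_point n i \<noteq> \<omega>" if "i < n" for i
  proof
    assume "boundary_point n i = \<omega>"
    then have "cis (- 2 * s i) = 1" using bp[OF that] \<omega>0 by simp
    then have "cos (2 * s i) = 1" by (simp add: complex_eq_iff)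
    then have "sin (s i) = 0" by (simp add: cos_double_sin)
    then show False using sin_gt_zero s[OF that] by force
  qed
  have bp_inj: "boundary_point n i \<noteq> boundary_point n j" if "i < j" "j < n" for i j
    using \<Phi>_bp(1)[of i] \<Phi>_bp(1)[of j] cot_strict_antimono[of "s i" "s j"] s s_mono that by force
  have Re_N: "Re (N z) = (4 - (norm z)\<^sup>2) / (norm (2 * \<omega> - z))\<^sup>2" for z
  proof -
    have "Re ((2 * \<omega> + z) * cnj (2 * \<omega> - z)) = 4 * (norm \<omega>)\<^sup>2 - (norm z)\<^sup>2"
      unfolding cmod_power2 by (simp add: algebra_simps power2_eq_square)
    then show ?thesis
      unfolding N_def by (subst complex_div_cnj) simp
  qed
  have inj: "inj_on N R"
  proof (rule inj_onI)
    fix x y assume "x \<in> R" "y \<in> R" "N x = N y"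
    then have "(2 * \<omega> + x) * (2 * \<omega> - y) = (2 * \<omega> + y) * (2 * \<omega> - x)"
      by (auto simp: N_def R_def frac_eq_eq)
    then have "4 * \<omega> * x = 4 * \<omega> * y" by (simp add: algebra_simps)
    then show "x = y" using \<omega>0 by simp
  qed
  have inj\<Phi>: "inj_on \<Phi> R"
  proof (rule inj_onI)
    fix x y assume xy: "x \<in> R" "y \<in> R" "\<Phi> x = \<Phi> y"
    have "vec_nth (\<Phi> z) 1 = Im (N z)" "vec_nth (\<Phi> z) 2 = Re (N z)" for z
      by (simp_all add: \<Phi>_def)
    then have "N x = N y" using xy by (metis complex_eq_iff)
    then show "x = y" using inj_onD[OF inj] xy by blast
  qed
  have cont: "continuous_on R \<Phi>"
  proof -
    have "continuous_on R N"
      unfolding N_def by (intro continuous_intros) (auto simp: R_def)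
    then have "continuous_on R (\<lambda>z. if i = 1 then Im (N z) else Re (N z))" for i :: 2
      by (cases "i = 1") (auto intro!: continuous_intros)
    then have "continuous_on R (\<lambda>z. vec_lambda (\<lambda>i::2. if i = 1 then Im (N z) else Re (N z)))"
      by (intro continuous_on_vec_lambda)
    moreover have "(\<lambda>z. vec_lambda (\<lambda>i::2. if i = 1 then Im (N z) else Re (N z))) = \<Phi>"
      by (auto simp: \<Phi>_def fun_eq_iff Finite_Cartesian_Product.vec_eq_iff forall_2)
    ultimately show ?thesis by (rule back_subst[where P = "continuous_on R"])
  qed
  define ext where "ext i j p = linepath (2 * boundary_point n i) (boundary_point n i) +++ p +++
    linepath (boundary_point n j) (2 * boundary_point n j)" for i j p
  have ray: "\<exists>r. 1 \<le> r \<and> r \<le> 2 \<and> z = of_real r * boundary_point n i"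
    if seg: "z \<in> closed_segment (2 * boundary_point n i) (boundary_point n i)" for i z
  proof -
    obtain u where u: "0 \<le> u" "u \<le> 1" "z = (1 - u) *\<^sub>R (2 * boundary_point n i) + u *\<^sub>R boundary_point n i"
      using seg unfolding in_segment(1) by metis
    then have "z = of_real (2 - u) * boundary_point n i"
      by (simp add: scaleR_conv_of_real algebra_simps)
    moreover have "1 \<le> 2 - u" "2 - u \<le> 2" using u by simp_all
    ultimately show ?thesis by metis
  qed
  have ext: "path (ext i j p)" "pathstart (ext i j p) = 2 * boundary_point n i"
    "pathfinish (ext i j p) = 2 * boundary_point n j"
    "path_image (ext i j p) = closed_segment (2 * boundary_point n i) (boundary_point n i) \<union> path_image p \<union>
      closed_segment (2 * boundary_point n j) (boundary_point n j)"
    if "path p" "pathstart p = boundary_point n i" "pathfinish p = boundary_point n j" for i j p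
    using that by (simp_all add: ext_def path_image_join closed_segment_commute[of "boundary_point n j"] Un_assoc)
  have ray_R: "closed_segment (2 * boundary_point n i) (boundary_point n i) \<subseteq> R" if "i < n" for i
  proof
    fix z assume "z \<in> closed_segment (2 * boundary_point n i) (boundary_point n i)"
    then obtain r where r: "1 \<le> r" "r \<le> 2" "z = of_real r * boundary_point n i" using ray by meson
    moreover have "z \<noteq> 2 * \<omega>"
    proof
      assume z: "z = 2 * \<omega>"
      have "norm z = r" using r by (simp add: norm_mult)
      then have "r = 2" using z by (simp add: norm_mult)
      then show False using z r bp_ne_\<omega>[OF that] by simp
    qed
    ultimately show "z \<in> R" by (simp add: R_def norm_mult)
  qed
  have disc_R: "cball 0 1 \<subseteq> R"
    by (auto simp: R_def norm_mult)
  let ?f = "ext a c f" and ?g = "ext b d g"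
  have sub: "path_image ?f \<subseteq> R" "path_image ?g \<subseteq> R"
    using ext(4)[OF f(1,3,4)] ext(4)[OF g(1,3,4)] ray_R[of a] ray_R[of b] ray_R[of c] ray_R[of d]
      disc_R f(2) g(2) lt by auto
  have paths: "path (\<Phi> \<circ> ?f)" "path (\<Phi> \<circ> ?g)"
    using path_continuous_image[OF ext(1)[OF f(1,3,4)] continuous_on_subset[OF cont sub(1)]]
      path_continuous_image[OF ext(1)[OF g(1,3,4)] continuous_on_subset[OF cont sub(2)]] by auto
  \<comment> \<open>The prolonged paths avoid the pole, so their images are bounded and fit into a
    box standing on the line of second coordinate 0.\<close>
  have "bounded (path_image (\<Phi> \<circ> ?f) \<union> path_image (\<Phi> \<circ> ?g))"
    using paths by (simp add: bounded_path_image)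
  then obtain B where B: "\<And>x. x \<in> path_image (\<Phi> \<circ> ?f) \<union> path_image (\<Phi> \<circ> ?g) \<Longrightarrow> norm x \<le> B"
    unfolding bounded_iff by blast
  have nonneg: "vec_nth (\<Phi> z) 2 \<ge> 0" if "z \<in> R" for z
  proof -
    have "(norm z)\<^sup>2 \<le> 2\<^sup>2" using that by (intro power_mono) (auto simp: R_def)
    then show ?thesis by (simp add: \<Phi>_def Re_N)
  qed
  have box: "x \<in> cbox (vector [- B, 0]) (vector [B, B])"
    if x: "x \<in> path_image (\<Phi> \<circ> ?f) \<union> path_image (\<Phi> \<circ> ?g)" for x
  proof -
    have "\<bar>vec_nth x 1\<bar> \<le> B" "\<bar>vec_nth x 2\<bar> \<le> B"
      using B[OF x] component_le_norm_cart order_trans by blast+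
    moreover have "vec_nth x 2 \<ge> 0"
      using x nonneg sub by (auto simp: path_image_compose)
    ultimately show ?thesis by (auto simp: mem_box_cart forall_2)
  qed
  have lts: "cot (s b) < cot (s a)" "cot (s c) < cot (s b)" "cot (s d) < cot (s c)"
    using lt s s_mono by (auto intro!: cot_strict_antimono)
  have st: "pathstart (\<Phi> \<circ> ?f) = \<Phi> (2 * boundary_point n a)" "pathfinish (\<Phi> \<circ> ?f) = \<Phi> (2 * boundary_point n c)"
    "pathstart (\<Phi> \<circ> ?g) = \<Phi> (2 * boundary_point n b)" "pathfinish (\<Phi> \<circ> ?g) = \<Phi> (2 * boundary_point n d)"
    using ext(2,3)[OF f(1,3,4)] ext(2,3)[OF g(1,3,4)] by (simp_all add: pathstart_compose pathfinish_compose)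
  have lt_n: "a < n" "b < n" "c < n" and lt_ad: "a < d" using lt by simp_all
  obtain w where w: "w \<in> path_image (\<Phi> \<circ> ?f)" "w \<in> path_image (\<Phi> \<circ> ?g)"
  proof (rule fashoda_interlace[OF paths, of "vector [- B, 0]" "vector [B, B]"])
    show "path_image (\<Phi> \<circ> ?f) \<subseteq> cbox (vector [- B, 0]) (vector [B, B])"
      "path_image (\<Phi> \<circ> ?g) \<subseteq> cbox (vector [- B, 0]) (vector [B, B])"
      using box by blast+
  qed (simp_all add: st \<Phi>_bp lts lt_n lt(4))
  obtain z z' where zz: "z \<in> path_image ?f" "w = \<Phi> z" "z' \<in> path_image ?g" "w = \<Phi> z'"
    using w unfolding path_image_compose by blast
  then have "z = z'"
    using sub by (intro inj_onD[OF inj\<Phi>]) auto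
  then have z: "z \<in> path_image ?f" "z \<in> path_image ?g" using zz by auto
  have ends: "boundary_point n a \<in> path_image f" "boundary_point n c \<in> path_image f"
    "boundary_point n b \<in> path_image g" "boundary_point n d \<in> path_image g"
    using pathstart_in_path_image[of f] pathfinish_in_path_image[of f]
      pathstart_in_path_image[of g] pathfinish_in_path_image[of g] f g by simp_all
  have ray_disc: "z = boundary_point n i" if seg: "z \<in> closed_segment (2 * boundary_point n i) (boundary_point n i)"
    and le: "norm z \<le> 1" for i
  proof -
    obtain r where r: "1 \<le> r" "z = of_real r * boundary_point n i" using ray[OF seg] by metis
    then have "norm z = r" by (simp add: norm_mult)
    then show ?thesis using r le by simp
  qed
  have ray_ray: False if seg: "z \<in> closed_segment (2 * boundary_point n i) (boundary_point n i)"
    "z \<in> closed_segment (2 * boundary_point n j) (boundary_point n j)" and ij: "i < j" "j < n" for i j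
  proof -
    obtain r r' where r: "1 \<le> r" "z = of_real r * boundary_point n i" "1 \<le> r'" "z = of_real r' * boundary_point n j"
      using ray[OF seg(1)] ray[OF seg(2)] by metis
    have "norm z = r" using r(1,2) by (simp add: norm_mult)
    moreover have "norm z = r'" using r(3,4) by (simp add: norm_mult)
    ultimately show False using r bp_inj[OF ij] by simp
  qed
  have zf: "z \<in> closed_segment (2 * boundary_point n a) (boundary_point n a) \<or> z \<in> path_image f \<or>
      z \<in> closed_segment (2 * boundary_point n c) (boundary_point n c)"
    using z ext(4)[OF f(1,3,4)] by auto
  have zg: "z \<in> closed_segment (2 * boundary_point n b) (boundary_point n b) \<or> z \<in> path_image g \<or>
      z \<in> closed_segment (2 * boundary_point n d) (boundary_point n d)"
    using z ext(4)[OF g(1,3,4)] by auto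
  \<comment> \<open>Rays of different labels are disjoint, so a common point on a ray of one path
    must lie on the unprolonged part of the other. Inside the unit disk a ray consists only of its
    boundary point, which the original path already contains.\<close>
  have "norm z \<le> 1"
    using zf
  proof (elim disjE)
    assume "z \<in> path_image f"
    then show ?thesis using f(2) by auto
  next
    assume "z \<in> closed_segment (2 * boundary_point n a) (boundary_point n a)"
    then have "z \<in> path_image g"
      using zg ray_ray[of a b] ray_ray[of a d] lt lt_ad lt_n by blast
    then show ?thesis using g(2) by auto
  next
    assume "z \<in> closed_segment (2 * boundary_point n c) (boundary_point n c)"
    then have "z \<in> path_image g"
      using zg ray_ray[of b c] ray_ray[of c d] lt lt_n by blast
    then show ?thesis using g(2) by auto
  qed
  have "z \<in> path_image f"
    using zf ray_disc[of a] ray_disc[of c] \<open>norm z \<le> 1\<close> ends(1,2) by metis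
  moreover have "z \<in> path_image g"
    using zg ray_disc[of b] ray_disc[of d] \<open>norm z \<le> 1\<close> ends(3,4) by metis
  ultimately show ?thesis by blast
qed

section \<open>Components of the network as drawn in the cactus\<close>

lemma same_component_refl [simp]: "same_component G F u u"
  by (simp add: same_component_def)

lemma same_component_trans:
  "same_component G F u v \<Longrightarrow> same_component G F v w \<Longrightarrow> same_component G F u w"
  unfolding same_component_def by (rule rtrancl_trans)

lemma same_component_sym: "same_component G F u v \<Longrightarrow> same_component G F v u"
proof -
  have "sym {(x, y). \<exists>e\<in>F. ends G e = {x, y}}"
    by (auto simp: sym_def insert_commute)
  then show "same_component G F u v \<Longrightarrow> same_component G F v u"
    unfolding same_component_def by (meson sym_rtrancl symD)
qed

lemma same_component_edge: "e \<in> F \<Longrightarrow> ends G e = {x, y} \<Longrightarrow> same_component G F x y"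
  unfolding same_component_def by (auto intro!: r_into_rtrancl)

lemma same_component_induct [consumes 1, case_names refl step]:
  assumes "same_component G F u v" "P u"
    and "\<And>x y e. same_component G F u x \<Longrightarrow> e \<in> F \<Longrightarrow> ends G e = {x, y} \<Longrightarrow> P x \<Longrightarrow> P y"
  shows "P v"
  using assms(1) unfolding same_component_def
  by (induction rule: rtrancl_induct) (use assms(2,3) in \<open>auto simp: same_component_def\<close>)

lemma is_cactus_networkD:
  assumes "is_cactus_network n G"
  shows "noncrossing_partition {..<n} (shape G)" "finite (verts G)" "finite (edges G)"
    "verts G \<subseteq> topspace (cactus_topology n (shape G))" "boundary_verts n G \<subseteq> verts G"
    "\<And>e. e \<in> edges G \<Longrightarrow> conductance G e > 0"
    "\<And>e. e \<in> edges G \<Longrightarrow> pathin (cactus_topology n (shape G)) (curve G e)"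
    "\<And>e. e \<in> edges G \<Longrightarrow> ends G e \<subseteq> verts G"
    "\<And>e. e \<in> edges G \<Longrightarrow> curve G e ` {0<..<1} \<inter> verts G = {}"
    "\<And>e e'. e \<in> edges G \<Longrightarrow> e' \<in> edges G \<Longrightarrow> e \<noteq> e' \<Longrightarrow> curve G e ` {0<..<1} \<inter> curve G e' ` {0<..<1} = {}"
  using assms unfolding is_cactus_network_def ends_def by simp_all

lemma same_component_verts:
  assumes "is_cactus_network n G" "F \<subseteq> edges G" "same_component G F u v" "u \<in> verts G"
  shows "v \<in> verts G"
  using assms(3)
proof (induction rule: same_component_induct)
  case (step x y e)
  then show ?case
    using is_cactus_networkD(8)[OF assms(1)] assms(2) by blast
qed (rule assms(4))

text \<open>Edges enter as open arcs, so every point is either a vertex or belongs to the interior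
  of an edge. Testing only \<open>curve G e 0\<close> loses nothing, since an edge of
  \<open>F\<close> joins its two ends.\<close>

definition component_drawing :: "'e cactus_network \<Rightarrow> 'e set \<Rightarrow> complex set \<Rightarrow> complex set set" where
  "component_drawing G F u = {v. same_component G F u v} \<union>
     \<Union>((\<lambda>e. curve G e ` {0<..<1}) ` {e \<in> F. same_component G F u (curve G e 0)})"

text \<open>Open arcs of distinct edges are disjoint and contain no vertex, so a common point would
  be a vertex of both components or lie on an edge belonging to both.\<close>

lemma component_drawing_disjoint:
  assumes G: "is_cactus_network n G" and F: "F \<subseteq> edges G"
    and uv: "u \<in> verts G" "v \<in> verts G" "\<not> same_component G F u v"
  shows "component_drawing G F u \<inter> component_drawing G F v = {}"
proof -
  have sep: "\<not> (same_component G F u w \<and> same_component G F v w)" for w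
    using uv same_component_sym same_component_trans by blast
  have mixed: "w \<notin> curve G e ` {0<..<1}" if "same_component G F z w" "z \<in> verts G" "e \<in> F" for z w e
    using same_component_verts[OF G F that(1,2)] is_cactus_networkD(9)[OF G, of e] F that(3) by auto
  have edges: "curve G e ` {0<..<1} \<inter> curve G e' ` {0<..<1} = {}"
    if "e \<in> F" "same_component G F u (curve G e 0)" "e' \<in> F" "same_component G F v (curve G e' 0)" for e e'
  proof -
    have "e \<noteq> e'" using that sep by auto
    then show ?thesis using is_cactus_networkD(10)[OF G, of e e'] F that by auto
  qed
  have cases: "same_component G F u w \<or>
      (\<exists>e\<in>F. same_component G F u (curve G e 0) \<and> w \<in> curve G e ` {0<..<1})"
    if "w \<in> component_drawing G F u" for u w
    using that by (auto simp: component_drawing_def)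
  show ?thesis
  proof (rule equals0I, elim IntE)
    fix w assume "w \<in> component_drawing G F u" "w \<in> component_drawing G F v"
    from this[THEN cases] show False
    proof (elim disjE bexE conjE)
      fix e e' assume "e \<in> F" "same_component G F u (curve G e 0)" "w \<in> curve G e ` {0<..<1}"
        "e' \<in> F" "same_component G F v (curve G e' 0)" "w \<in> curve G e' ` {0<..<1}"
      then show False using edges[of e e'] by (meson disjoint_iff)
    next
      assume "same_component G F u w" "same_component G F v w"
      then show False using sep[of w] by simp
    next
      fix e assume "same_component G F u w" "e \<in> F" "w \<in> curve G e ` {0<..<1}"
      then show False using mixed[OF _ uv(1)] by metis
    next
      fix e assume "same_component G F v w" "e \<in> F" "w \<in> curve G e ` {0<..<1}"
      then show False using mixed[OF _ uv(2)] by metis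
    qed
  qed
qed

text \<open>Follow a walk from \<open>u\<close> to \<open>v\<close> and unite the closed arcs of its
  edges: consecutive arcs share a vertex, and finitely many path images are compact.\<close>

lemma component_drawing_continuum:
  assumes G: "is_cactus_network n G" and F: "F \<subseteq> edges G"
    and u: "u \<in> verts G" and uv: "same_component G F u v"
  shows "\<exists>Y. connectedin (cactus_topology n (shape G)) Y \<and> compactin (cactus_topology n (shape G)) Y \<and>
    u \<in> Y \<and> v \<in> Y \<and> Y \<subseteq> component_drawing G F u"
  using uv
proof (induction rule: same_component_induct)
  case refl
  have "u \<in> topspace (cactus_topology n (shape G))"
    using is_cactus_networkD(4)[OF G] u by blast
  then show ?case
    by (intro exI[of _ "{u}"]) (auto simp: component_drawing_def)
next
  case (step x y e)
  then obtain Y where Y: "connectedin (cactus_topology n (shape G)) Y"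
    "compactin (cactus_topology n (shape G)) Y" "u \<in> Y" "x \<in> Y" "Y \<subseteq> component_drawing G F u" by blast
  let ?Z = "curve G e ` {0..1}"
  have path: "pathin (cactus_topology n (shape G)) (curve G e)"
    using is_cactus_networkD(7)[OF G] step F by blast
  have e: "{curve G e 0, curve G e 1} = {x, y}"
    using step(3) by (simp add: ends_def)
  have "same_component G F u y"
    by (rule same_component_trans[OF step(1) same_component_edge[OF step(2,3)]])
  then have ends: "same_component G F u (curve G e 0)" "same_component G F u (curve G e 1)"
    using e step(1) by (metis doubleton_eq_iff)+
  have "{0..1::real} = insert 0 (insert 1 {0<..<1})" by auto
  then have Z: "?Z = insert (curve G e 0) (insert (curve G e 1) (curve G e ` {0<..<1}))"
    by (metis image_insert)
  have "x \<in> {curve G e 0, curve G e 1}" "y \<in> {curve G e 0, curve G e 1}" unfolding e by simp_all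
  then have xy: "x \<in> ?Z" "y \<in> ?Z" unfolding Z by blast+
  show ?case
  proof (intro exI[of _ "Y \<union> ?Z"] conjI)
    show "connectedin (cactus_topology n (shape G)) (Y \<union> ?Z)"
      using Y xy by (intro connectedin_Un connectedin_path_image[OF path]) auto
    show "compactin (cactus_topology n (shape G)) (Y \<union> ?Z)"
      using Y by (intro compactin_Un compactin_path_image[OF path])
    show "Y \<union> ?Z \<subseteq> component_drawing G F u"
      using Y(5) ends step(2) unfolding Z component_drawing_def by auto
  qed (use Y xy in auto)
qed

text \<open>Preimages of closed connected sets under a monotone quotient map are connected;
  \<open>Y\<close> is closed because it is compact in a Hausdorff space.\<close>

lemma connected_preimage_of_continuum:
  assumes P: "noncrossing_partition {..<n} P"
    and Y: "connectedin (cactus_topology n P) Y" "compactin (cactus_topology n P) Y"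
  defines "K \<equiv> {x \<in> cball 0 1. cactus_class n P x \<in> Y}"
  shows "connected K" "compact K"
proof -
  have closed: "closedin (cactus_topology n P) Y"
    using Y(2) Hausdorff_space_cactus_topology[OF P] by (rule compactin_imp_closedin[rotated])
  have "connectedin (top_of_set (cball 0 1)) K"
    using connectedin_monotone_quotient_map_preimage[OF monotone_map_cactus_class[OF P]
        quotient_map_cactus_class Y(1)] closed by (simp add: K_def)
  then show "connected K" by (simp add: connectedin_subtopology)
  have "closedin (top_of_set (cball 0 1)) K"
    using closedin_continuous_map_preimage[OF quotient_imp_continuous_map[OF quotient_map_cactus_class] closed]
    by (simp add: K_def)
  then show "compact K"
    using closedin_compact compact_cball by blast
qed

lemma crossing_components_meet:
  assumes G: "is_cactus_network n G" and F: "F \<subseteq> edges G"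
    and lt: "a < b" "b < c" "c < d" "d < n"
    and ac: "same_component G F (boundary_vertex n G a) (boundary_vertex n G c)"
    and bd: "same_component G F (boundary_vertex n G b) (boundary_vertex n G d)"
  shows "same_component G F (boundary_vertex n G a) (boundary_vertex n G b)"
proof (rule ccontr)
  assume sep: "\<not> ?thesis"
  let ?v = "boundary_vertex n G" and ?top = "cactus_topology n (shape G)"
  let ?q = "cactus_class n (shape G)"
  note P = is_cactus_networkD(1)[OF G]
  have verts: "?v i \<in> verts G" if "i < n" for i
    using is_cactus_networkD(5)[OF G] that by (auto simp: boundary_verts_def)
  obtain Y1 where Y1: "connectedin ?top Y1" "compactin ?top Y1" "?v a \<in> Y1" "?v c \<in> Y1"
    "Y1 \<subseteq> component_drawing G F (?v a)"
    using component_drawing_continuum[OF G F _ ac] verts lt by auto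
  obtain Y2 where Y2: "connectedin ?top Y2" "compactin ?top Y2" "?v b \<in> Y2" "?v d \<in> Y2"
    "Y2 \<subseteq> component_drawing G F (?v b)"
    using component_drawing_continuum[OF G F _ bd] verts lt by auto
  have "Y1 \<inter> Y2 = {}"
    using component_drawing_disjoint[OF G F _ _ sep] verts lt Y1(5) Y2(5) by fastforce
  define K1 where "K1 = {x \<in> cball 0 1. ?q x \<in> Y1}"
  define K2 where "K2 = {x \<in> cball 0 1. ?q x \<in> Y2}"
  have K: "connected K1" "compact K1" "connected K2" "compact K2" "K1 \<subseteq> cball 0 1" "K2 \<subseteq> cball 0 1"
    unfolding K1_def K2_def
    using connected_preimage_of_continuum[OF P Y1(1,2)] connected_preimage_of_continuum[OF P Y2(1,2)] by auto
  have mem: "boundary_point n a \<in> K1" "boundary_point n c \<in> K1" "boundary_point n b \<in> K2" "boundary_point n d \<in> K2"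
    using Y1 Y2 by (auto simp: K1_def K2_def boundary_vertex_def)
  have "K1 \<inter> K2 = {}"
    using \<open>Y1 \<inter> Y2 = {}\<close> by (auto simp: K1_def K2_def)
  \<comment> \<open>Paths staying within half the distance of \<open>K1\<close> and of
    \<open>K2\<close> cannot meet, whereas their interlaced ends force them to.\<close>
  define e where "e = setdist K1 K2 / 2"
  have "setdist K1 K2 > 0"
    using K mem \<open>K1 \<inter> K2 = {}\<close> setdist_gt_0_compact_closed compact_imp_closed by blast
  then have "e > 0" by (simp add: e_def)
  obtain f where f: "path f" "pathstart f = boundary_point n a" "pathfinish f = boundary_point n c"
    "path_image f \<subseteq> cball 0 1" "\<And>z. z \<in> path_image f \<Longrightarrow> \<exists>x\<in>K1. dist x z < e"
    using thin_path_in_disc[OF K(1,5) mem(1,2) \<open>e > 0\<close>] by blast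
  obtain g where g: "path g" "pathstart g = boundary_point n b" "pathfinish g = boundary_point n d"
    "path_image g \<subseteq> cball 0 1" "\<And>z. z \<in> path_image g \<Longrightarrow> \<exists>x\<in>K2. dist x z < e"
    using thin_path_in_disc[OF K(3,6) mem(3,4) \<open>e > 0\<close>] by blast
  obtain z where "z \<in> path_image f" "z \<in> path_image g"
    using disc_chords_intersect[OF lt f(1,4,2,3) g(1,4,2,3)] by blast
  then obtain x y where xy: "x \<in> K1" "y \<in> K2" "dist x z < e" "dist y z < e"
    using f(5) g(5) by blast
  then have "dist x y < 2 * e"
    using dist_triangle2[of x y z] by simp
  moreover have "setdist K1 K2 \<le> dist x y"
    using xy by (intro setdist_le_dist)
  ultimately show False by (simp add: e_def)
qed

abbreviation boundary_rel :: "nat \<Rightarrow> 'e cactus_network \<Rightarrow> 'e set \<Rightarrow> (nat \<times> nat) set" where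
  "boundary_rel n G F \<equiv> {(i, j). i < n \<and> j < n \<and>
     same_component G F (boundary_vertex n G i) (boundary_vertex n G j)}"

lemma equiv_boundary_rel: "equiv {..<n} (boundary_rel n G F)"
  by (rule equivI) (auto simp: refl_on_def sym_def trans_def intro: same_component_sym same_component_trans)

lemma partition_on_grove_partition: "partition_on {..<n} (grove_partition n G F)"
  unfolding grove_partition_def by (intro partition_on_quotient equiv_boundary_rel)

lemma grove_partition_same_block:
  assumes "B \<in> grove_partition n G F" "i \<in> B"
  shows "j \<in> B \<longleftrightarrow> j < n \<and> same_component G F (boundary_vertex n G i) (boundary_vertex n G j)"
    and "i < n"
proof -
  have "B \<in> {..<n} // boundary_rel n G F"
    using assms(1) by (simp add: grove_partition_def)
  then obtain x where "B = boundary_rel n G F `` {x}" by (rule quotientE)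
  moreover from this have xi: "(x, i) \<in> boundary_rel n G F" using assms(2) by simp
  ultimately have "B = boundary_rel n G F `` {i}"
    using equiv_class_eq[OF equiv_boundary_rel xi] by simp
  then show "i < n" "j \<in> B \<longleftrightarrow> j < n \<and> same_component G F (boundary_vertex n G i) (boundary_vertex n G j)"
    using xi by auto
qed

lemma noncrossing_grove_partition:
  assumes G: "is_cactus_network n G" and F: "F \<subseteq> edges G"
  shows "noncrossing_partition {..<n} (grove_partition n G F)"
  unfolding noncrossing_partition_def
proof (intro conjI ballI allI impI partition_on_grove_partition)
  fix B C a b c d
  assume BC: "B \<in> grove_partition n G F" "C \<in> grove_partition n G F"
    and *: "a < b \<and> b < c \<and> c < d \<and> a \<in> B \<and> c \<in> B \<and> b \<in> C \<and> d \<in> C"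
  have "same_component G F (boundary_vertex n G a) (boundary_vertex n G b)"
    using crossing_components_meet[OF G F, of a b c d] grove_partition_same_block(1)[OF BC(1), of a c]
      grove_partition_same_block(1)[OF BC(2), of b d] * by simp
  then have "b \<in> B"
    using grove_partition_same_block(1)[OF BC(1), of a b] grove_partition_same_block(2)[OF BC(2), of b] * by simp
  then show "B = C"
    using disjointD[OF partition_onD2[OF partition_on_grove_partition] BC] * by auto
qed

section \<open>Spanning forests and effective resistance\<close>

lemma same_component_mono: "same_component G H u v \<Longrightarrow> H \<subseteq> F \<Longrightarrow> same_component G F u v"
  unfolding same_component_def by (rule rtrancl_mono[THEN subsetD, rotated]) auto

text \<open>A walk can be shortened until it uses the added edge at most once; the last two
  alternatives are the two directions of that use.\<close>

lemma same_component_insert: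
  assumes "same_component G (insert e H) a b" "ends G e = {x, y}"
  shows "same_component G H a b \<or> same_component G H a x \<and> same_component G H y b \<or>
    same_component G H a y \<and> same_component G H x b"
  using assms(1)
proof (induction rule: same_component_induct)
  case (step c d e')
  show ?case
  proof (cases "e' \<in> H")
    case True
    then have "same_component G H c d" using step by (intro same_component_edge)
    then show ?thesis using step.IH same_component_trans by metis
  next
    case False
    then have "{c, d} = {x, y}" using step assms by auto
    then consider "c = x" "d = y" | "c = y" "d = x" by (metis doubleton_eq_iff)
    then show ?thesis
      by cases (use step.IH same_component_trans same_component_refl in metis)+
  qed
qed simp

text \<open>Acyclicity in the form that every edge is a bridge, which is easier to maintain than the
  absence of cycles when edges are added or removed. Loops are excluded because a vertex lies in its
  own component.\<close>

definition forest :: "'e cactus_network \<Rightarrow> 'e set \<Rightarrow> bool" where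
  "forest G F \<longleftrightarrow> (\<forall>e\<in>F. \<forall>x y. ends G e = {x, y} \<longrightarrow> \<not> same_component G (F - {e}) x y)"

lemma forest_subset:
  assumes "forest G F" "H \<subseteq> F"
  shows "forest G H"
  unfolding forest_def
proof (intro ballI allI impI)
  fix e x y assume "e \<in> H" "ends G e = {x, y}"
  then show "\<not> same_component G (H - {e}) x y"
    using assms same_component_mono[of G "H - {e}" x y "F - {e}"] unfolding forest_def by blast
qed

text \<open>If an old edge \<open>e'\<close> could be bypassed through the new edge
  \<open>e\<close>, then going round the other way, through \<open>e'\<close>, would already join
  the ends of \<open>e\<close> inside \<open>F\<close>.\<close>

lemma forest_insert:
  assumes "forest G F" "e \<notin> F" "ends G e = {x, y}" "\<not> same_component G F x y"
  shows "forest G (insert e F)"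
  unfolding forest_def
proof (intro ballI allI impI notI)
  fix e' a b assume e': "e' \<in> insert e F" "ends G e' = {a, b}"
    and ab: "same_component G (insert e F - {e'}) a b"
  show False
  proof (cases "e' = e")
    case True
    then have "{a, b} = {x, y}" "same_component G F a b" using assms e' ab by auto
    then show False using assms same_component_sym by (metis doubleton_eq_iff)
  next
    case False
    let ?H = "F - {e'}"
    have "same_component G (insert e ?H) a b" using ab False by (metis insert_Diff_if singletonD)
    moreover have "\<not> same_component G ?H a b" using assms(1) e' False unfolding forest_def by blast
    ultimately have "same_component G ?H a x \<and> same_component G ?H y b \<or>
        same_component G ?H a y \<and> same_component G ?H x b"
      using same_component_insert assms(3) by metis
    then have "same_component G F a x \<and> same_component G F y b \<or>
        same_component G F a y \<and> same_component G F x b"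
      using same_component_mono[of G ?H _ _ F] by blast
    moreover have "same_component G F a b" using e' False by (intro same_component_edge) auto
    ultimately show False using assms(4) same_component_sym same_component_trans by metis
  qed
qed

lemma same_component_simple_path:
  assumes "same_component G H x y"
  shows "\<exists>vs es. vs \<noteq> [] \<and> vs ! 0 = x \<and> last vs = y \<and> distinct vs \<and> length vs = Suc (length es) \<and>
    set es \<subseteq> H \<and> (\<forall>i<length es. ends G (es ! i) = {vs ! i, vs ! Suc i})"
  using assms
proof (induction rule: same_component_induct)
  case refl
  show ?case by (intro exI[of _ "[x]"] exI[of _ "[]"]) simp
next
  case (step c d e)
  then obtain vs es where p: "vs \<noteq> []" "vs ! 0 = x" "last vs = c" "distinct vs" "length vs = Suc (length es)"
    "set es \<subseteq> H" "\<And>i. i < length es \<Longrightarrow> ends G (es ! i) = {vs ! i, vs ! Suc i}" by blast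
  show ?case
  proof (cases "d \<in> set vs")
    \<comment> \<open>The walk returns to a vertex already visited; only the initial piece up to
      that vertex is kept.\<close>
    case True
    then obtain k where k: "k < length vs" "vs ! k = d" by (auto simp: in_set_conv_nth)
    have "last (take (Suc k) vs) = d"
      using k by (simp add: take_Suc_conv_app_nth)
    then show ?thesis
      using p k set_take_subset[of k es]
      by (intro exI[of _ "take (Suc k) vs"] exI[of _ "take k es"]) auto
  next
    case False
    have "ends G ((es @ [e]) ! i) = {(vs @ [d]) ! i, (vs @ [d]) ! Suc i}" if "i < Suc (length es)" for i
    proof (cases "i < length es")
      case True
      then show ?thesis using p by (simp add: nth_append)
    next
      case False
      then have "i = length es" using that by simp
      then show ?thesis using p step(3) by (simp add: nth_append last_conv_nth)
    qed
    then show ?thesis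
      using p False step(2) by (intro exI[of _ "vs @ [d]"] exI[of _ "es @ [e]"]) (auto simp: nth_append)
  qed
qed

text \<open>The last edge of a cycle is bypassed by the others; conversely an edge that is not a
  bridge closes a simple path avoiding it. A loop gives a cycle of length one and a pair of parallel
  edges one of length two.\<close>

lemma forest_iff_no_cycle: "forest G F \<longleftrightarrow> (\<nexists>vs es. is_cycle G F vs es)"
proof
  assume forest: "forest G F"
  show "\<nexists>vs es. is_cycle G F vs es"
  proof (intro notI, elim exE)
    fix vs es assume cyc: "is_cycle G F vs es"
    then have c: "es \<noteq> []" "length vs = length es" "distinct es" "set es \<subseteq> F"
      "\<And>i. i < length es \<Longrightarrow> ends G (es ! i) = {vs ! i, vs ! ((i + 1) mod length vs)}"
      unfolding is_cycle_def by auto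
    define k where "k = length es - 1"
    have k: "length es = Suc k" using c(1) by (simp add: k_def)
    have "same_component G (F - {es ! k}) (vs ! 0) (vs ! i)" if "i \<le> k" for i
      using that
    proof (induction i)
      case (Suc i)
      then have "es ! i \<in> F - {es ! k}"
        using c(3,4) k nth_mem[of i es] by (auto simp: nth_eq_iff_index_eq)
      moreover have "ends G (es ! i) = {vs ! i, vs ! Suc i}"
        using c(5)[of i] c(2) k Suc by simp
      ultimately show ?case
        using Suc same_component_edge same_component_trans by (metis Suc_leD)
    qed simp
    from this[OF order_refl] have "same_component G (F - {es ! k}) (vs ! k) (vs ! 0)"
      by (rule same_component_sym)
    moreover have "ends G (es ! k) = {vs ! k, vs ! 0}" using c(5)[of k] c(2) k by simp
    moreover have "es ! k \<in> F" using c(4) k nth_mem[of k es] by auto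
    ultimately show False using forest unfolding forest_def by blast
  qed
next
  assume nocyc: "\<nexists>vs es. is_cycle G F vs es"
  show "forest G F"
    unfolding forest_def
  proof (intro ballI allI impI notI)
    fix e x y assume e: "e \<in> F" "ends G e = {x, y}" "same_component G (F - {e}) x y"
    obtain vs es where p: "vs \<noteq> []" "vs ! 0 = x" "last vs = y" "distinct vs" "length vs = Suc (length es)"
      "set es \<subseteq> F - {e}" "\<And>i. i < length es \<Longrightarrow> ends G (es ! i) = {vs ! i, vs ! Suc i}"
      using same_component_simple_path[OF e(3)] by blast
    have "es ! i \<noteq> es ! j" if "i < j" "j < length es" for i j
    proof
      assume "es ! i = es ! j"
      then have "vs ! i \<in> {vs ! j, vs ! Suc j}" using p(7)[of i] p(7)[of j] that by auto
      then show False using that p(4,5) by (auto simp: nth_eq_iff_index_eq)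
    qed
    then have "distinct es"
      unfolding distinct_conv_nth by (metis linorder_neqE_nat)
    moreover have "ends G ((es @ [e]) ! i) = {vs ! i, vs ! ((i + 1) mod length vs)}"
      if "i < Suc (length es)" for i
    proof (cases "i < length es")
      case True
      then show ?thesis using p by (simp add: nth_append)
    next
      case False
      then have "i = length es" using that by simp
      then show ?thesis using p e(2) by (auto simp: nth_append last_conv_nth)
    qed
    ultimately have "is_cycle G F vs (es @ [e])"
      using p e(1) unfolding is_cycle_def by auto
    then show False using nocyc by blast
  qed
qed

lemma sum_of_bool_single:
  fixes f :: "'a \<Rightarrow> real"
  assumes "\<And>w. P w \<longleftrightarrow> w = v" "finite V" "v \<in> V"
  shows "(\<Sum>w\<in>V. of_bool (P w) * c * f w) = c * f v"
proof -
  have "(\<Sum>w\<in>V. of_bool (P w) * c * f w) = (\<Sum>w\<in>{v}. of_bool (P w) * c * f w)"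
    using assms by (intro sum.mono_neutral_right) auto
  then show ?thesis using assms(1) by simp
qed

lemma sum_rotate:
  "(\<Sum>x\<in>A. \<Sum>y\<in>B. \<Sum>z\<in>C. f x y z) = (\<Sum>z\<in>C. \<Sum>x\<in>A. \<Sum>y\<in>B. f x y z)"
proof -
  have "(\<Sum>y\<in>B. \<Sum>z\<in>C. f x y z) = (\<Sum>z\<in>C. \<Sum>y\<in>B. f x y z)" for x
    by (rule sum.swap)
  then have "(\<Sum>x\<in>A. \<Sum>y\<in>B. \<Sum>z\<in>C. f x y z) = (\<Sum>x\<in>A. \<Sum>z\<in>C. \<Sum>y\<in>B. f x y z)"
    by (intro sum.cong refl)
  also have "\<dots> = (\<Sum>z\<in>C. \<Sum>x\<in>A. \<Sum>y\<in>B. f x y z)"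
    by (rule sum.swap)
  finally show ?thesis .
qed

section \<open>Spanning trees, two-component forests and Kirchhoff's potential\<close>

definition spanning_tree :: "'e cactus_network \<Rightarrow> 'e set \<Rightarrow> bool" where
  "spanning_tree G T \<longleftrightarrow> T \<subseteq> edges G \<and> forest G T \<and>
     (\<forall>u\<in>verts G. \<forall>v\<in>verts G. same_component G T u v)"

definition separating_forest :: "'e cactus_network \<Rightarrow> complex set \<Rightarrow> complex set \<Rightarrow> 'e set \<Rightarrow> bool" where
  "separating_forest G u v F \<longleftrightarrow> F \<subseteq> edges G \<and> forest G F \<and> \<not> same_component G F u v \<and>
     (\<forall>w\<in>verts G. same_component G F u w \<or> same_component G F v w)"

definition tree_weight :: "'e cactus_network \<Rightarrow> real" where
  "tree_weight G = (\<Sum>T | spanning_tree G T. grove_weight G T)"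

text \<open>Take a connected spanning edge set of least cardinality: an edge that is not a bridge
  could be dropped from it.\<close>

lemma spanning_tree_exists:
  assumes "finite (edges G)" "network_connected G"
  shows "\<exists>T. spanning_tree G T"
proof -
  let ?P = "\<lambda>F. F \<subseteq> edges G \<and> (\<forall>u\<in>verts G. \<forall>v\<in>verts G. same_component G F u v)"
  have "?P (edges G)" using assms(2) unfolding network_connected_def by blast
  then obtain T where T: "?P T" and min: "\<And>F. ?P F \<Longrightarrow> card T \<le> card F"
    using ex_has_least_nat[of ?P "edges G" card] by blast
  have "forest G T"
    unfolding forest_def
  proof (intro ballI allI impI notI)
    fix e x y assume e: "e \<in> T" "ends G e = {x, y}" "same_component G (T - {e}) x y"
    have "same_component G (T - {e}) u v" if "same_component G T u v" for u v
      using same_component_insert[of G e "T - {e}" u v x y] that e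
        same_component_trans same_component_sym by (metis insert_Diff)
    then have "card T \<le> card (T - {e})" using T by (intro min) auto
    moreover have "finite T" using T assms(1) finite_subset by blast
    ultimately show False using e(1) by (meson card_Diff1_less not_le)
  qed
  then show ?thesis using T unfolding spanning_tree_def by blast
qed

lemma tree_weight_pos:
  assumes "is_cactus_network n G" "network_connected G"
  shows "tree_weight G > 0"
  unfolding tree_weight_def
proof (rule sum_pos)
  have fin: "finite (edges G)" using is_cactus_networkD(3)[OF assms(1)] .
  then show "finite {T. spanning_tree G T}"
    by (rule finite_subset[rotated, OF finite_Pow_iff[THEN iffD2]]) (auto simp: spanning_tree_def)
  show "{T. spanning_tree G T} \<noteq> {}" using spanning_tree_exists[OF fin assms(2)] by blast
  fix T assume "T \<in> {T. spanning_tree G T}"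
  then show "grove_weight G T > 0"
    unfolding grove_weight_def using is_cactus_networkD(6)[OF assms(1)]
    by (intro prod_pos) (auto simp: spanning_tree_def)
qed

text \<open>
  The left-hand side is the net number of times that the path from \<open>u\<close> to \<open>v\<close> enters \<open>x\<close>.
  Extending the path by one edge \<open>e0\<close> only changes the summand of \<open>e0\<close>.
\<close>

lemma tree_path_flow:
  assumes T: "forest G T" "finite T" and V: "finite (verts G)" "\<And>e. e \<in> T \<Longrightarrow> ends G e \<subseteq> verts G"
    and uv: "same_component G T u v"
  shows "(\<Sum>w\<in>verts G. \<Sum>e\<in>T. of_bool (ends G e = {x, w}) * of_bool (\<not> same_component G (T - {e}) u v) *
      (of_bool (same_component G (T - {e}) u w) - of_bool (same_component G (T - {e}) u x))) =
    (of_bool (x = v) - of_bool (x = u) :: real)"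
  (is "?flow v = _")
  using uv
proof (induction rule: same_component_induct)
  case refl
  show ?case by simp
next
  case (step v v' e0)
  let ?s = "\<lambda>e. same_component G (T - {e})"
  let ?d = "\<lambda>e w. of_bool (?s e u w) - of_bool (?s e u x) :: real"
  let ?g = "\<lambda>v w e. of_bool (ends G e = {x, w}) * of_bool (\<not> ?s e u v) * ?d e w :: real"
  have other: "?s e u v = ?s e u v'" if "e \<in> T" "e \<noteq> e0" for e
  proof -
    have "?s e v v'" using step that by (intro same_component_edge[of e0]) auto
    then show ?thesis using same_component_trans same_component_sym by metis
  qed
  have sep: "\<not> ?s e0 v v'" using T(1) step unfolding forest_def by blast
  then have ne: "v \<noteq> v'" by auto
  have "?s e0 u v \<or> ?s e0 u v'"
    using same_component_insert[of G e0 "T - {e0}" u v v v'] step insert_Diff[of e0 T] by auto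
  \<comment> \<open>The walk may backtrack, so \<open>e0\<close> is either appended to the tree path
    or erased from its end. In both cases exactly one of \<open>v\<close>, \<open>v'\<close> stays
    with \<open>u\<close> when \<open>e0\<close> is removed, and the signed summand treats both
    alike.\<close>
  then have one: "?s e0 u v' \<longleftrightarrow> \<not> ?s e0 u v"
    using sep same_component_trans same_component_sym by metis
  have "?flow v' - ?flow v = (\<Sum>w\<in>verts G. \<Sum>e\<in>T. ?g v' w e - ?g v w e)"
    by (simp add: sum_subtractf)
  also have "\<dots> = (\<Sum>w\<in>verts G. \<Sum>e\<in>{e0}. ?g v' w e - ?g v w e)"
    using T(2) step(2) other by (intro sum.cong refl sum.mono_neutral_right) auto
  also have "\<dots> = (\<Sum>w\<in>verts G. of_bool (ends G e0 = {x, w}) *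
      (of_bool (\<not> ?s e0 u v') - of_bool (\<not> ?s e0 u v)) * ?d e0 w)"
    by (simp add: algebra_simps)
  also have "\<dots> = of_bool (x = v') - of_bool (x = v)"
  proof -
    have vs: "v \<in> verts G" "v' \<in> verts G" using V(2)[OF step(2)] step(3) by auto
    consider "x = v" | "x = v'" | "x \<noteq> v" "x \<noteq> v'" by blast
    then show ?thesis
    proof cases
      case 1
      have "ends G e0 = {x, w} \<longleftrightarrow> w = v'" for w
        using step(3) 1 ne by (auto simp: doubleton_eq_iff)
      then have "(\<Sum>w\<in>verts G. of_bool (ends G e0 = {x, w}) *
          (of_bool (\<not> ?s e0 u v') - of_bool (\<not> ?s e0 u v)) * ?d e0 w) =
          (of_bool (\<not> ?s e0 u v') - of_bool (\<not> ?s e0 u v)) * ?d e0 v'"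
        using vs V(1) by (intro sum_of_bool_single)
      then show ?thesis using 1 one ne by auto
    next
      case 2
      have "ends G e0 = {x, w} \<longleftrightarrow> w = v" for w
        using step(3) 2 ne by (auto simp: doubleton_eq_iff)
      then have "(\<Sum>w\<in>verts G. of_bool (ends G e0 = {x, w}) *
          (of_bool (\<not> ?s e0 u v') - of_bool (\<not> ?s e0 u v)) * ?d e0 w) =
          (of_bool (\<not> ?s e0 u v') - of_bool (\<not> ?s e0 u v)) * ?d e0 v"
        using vs V(1) by (intro sum_of_bool_single)
      then show ?thesis using 2 one ne by auto
    next
      case 3
      then have "ends G e0 \<noteq> {x, w}" for w using step(3) by auto
      then show ?thesis using 3 by simp
    qed
  qed
  finally show ?case using step.IH by simp
qed

text \<open>Kirchhoff's combinatorial solution of the Laplace equation: after division by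
  \<open>tree_weight G\<close> it is a potential falling from \<open>u\<close> to \<open>v\<close>
  under a unit current.\<close>

definition forest_potential :: "'e cactus_network \<Rightarrow> complex set \<Rightarrow> complex set \<Rightarrow> complex set \<Rightarrow> real" where
  "forest_potential G u v x =
     (\<Sum>F | separating_forest G u v F. grove_weight G F * of_bool (same_component G F u x))"

text \<open>
  Adding the edge \<open>e\<close> to a forest in which it joins the two components gives a spanning tree
  whose path from \<open>u\<close> to \<open>v\<close> uses \<open>e\<close>, and every such tree arises in this way.
\<close>

lemma forest_tree_exchange:
  assumes G: "is_cactus_network n G" and e: "e \<in> edges G" "ends G e = {x, w}"
    and uv: "u \<in> verts G" "v \<in> verts G"
  shows "(\<Sum>F | separating_forest G u v F. conductance G e * grove_weight G F *
      (of_bool (same_component G F u w) - of_bool (same_component G F u x))) =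
    (\<Sum>T | spanning_tree G T. of_bool (e \<in> T) * grove_weight G T *
      of_bool (\<not> same_component G (T - {e}) u v) *
      (of_bool (same_component G (T - {e}) u w) - of_bool (same_component G (T - {e}) u x)))"
    (is "sum ?f ?A = sum ?g ?B")
proof -
  have finE: "finite (edges G)" using is_cactus_networkD(3)[OF G] .
  have finA: "finite ?A" and finB: "finite ?B"
    by (rule finite_subset[OF _ finite_Pow_iff[THEN iffD2, OF finE]],
        auto simp: separating_forest_def spanning_tree_def)+
  have xw: "x \<in> verts G" "w \<in> verts G"
    using is_cactus_networkD(8)[OF G e(1)] e(2) by auto
  \<comment> \<open>\<open>A\<close> and \<open>B\<close> select indices outside of which the
    summands vanish; adding and deleting \<open>e\<close> are inverse bijections between
    them.\<close>
  define A where "A = {F \<in> ?A. e \<notin> F \<and> same_component G F u w \<noteq> same_component G F u x}"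
  define B where "B = {T \<in> ?B. e \<in> T \<and> \<not> same_component G (T - {e}) u v}"
  have "sum ?f ?A = sum ?f A"
  proof (intro sum.mono_neutral_right finA ballI)
    fix F assume "F \<in> ?A - A"
    then have "e \<in> F \<or> same_component G F u w = same_component G F u x" by (auto simp: A_def)
    then have "same_component G F u w = same_component G F u x"
      using same_component_edge[of e F G x w] e(2) same_component_trans same_component_sym by metis
    then show "?f F = 0" by simp
  qed (auto simp: A_def)
  also have "\<dots> = sum ?g B"
  proof (rule sum.reindex_bij_witness[where i = "\<lambda>T. T - {e}" and j = "insert e"])
    fix F assume "F \<in> A"
    then have F: "F \<subseteq> edges G" "forest G F" "\<not> same_component G F u v"
      "\<And>z. z \<in> verts G \<Longrightarrow> same_component G F u z \<or> same_component G F v z"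
      "e \<notin> F" "same_component G F u w \<noteq> same_component G F u x"
      by (auto simp: A_def separating_forest_def)
    show "insert e F - {e} = F" using F by auto
    have "\<not> same_component G F x w"
      using F(6) same_component_trans same_component_sym by metis
    then have "forest G (insert e F)" using F e(2) by (intro forest_insert) auto
    moreover have "same_component G (insert e F) u z" if "z \<in> verts G" for z
    proof -
      have up: "same_component G (insert e F) a b" if "same_component G F a b" for a b
        using that same_component_mono by blast
      have "same_component G (insert e F) x w" using e by (intro same_component_edge) auto
      then have "same_component G (insert e F) u v"
        using F(4)[OF xw(1)] F(4)[OF xw(2)] F(6) up same_component_trans same_component_sym by metis
      then show ?thesis using F(4)[OF that] up same_component_trans by metis
    qed
    ultimately have "spanning_tree G (insert e F)"
      unfolding spanning_tree_def using F(1) e(1) same_component_trans same_component_sym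
      by (metis insert_subset)
    then show "insert e F \<in> B" using F(3,5) by (auto simp: B_def)
    have "finite F" using F(1) finE finite_subset by blast
    then show "?g (insert e F) = ?f F"
      using F(3,5) by (simp add: grove_weight_def)
  next
    fix T assume "T \<in> B"
    then have T: "T \<subseteq> edges G" "forest G T" "\<And>a b. a \<in> verts G \<Longrightarrow> b \<in> verts G \<Longrightarrow> same_component G T a b"
      "e \<in> T" "\<not> same_component G (T - {e}) u v"
      by (auto simp: B_def spanning_tree_def)
    show "insert e (T - {e}) = T" using T by auto
    have split: "same_component G (T - {e}) u z \<or>
        same_component G (T - {e}) u x \<and> same_component G (T - {e}) w z \<or>
        same_component G (T - {e}) u w \<and> same_component G (T - {e}) x z" if "z \<in> verts G" for z
      using same_component_insert[of G e "T - {e}" u z x w] T(3)[OF uv(1) that] T(4) e(2)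
      by (simp add: insert_absorb)
    have "separating_forest G u v (T - {e})"
      unfolding separating_forest_def
    proof (intro conjI ballI)
      show "forest G (T - {e})" using T(2) by (rule forest_subset) auto
      fix z assume "z \<in> verts G"
      then show "same_component G (T - {e}) u z \<or> same_component G (T - {e}) v z"
        using split[of z] split[OF uv(2)] T(5) same_component_trans same_component_sym by metis
    qed (use T in auto)
    moreover have "same_component G (T - {e}) u w \<noteq> same_component G (T - {e}) u x"
      using split[OF uv(2)] T(5) same_component_trans same_component_sym by metis
    ultimately show "T - {e} \<in> A" by (auto simp: A_def)
  qed
  also have "\<dots> = sum ?g ?B"
    by (intro sum.mono_neutral_left finB) (auto simp: B_def)
  finally show ?thesis .
qed

lemma total_conductance_eq:
  assumes "finite (edges G)"
  shows "total_conductance G u w = (\<Sum>e\<in>edges G. of_bool (ends G e = {u, w}) * conductance G e)"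
proof -
  have "total_conductance G u w = (\<Sum>e\<in>{e \<in> edges G. ends G e = {u, w}}. conductance G e)"
    by (simp add: total_conductance_def)
  also have "\<dots> = (\<Sum>e\<in>edges G. if ends G e = {u, w} then conductance G e else 0)"
    using assms by (simp add: sum.inter_filter)
  also have "\<dots> = (\<Sum>e\<in>edges G. of_bool (ends G e = {u, w}) * conductance G e)"
    by (intro sum.cong) auto
  finally show ?thesis .
qed

text \<open>Edge exchange turns the double sum over edges and forests into one over edges and
  spanning trees. Each tree then contributes its weight times the unit flow along its path from
  \<open>u\<close> to \<open>v\<close>.\<close>

lemma laplacian_forest_potential:
  assumes G: "is_cactus_network n G" and uv: "u \<in> verts G" "v \<in> verts G"
  shows "laplacian G (forest_potential G u v) x = tree_weight G * (of_bool (x = v) - of_bool (x = u))"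
proof -
  let ?A = "{F. separating_forest G u v F}" and ?B = "{T. spanning_tree G T}"
  let ?E = "edges G" and ?V = "verts G"
  let ?d = "\<lambda>F w. of_bool (same_component G F u w) - of_bool (same_component G F u x) :: real"
  have finE: "finite ?E" using is_cactus_networkD(3)[OF G] .
  have "laplacian G (forest_potential G u v) x =
      (\<Sum>w\<in>?V. \<Sum>e\<in>?E. of_bool (ends G e = {x, w}) *
        (conductance G e * (forest_potential G u v w - forest_potential G u v x)))"
    unfolding laplacian_def total_conductance_eq[OF finE] sum_distrib_right by (simp add: mult.assoc)
  also have "\<dots> = (\<Sum>w\<in>?V. \<Sum>e\<in>?E. of_bool (ends G e = {x, w}) *
      (\<Sum>F\<in>?A. conductance G e * grove_weight G F * ?d F w))"
    unfolding forest_potential_def sum_subtractf[symmetric] sum_distrib_left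
    by (simp add: algebra_simps)
  also have "\<dots> = (\<Sum>w\<in>?V. \<Sum>e\<in>?E. of_bool (ends G e = {x, w}) *
      (\<Sum>T\<in>?B. of_bool (e \<in> T) * grove_weight G T *
        of_bool (\<not> same_component G (T - {e}) u v) * ?d (T - {e}) w))"
    using forest_tree_exchange[OF G _ _ uv] by (intro sum.cong refl) auto
  also have "\<dots> = (\<Sum>w\<in>?V. \<Sum>e\<in>?E. \<Sum>T\<in>?B. grove_weight G T * (of_bool (e \<in> T) *
      (of_bool (ends G e = {x, w}) * of_bool (\<not> same_component G (T - {e}) u v) * ?d (T - {e}) w)))"
    unfolding sum_distrib_left by (intro sum.cong refl) (simp add: mult_ac)
  also have "\<dots> = (\<Sum>T\<in>?B. grove_weight G T * (\<Sum>w\<in>?V. \<Sum>e\<in>?E. of_bool (e \<in> T) *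
      (of_bool (ends G e = {x, w}) * of_bool (\<not> same_component G (T - {e}) u v) * ?d (T - {e}) w)))"
    unfolding sum_distrib_left by (rule sum_rotate)
  also have "\<dots> = (\<Sum>T\<in>?B. grove_weight G T * (of_bool (x = v) - of_bool (x = u)))"
  proof (intro sum.cong refl arg_cong2[where f = "(*)"])
    fix T assume "T \<in> ?B"
    then have T: "T \<subseteq> ?E" "forest G T" "same_component G T u v"
      using uv by (auto simp: spanning_tree_def)
    have restrict: "(\<Sum>e\<in>?E. of_bool (e \<in> T) * (h e :: real)) = (\<Sum>e\<in>T. h e)" for h
    proof -
      have "(\<Sum>e\<in>T. of_bool (e \<in> T) * h e) = (\<Sum>e\<in>?E. of_bool (e \<in> T) * h e)"
        using finE T(1) by (intro sum.mono_neutral_left) auto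
      then show ?thesis by simp
    qed
    have "ends G e \<subseteq> ?V" if "e \<in> T" for e
      using is_cactus_networkD(8)[OF G] T(1) that by blast
    from tree_path_flow[OF T(2) finite_subset[OF T(1) finE] is_cactus_networkD(2)[OF G] this T(3)]
    show "(\<Sum>w\<in>?V. \<Sum>e\<in>?E. of_bool (e \<in> T) * (of_bool (ends G e = {x, w}) *
        of_bool (\<not> same_component G (T - {e}) u v) * ?d (T - {e}) w)) = of_bool (x = v) - of_bool (x = u)"
      unfolding restrict .
  qed
  finally show ?thesis
    by (simp add: tree_weight_def sum_distrib_right)
qed

section \<open>Uniqueness and existence of harmonic functions\<close>

lemma laplacian_cong:
  assumes "\<And>w. w \<in> verts G \<Longrightarrow> V w = W w" "x \<in> verts G"
  shows "laplacian G V x = laplacian G W x"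
  unfolding laplacian_def using assms by (intro sum.cong) auto

lemma laplacian_scale: "laplacian G (\<lambda>w. a * V w) x = a * laplacian G V x"
  unfolding laplacian_def sum_distrib_left by (intro sum.cong) (auto simp: algebra_simps)

lemma laplacian_diff: "laplacian G (\<lambda>w. V w - W w) x = laplacian G V x - laplacian G W x"
  unfolding laplacian_def sum_subtractf[symmetric] by (intro sum.cong) (auto simp: algebra_simps)

lemma laplacian_diff_const: "laplacian G (\<lambda>w. V w - a) x = laplacian G V x"
  unfolding laplacian_def by simp

lemma total_conductance_nonneg:
  assumes "is_cactus_network n G"
  shows "total_conductance G u w \<ge> 0"
  unfolding total_conductance_def using is_cactus_networkD(6)[OF assms] by (intro sum_nonneg) force

lemma total_conductance_pos:
  assumes "is_cactus_network n G" "e \<in> edges G" "ends G e = {u, w}"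
  shows "total_conductance G u w > 0"
  unfolding total_conductance_def
proof (rule sum_pos2)
  show "finite {e \<in> edges G. ends G e = {u, w}}" using is_cactus_networkD(3)[OF assms(1)] by simp
qed (use assms is_cactus_networkD(6)[OF assms(1)] in \<open>auto intro: less_imp_le\<close>)

text \<open>At a vertex outside \<open>B\<close> a positive maximum forces the same value on all
  neighbours, hence by connectedness also on \<open>B\<close>, where the function is 0. The set
  \<open>B\<close> is kept general: it is later the whole boundary or a single grounded
  vertex.\<close>

lemma maximum_principle:
  assumes G: "is_cactus_network n G" and conn: "network_connected G"
    and B: "B \<subseteq> verts G" "B \<noteq> {}"
    and harm: "\<And>x. x \<in> verts G - B \<Longrightarrow> laplacian G V x = 0"
    and zero: "\<And>x. x \<in> B \<Longrightarrow> V x = 0"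
    and x: "x \<in> verts G"
  shows "V x \<le> 0"
proof (rule ccontr)
  assume "\<not> V x \<le> 0"
  have fin: "finite (V ` verts G)" using is_cactus_networkD(2)[OF G] by simp
  define M where "M = Max (V ` verts G)"
  have "M \<in> V ` verts G" unfolding M_def using fin x by (intro Max_in) auto
  then obtain x0 where x0: "x0 \<in> verts G" "V x0 = M" by blast
  have le: "V w \<le> M" if "w \<in> verts G" for w
    unfolding M_def using fin that by (intro Max_ge) auto
  have "M > 0" using le[OF x] \<open>\<not> V x \<le> 0\<close> by simp
  have eq: "V y = M" if "same_component G (edges G) x0 y" for y
    using that
  proof (induction rule: same_component_induct)
    case refl
    show ?case by (rule x0)
  next
    case (step y z e)
    have yz: "y \<in> verts G" "z \<in> verts G"
      using is_cactus_networkD(8)[OF G step(2)] step(3) by auto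
    moreover have "y \<notin> B" using zero step.IH \<open>M > 0\<close> by force
    ultimately have "laplacian G V y = 0" using harm by simp
    then have "(\<Sum>w\<in>verts G. total_conductance G y w * (M - V w)) = 0"
      unfolding laplacian_def step.IH by (simp add: right_diff_distrib sum_subtractf)
    then have "\<forall>w\<in>verts G. total_conductance G y w * (M - V w) = 0"
      using is_cactus_networkD(2)[OF G] total_conductance_nonneg[OF G] le
      by (subst (asm) sum_nonneg_eq_0_iff) auto
    then have "total_conductance G y z * (M - V z) = 0" using yz by blast
    then show ?case using total_conductance_pos[OF G step(2,3)] by simp
  qed
  obtain b where "b \<in> B" using B(2) by blast
  then have "V b = M" using eq conn x0(1) B(1) unfolding network_connected_def by blast
  then show False using zero[OF \<open>b \<in> B\<close>] \<open>M > 0\<close> by simp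
qed

lemma laplacian_uniqueness:
  assumes G: "is_cactus_network n G" and conn: "network_connected G"
    and B: "B \<subseteq> verts G" "B \<noteq> {}"
    and harm: "\<And>x. x \<in> verts G - B \<Longrightarrow> laplacian G V x = 0"
    and zero: "\<And>x. x \<in> B \<Longrightarrow> V x = 0"
    and x: "x \<in> verts G"
  shows "V x = 0"
proof (rule antisym)
  show "V x \<le> 0" by (rule maximum_principle[OF assms])
  have "(- 1) * V x \<le> 0"
    by (rule maximum_principle[OF G conn B _ _ x]) (simp_all only: laplacian_scale harm zero mult_zero_right)
  then show "0 \<le> V x" by simp
qed

text \<open>For a square matrix a trivial kernel means nonzero determinant, hence invertibility; a
  bijection with \<open>{..<N}\<close> makes determinants applicable to an arbitrary finite index
  set.\<close>

lemma finite_linear_system_solvable: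
  fixes a :: "'a \<Rightarrow> 'a \<Rightarrow> real"
  assumes "finite A"
    and inj: "\<And>f. (\<And>x. x \<in> A \<Longrightarrow> (\<Sum>y\<in>A. a x y * f y) = 0) \<Longrightarrow> (\<And>y. y \<in> A \<Longrightarrow> f y = 0)"
  shows "\<exists>f. \<forall>x\<in>A. (\<Sum>y\<in>A. a x y * f y) = b x"
proof -
  define N where "N = card A"
  obtain h where h: "bij_betw h {..<N} A"
    using ex_bij_betw_nat_finite[OF assms(1)] by (auto simp: N_def atLeast0LessThan)
  define g where "g = the_inv_into {..<N} h"
  have gh: "g (h i) = i" if "i < N" for i
    using h that unfolding g_def bij_betw_def by (intro the_inv_into_f_f) auto
  have g: "g y < N" "h (g y) = y" if "y \<in> A" for y
    using h that the_inv_into_into[of h "{..<N}" y] f_the_inv_into_f[of h "{..<N}" y]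
    unfolding g_def bij_betw_def by auto
  define M where "M = Matrix.mat N N (\<lambda>(i, j). a (h i) (h j))"
  have M: "M \<in> carrier_mat N N" by (simp add: M_def)
  have mult: "(M *\<^sub>v v) $ (g x) = (\<Sum>y\<in>A. a x y * v $ (g y))" if v: "v \<in> carrier_vec N" and x: "x \<in> A" for v x
  proof -
    have "(M *\<^sub>v v) $ (g x) = (\<Sum>j<N. a x (h j) * v $ j)"
      using v g[OF x] M by (simp add: M_def scalar_prod_def atLeast0LessThan)
    also have "\<dots> = (\<Sum>j<N. a x (h j) * v $ g (h j))"
      by (intro sum.cong refl) (simp add: gh)
    also have "\<dots> = (\<Sum>y\<in>A. a x y * v $ (g y))"
      by (rule sum.reindex_bij_betw[OF h])
    finally show ?thesis .
  qed
  have "Determinant.det M \<noteq> 0"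
  proof
    assume "Determinant.det M = 0"
    then obtain v where v: "v \<in> carrier_vec N" "v \<noteq> 0\<^sub>v N" "M *\<^sub>v v = 0\<^sub>v N"
      using det_0_iff_vec_prod_zero[OF M] by blast
    have "(\<Sum>y\<in>A. a x y * v $ (g y)) = 0" if "x \<in> A" for x
      using mult[OF v(1) that] g(1)[OF that] v(3) by simp
    then have "v $ (g y) = 0" if "y \<in> A" for y
      using inj[of "\<lambda>y. v $ (g y)"] that by blast
    then have "v $ i = 0" if "i < N" for i
      using that gh[OF that] bij_betwE[OF h] by (metis lessThan_iff)
    then have "v = 0\<^sub>v N" using v(1) by (intro eq_vecI) auto
    then show False using v(2) by simp
  qed
  from det_non_zero_imp_unit[OF M this, of "()"]
  obtain M' where M': "M' \<in> carrier_mat N N" "M * M' = 1\<^sub>m N"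
    unfolding Units_def ring_mat_def by auto
  define c where "c = Matrix.vec N (\<lambda>i. b (h i))"
  have c: "c \<in> carrier_vec N" by (simp add: c_def)
  have "M *\<^sub>v (M' *\<^sub>v c) = c"
    using M M' c by (simp add: assoc_mult_mat_vec[symmetric])
  then have "(\<Sum>y\<in>A. a x y * (M' *\<^sub>v c) $ (g y)) = b x" if "x \<in> A" for x
    using mult[of "M' *\<^sub>v c" x] M' c g[OF that] that by (simp add: c_def)
  then show ?thesis by (intro exI[of _ "\<lambda>y. (M' *\<^sub>v c) $ (g y)"]) blast
qed

text \<open>Existence follows from uniqueness, because the Dirichlet problem is a square linear
  system. It gives the choice in \<open>harmonic_extension\<close> its meaning.\<close>

lemma harmonic_extension_exists:
  assumes G: "is_cactus_network n G" and conn: "network_connected G" and n: "n \<ge> 1"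
  shows "\<exists>V. harmonic n G V \<and> (\<forall>u\<in>boundary_verts n G. V u = g u)"
proof -
  let ?B = "boundary_verts n G"
  have B: "?B \<subseteq> verts G" "?B \<noteq> {}"
    using is_cactus_networkD(5)[OF G] n by (auto simp: boundary_verts_def lessThan_empty_iff)
  have fin: "finite (verts G)" using is_cactus_networkD(2)[OF G] .
  define d where "d x = (\<Sum>w\<in>verts G. total_conductance G x w)" for x
  \<comment> \<open>Rows of boundary vertices prescribe the value; the other rows are those of the
    Laplacian.\<close>
  define a where "a x y = (if x \<in> ?B then of_bool (x = y) else total_conductance G x y - of_bool (x = y) * d x)" for x y
  have point: "(\<Sum>y\<in>verts G. of_bool (x = y) * f y) = f x" if "x \<in> verts G" for x and f :: "complex set \<Rightarrow> real"
    using sum_of_bool_single[of "\<lambda>y. x = y" x "verts G" 1 f] fin that by auto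
  have sum_a: "(\<Sum>y\<in>verts G. a x y * f y) = (if x \<in> ?B then f x else laplacian G f x)" if x: "x \<in> verts G" for x f
  proof (cases "x \<in> ?B")
    case True
    then show ?thesis using point[OF x] by (simp add: a_def)
  next
    case False
    then have "(\<Sum>y\<in>verts G. a x y * f y) =
        (\<Sum>y\<in>verts G. total_conductance G x y * f y) - (\<Sum>y\<in>verts G. of_bool (x = y) * (d x * f y))"
      by (simp add: a_def left_diff_distrib sum_subtractf mult.assoc)
    also have "\<dots> = laplacian G f x"
      unfolding point[OF x] laplacian_def d_def by (simp add: right_diff_distrib sum_subtractf sum_distrib_right)
    finally show ?thesis using False by simp
  qed
  have "\<exists>V. \<forall>x\<in>verts G. (\<Sum>y\<in>verts G. a x y * V y) = (if x \<in> ?B then g x else 0)"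
  proof (rule finite_linear_system_solvable[OF fin])
    fix f y assume f: "\<And>x. x \<in> verts G \<Longrightarrow> (\<Sum>y\<in>verts G. a x y * f y) = 0" and y: "y \<in> verts G"
    have f': "(if x \<in> ?B then f x else laplacian G f x) = 0" if "x \<in> verts G" for x
      using f[OF that] sum_a[OF that] by simp
    show "f y = 0"
    proof (rule laplacian_uniqueness[OF G conn B _ _ y])
      show "laplacian G f x = 0" if "x \<in> verts G - ?B" for x using f'[of x] that by simp
      show "f x = 0" if "x \<in> ?B" for x using f'[of x] that B by auto
    qed
  qed
  then obtain V where V: "\<And>x. x \<in> verts G \<Longrightarrow> (if x \<in> ?B then V x else laplacian G V x) = (if x \<in> ?B then g x else 0)"
    using sum_a by metis
  have "laplacian G V x = 0" if "x \<in> verts G - ?B" for x using V[of x] that by simp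
  moreover have "V x = g x" if "x \<in> ?B" for x using V[of x] that B by auto
  ultimately show ?thesis unfolding harmonic_def by blast
qed

text \<open>Kirchhoff's formula. The explicit potential shows that suitable boundary values exist,
  and any others chosen by \<open>resistance\<close> differ from it by a constant, which the
  difference of two values does not see.\<close>

lemma resistance_eq_forest_sum:
  assumes G: "is_cactus_network n G" and conn: "network_connected G" and ij: "i < n" "j < n"
  defines "u \<equiv> boundary_vertex n G i" and "v \<equiv> boundary_vertex n G j"
  shows "resistance n G i j = (\<Sum>F | separating_forest G u v F. grove_weight G F) / tree_weight G"
proof -
  let ?B = "boundary_verts n G" and ?Z = "tree_weight G"
  have n: "n \<ge> 1" using ij by simp
  have uvB: "u \<in> ?B" "v \<in> ?B" using ij by (auto simp: boundary_verts_def u_def v_def)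
  have B: "?B \<subseteq> verts G" using is_cactus_networkD(5)[OF G] .
  have uv: "u \<in> verts G" "v \<in> verts G" using uvB B by auto
  have Z: "?Z > 0" by (rule tree_weight_pos[OF G conn])
  \<comment> \<open>The factor reverses the direction and normalizes the current:
    \<open>forest_potential\<close> has Laplacian \<open>tree_weight G\<close> at \<open>v\<close>
    and its negative at \<open>u\<close>.\<close>
  define V0 where "V0 x = (- 1 / ?Z) * forest_potential G u v x" for x
  define \<delta> :: "complex set \<Rightarrow> real" where "\<delta> x = of_bool (x = u) - of_bool (x = v)" for x
  have V0: "laplacian G V0 x = \<delta> x" for x
    unfolding V0_def laplacian_scale laplacian_forest_potential[OF G uv] \<delta>_def using Z by (simp add: field_simps)
  have ext: "harmonic n G (harmonic_extension n G g) \<and> (\<forall>u\<in>?B. harmonic_extension n G g u = g u)" for g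
    unfolding harmonic_extension_def by (rule someI_ex[OF harmonic_extension_exists[OF G conn n]])
  have interior: "\<delta> x = 0" if "x \<notin> ?B" for x
    using that uvB by (auto simp: \<delta>_def)
  have "harmonic_extension n G V0 x = V0 x" if x: "x \<in> verts G" for x
  proof -
    have "harmonic_extension n G V0 x - V0 x = 0"
    proof (rule laplacian_uniqueness[OF G conn B _ _ _ x])
      show "laplacian G (\<lambda>x. harmonic_extension n G V0 x - V0 x) y = 0" if "y \<in> verts G - ?B" for y
        using ext[of V0] interior[of y] that by (auto simp: laplacian_diff V0 harmonic_def)
    qed (use uvB ext[of V0] in auto)
    then show ?thesis by simp
  qed
  then have "response n G V0 x = \<delta> x" if "x \<in> ?B" for x
    unfolding response_def V0[symmetric] using that B by (intro laplacian_cong) auto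
  then have ex: "\<exists>g. \<forall>x\<in>?B. response n G g x = of_bool (x = u) - of_bool (x = v)"
    unfolding \<delta>_def by blast
  define g where "g = (SOME g. \<forall>x\<in>?B. response n G g x = of_bool (x = u) - of_bool (x = v))"
  have g: "\<And>x. x \<in> ?B \<Longrightarrow> response n G g x = \<delta> x"
    using someI_ex[OF ex] unfolding g_def[symmetric] \<delta>_def by blast
  define W where "W = harmonic_extension n G g"
  have "laplacian G W x = \<delta> x" if "x \<in> verts G" for x
    using g[of x] ext[of g] interior[of x] that unfolding W_def response_def harmonic_def by (cases "x \<in> ?B") auto
  then have diff: "laplacian G (\<lambda>x. W x - V0 x) x = 0" if "x \<in> verts G" for x
    using that by (simp add: laplacian_diff V0)
  \<comment> \<open>Subtracting the value at \<open>u\<close> grounds this vertex, so uniqueness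
    applies with the single vertex \<open>u\<close> as boundary.\<close>
  have "W v - V0 v - (W u - V0 u) = 0"
  proof (rule laplacian_uniqueness[OF G conn _ _ _ _ uv(2)])
    show "{u} \<subseteq> verts G" "{u} \<noteq> {}" using uv by auto
    show "laplacian G (\<lambda>x. W x - V0 x - (W u - V0 u)) x = 0" if "x \<in> verts G - {u}" for x
      using diff that unfolding laplacian_diff_const by blast
  qed auto
  then have "W v - W u = V0 v - V0 u" by simp
  moreover have "resistance n G i j = g v - g u"
    unfolding resistance_def Let_def u_def[symmetric] v_def[symmetric] g_def[symmetric] ..
  moreover have "W v = g v" "W u = g u" using ext[of g] uvB unfolding W_def by auto
  ultimately have "resistance n G i j = V0 v - V0 u" by simp
  also have "\<dots> = (forest_potential G u v u - forest_potential G u v v) / ?Z"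
    by (simp add: V0_def diff_divide_distrib)
  also have "forest_potential G u v v = 0"
    unfolding forest_potential_def by (intro sum.neutral) (auto simp: separating_forest_def)
  also have "forest_potential G u v u = (\<Sum>F | separating_forest G u v F. grove_weight G F)"
    by (simp add: forest_potential_def)
  finally show ?thesis by simp
qed

section \<open>Kreweras complements of partitions with at most two blocks\<close>

lemma noncrossing_partitionD:
  assumes "noncrossing_partition A P"
  shows "partition_on A P"
    and "B \<in> P \<Longrightarrow> C \<in> P \<Longrightarrow> a < b \<Longrightarrow> b < c \<Longrightarrow> c < d \<Longrightarrow> a \<in> B \<Longrightarrow> c \<in> B \<Longrightarrow> b \<in> C \<Longrightarrow> d \<in> C \<Longrightarrow> B = C"
  using assms unfolding noncrossing_partition_def by (blast, meson)

lemma kreweras_eqI: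
  assumes "kreweras_compatible n P Q"
    and "\<And>Q'. kreweras_compatible n P Q' \<Longrightarrow> refines {..<n} Q' Q"
  shows "kreweras n P = Q"
  unfolding kreweras_def
proof (rule the_equality)
  show "kreweras_compatible n P Q \<and> (\<forall>Q'. kreweras_compatible n P Q' \<longrightarrow> refines {..<n} Q' Q)"
    using assms by blast
  fix Q2 assume "kreweras_compatible n P Q2 \<and> (\<forall>Q'. kreweras_compatible n P Q' \<longrightarrow> refines {..<n} Q' Q2)"
  then show "Q2 = Q" using assms refines_asym by metis
qed

text \<open>In the interleaved order the label \<open>a\<close> precedes the tilde label
  \<open>b\<close> iff \<open>a \<le> b\<close>, and follows it iff \<open>b < a\<close>. The two
  patterns are the two ways for a pair of labels and a pair of tilde labels to cross.\<close>

lemma kreweras_compatibleD: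
  assumes "kreweras_compatible n P Q" "B \<in> P" "C \<in> Q" "a \<in> B" "a' \<in> B" "b \<in> C" "b' \<in> C"
  shows "\<not> (a \<le> b \<and> b < a' \<and> a' \<le> b')" "\<not> (b < a \<and> a \<le> b' \<and> b' < a')"
proof -
  let ?X = "(\<lambda>i. 2 * i) ` B" and ?Y = "(\<lambda>i. 2 * i + 1) ` C"
  have nc: "noncrossing_partition {..<2 * n} (interleave P Q)"
    using assms(1) unfolding kreweras_compatible_def by blast
  have XY: "?X \<in> interleave P Q" "?Y \<in> interleave P Q"
    using assms unfolding interleave_def by blast+
  have "?X \<noteq> ?Y"
  proof
    assume "?X = ?Y"
    then have "2 * a \<in> ?Y" using assms(4) by blast
    then obtain j where "2 * a = 2 * j + 1" by blast
    then show False by presburger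
  qed
  show "\<not> (a \<le> b \<and> b < a' \<and> a' \<le> b')"
  proof
    assume "a \<le> b \<and> b < a' \<and> a' \<le> b'"
    then have "?X = ?Y"
      using assms(4-7) by (intro noncrossing_partitionD(2)[OF nc XY, of "2 * a" "2 * b + 1" "2 * a'" "2 * b' + 1"]) simp_all
    with \<open>?X \<noteq> ?Y\<close> show False by simp
  qed
  show "\<not> (b < a \<and> a \<le> b' \<and> b' < a')"
  proof
    assume "b < a \<and> a \<le> b' \<and> b' < a'"
    then have "?Y = ?X"
      using assms(4-7) by (intro noncrossing_partitionD(2)[OF nc XY(2,1), of "2 * b + 1" "2 * a" "2 * b' + 1" "2 * a'"]) simp_all
    with \<open>?X \<noteq> ?Y\<close> show False by simp
  qed
qed

lemma partition_on_interleave: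
  assumes "partition_on {..<n} P" "partition_on {..<n} Q"
  shows "partition_on {..<2 * n} (interleave P Q)"
proof (rule partition_onI)
  show "{} \<notin> interleave P Q"
    using partition_onD3[OF assms(1)] partition_onD3[OF assms(2)] unfolding interleave_def by auto
  have un: "\<Union> (interleave P Q) = (\<lambda>i. 2 * i) ` \<Union>P \<union> (\<lambda>i. 2 * i + 1) ` \<Union>Q"
    unfolding interleave_def by blast
  also have "\<dots> = (\<lambda>i. 2 * i) ` {..<n} \<union> (\<lambda>i. 2 * i + 1) ` {..<n}"
    using partition_onD1[OF assms(1)] partition_onD1[OF assms(2)] by simp
  also have "\<dots> = {..<2 * n}"
  proof (intro equalityI subsetI)
    fix x assume "x \<in> {..<2 * n}"
    then have "x div 2 \<in> {..<n}" "x = 2 * (x div 2) \<or> x = 2 * (x div 2) + 1" by auto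
    then show "x \<in> (\<lambda>i. 2 * i) ` {..<n} \<union> (\<lambda>i. 2 * i + 1) ` {..<n}" by blast
  qed auto
  finally show "\<Union> (interleave P Q) = {..<2 * n}" .
  fix X Y assume XY: "X \<in> interleave P Q" "Y \<in> interleave P Q" "X \<noteq> Y"
  have parity: "(\<lambda>i. 2 * i) ` B \<inter> (\<lambda>i. 2 * i + 1) ` C = {}" for B C :: "nat set"
    by auto presburger
  have same: "f ` B \<inter> f ` C = {}" if "inj f" "B \<in> R" "C \<in> R" "f ` B \<noteq> f ` C" "partition_on {..<n} R"
    for f :: "nat \<Rightarrow> nat" and B C R
  proof -
    have "B \<inter> C = {}" using disjointD[OF partition_onD2[OF that(5)] that(2,3)] that(4) by blast
    then show ?thesis using that(1) by (simp add: image_Int[symmetric])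
  qed
  have inj: "inj (\<lambda>i::nat. 2 * i)" "inj (\<lambda>i::nat. 2 * i + 1)" by (auto simp: inj_on_def)
  have "X \<inter> Y = {}"
    using XY same[OF inj(1) _ _ _ assms(1)] same[OF inj(2) _ _ _ assms(2)] parity
    unfolding interleave_def by (elim UnE imageE) (simp_all add: Int_commute)
  then show "disjnt X Y" by (simp add: disjnt_def)
qed

lemma kreweras_compatibleI:
  assumes P: "noncrossing_partition {..<n} P" and Q: "noncrossing_partition {..<n} Q"
    and cross: "\<And>B C a a' b b'. B \<in> P \<Longrightarrow> C \<in> Q \<Longrightarrow> a \<in> B \<Longrightarrow> a' \<in> B \<Longrightarrow> b \<in> C \<Longrightarrow> b' \<in> C \<Longrightarrow>
      a \<le> b \<and> b < a' \<and> a' \<le> b' \<or> b < a \<and> a \<le> b' \<and> b' < a' \<Longrightarrow> False"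
  shows "kreweras_compatible n P Q"
  unfolding kreweras_compatible_def noncrossing_partition_def[of "{..<2 * n}"]
proof (intro conjI Q ballI allI impI)
  show "partition_on {..<2 * n} (interleave P Q)"
    by (intro partition_on_interleave noncrossing_partitionD(1)[OF P] noncrossing_partitionD(1)[OF Q])
  fix X Y a b c d
  assume X: "X \<in> interleave P Q" and Y: "Y \<in> interleave P Q"
    and "a < b \<and> b < c \<and> c < d \<and> a \<in> X \<and> c \<in> X \<and> b \<in> Y \<and> d \<in> Y"
  then have lt: "a < b" "b < c" "c < d" and mem: "a \<in> X" "c \<in> X" "b \<in> Y" "d \<in> Y" by auto
  from X Y consider
      (PP) B C where "B \<in> P" "C \<in> P" "X = (\<lambda>i. 2 * i) ` B" "Y = (\<lambda>i. 2 * i) ` C"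
    | (QQ) B C where "B \<in> Q" "C \<in> Q" "X = (\<lambda>i. 2 * i + 1) ` B" "Y = (\<lambda>i. 2 * i + 1) ` C"
    | (PQ) B C where "B \<in> P" "C \<in> Q" "X = (\<lambda>i. 2 * i) ` B" "Y = (\<lambda>i. 2 * i + 1) ` C"
    | (QP) B C where "B \<in> P" "C \<in> Q" "Y = (\<lambda>i. 2 * i) ` B" "X = (\<lambda>i. 2 * i + 1) ` C"
    unfolding interleave_def
    by (elim UnE imageE) (rule that, assumption, assumption, assumption, assumption)+
  then show "X = Y"
  proof cases
    case PP
    then obtain a' b' c' d' where "a' \<in> B" "c' \<in> B" "b' \<in> C" "d' \<in> C"
      "a = 2 * a'" "b = 2 * b'" "c = 2 * c'" "d = 2 * d'" using mem by auto
    then show ?thesis using noncrossing_partitionD(2)[OF P PP(1,2), of a' b' c' d'] lt PP by simp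
  next
    case QQ
    then obtain a' b' c' d' where "a' \<in> B" "c' \<in> B" "b' \<in> C" "d' \<in> C"
      "a = 2 * a' + 1" "b = 2 * b' + 1" "c = 2 * c' + 1" "d = 2 * d' + 1" using mem by auto
    then show ?thesis using noncrossing_partitionD(2)[OF Q QQ(1,2), of a' b' c' d'] lt QQ by simp
  next
    case PQ
    then obtain a' b' c' d' where "a' \<in> B" "c' \<in> B" "b' \<in> C" "d' \<in> C"
      "a = 2 * a'" "b = 2 * b' + 1" "c = 2 * c'" "d = 2 * d' + 1" using mem by auto
    then show ?thesis using cross[OF PQ(1,2), of a' c' b' d'] lt by simp
  next
    case QP
    then obtain a' b' c' d' where "a' \<in> C" "c' \<in> C" "b' \<in> B" "d' \<in> B"
      "a = 2 * a' + 1" "b = 2 * b'" "c = 2 * c' + 1" "d = 2 * d'" using mem by auto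
    then show ?thesis using cross[OF QP(1,2), of b' d' a' c'] lt by simp
  qed
qed

text \<open>Tilde labels x < y cannot share a block: the pair of labels 0 and x + 1, which belong to
  the single block, would cross them.\<close>

lemma kreweras_one_block:
  assumes "n \<ge> 1"
  shows "kreweras n {{..<n}} = (\<lambda>i. {i}) ` {..<n}"
proof (rule kreweras_eqI)
  have part: "partition_on {..<n} ((\<lambda>i. {i}) ` {..<n})"
    by (auto intro!: partition_onI simp: disjnt_def)
  have "noncrossing_partition {..<n} {{..<n}}"
    using assms unfolding noncrossing_partition_def by (auto intro!: partition_on_space simp: lessThan_empty_iff)
  moreover have "noncrossing_partition {..<n} ((\<lambda>i. {i}) ` {..<n})"
    using part unfolding noncrossing_partition_def by auto
  ultimately show "kreweras_compatible n {{..<n}} ((\<lambda>i. {i}) ` {..<n})"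
    by (rule kreweras_compatibleI) auto
  fix Q assume Q: "kreweras_compatible n {{..<n}} Q"
  then have partQ: "partition_on {..<n} Q"
    unfolding kreweras_compatible_def using noncrossing_partitionD(1) by blast
  have single: "\<not> x < y" if "X \<in> Q" "x \<in> X" "y \<in> X" for X x y
  proof
    assume "x < y"
    moreover have "y < n" using partition_onD1[OF partQ] that by auto
    ultimately show False
      using kreweras_compatibleD(1)[OF Q, of "{..<n}" X 0 "Suc x" x y] that by simp
  qed
  show "refines {..<n} Q ((\<lambda>i. {i}) ` {..<n})"
    unfolding refines_def
  proof (intro conjI ballI partQ part)
    fix X assume X: "X \<in> Q"
    then obtain x where x: "x \<in> X" using partition_onD3[OF partQ] by (metis all_not_in_conv)
    have "X \<subseteq> {x}" using single[OF X] x by (metis insertI1 linorder_neqE_nat subsetI)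
    moreover have "x < n" using partition_onD1[OF partQ] X x by auto
    ultimately show "\<exists>Y\<in>(\<lambda>i. {i}) ` {..<n}. X \<subseteq> Y" by blast
  qed
qed

text \<open>Tilde p - 1 and tilde q sit exactly in the two places where the circular order passes
  from one block to the other, so they may be joined and nothing else may.\<close>

lemma kreweras_two_blocks:
  assumes pq: "1 \<le> p" "p \<le> q" "q < n"
    and P: "noncrossing_partition {..<n} {{p..q}, {..<n} - {p..q}}"
  shows "kreweras n {{p..q}, {..<n} - {p..q}} = insert {p - 1, q} ((\<lambda>i. {i}) ` ({..<n} - {p - 1, q}))"
    (is "kreweras n ?P = ?K")
proof (rule kreweras_eqI)
  have part: "partition_on {..<n} ?K"
    using pq by (intro partition_onI) (auto simp: disjnt_def)
  have "noncrossing_partition {..<n} ?K"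
    unfolding noncrossing_partition_def
  proof (intro conjI part ballI allI impI)
    fix B C a b c d
    assume "B \<in> ?K" "C \<in> ?K" "a < b \<and> b < c \<and> c < d \<and> a \<in> B \<and> c \<in> B \<and> b \<in> C \<and> d \<in> C"
    then show "B = C" by auto
  qed
  with P show "kreweras_compatible n ?P ?K"
  proof (rule kreweras_compatibleI)
    fix B C a a' b b'
    assume B: "B \<in> ?P" and C: "C \<in> ?K" and mem: "a \<in> B" "a' \<in> B" "b \<in> C" "b' \<in> C"
      and c: "a \<le> b \<and> b < a' \<and> a' \<le> b' \<or> b < a \<and> a \<le> b' \<and> b' < a'"
    then have "b < b'" by auto
    then have b: "b = p - 1" "b' = q" using C mem pq by auto
    have "a \<in> {p..q} \<longleftrightarrow> a' \<in> {p..q}" using B mem by auto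
    then show False using c b pq by auto
  qed
  fix Q assume Q: "kreweras_compatible n ?P Q"
  then have partQ: "partition_on {..<n} Q"
    unfolding kreweras_compatible_def using noncrossing_partitionD(1) by blast
  have pair: "x = p - 1 \<and> y = q" if X: "X \<in> Q" "x \<in> X" "y \<in> X" "x < y" for X x y
  proof -
    have yn: "y < n" using partition_onD1[OF partQ] X by auto
    \<comment> \<open>If tilde \<open>x\<close> and tilde \<open>y\<close> share a block, then the
      labels in (x, y] are cut off from all others; no block of \<open>?P\<close> may contain labels
      from both sides.\<close>
    have sep: "(a \<in> {p..q}) \<noteq> (a' \<in> {p..q})" if a: "x < a" "a \<le> y" and a': "a' < n" "\<not> (x < a' \<and> a' \<le> y)" for a a'
    proof
      assume eq: "(a \<in> {p..q}) = (a' \<in> {p..q})"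
      have "a < n" using a yn by simp
      then have "\<exists>B\<in>?P. a \<in> B \<and> a' \<in> B" using eq a'(1) by (cases "a \<in> {p..q}") auto
      then obtain B where B: "B \<in> ?P" "a \<in> B" "a' \<in> B" by blast
      show False
        using kreweras_compatibleD(1)[OF Q B(1) X(1) B(3,2) X(2,3)]
          kreweras_compatibleD(2)[OF Q B(1) X(1) B(2,3) X(2,3)] a a' by auto
    qed
    \<comment> \<open>Label 0 serves as the outside reference: it is not in (x, y], and not in the
      interval because \<open>1 \<le> p\<close>.\<close>
    have inside: "a \<in> {p..q}" if "x < a" "a \<le> y" for a
      using sep[OF that, of 0] pq by auto
    have outside: "a' \<notin> {p..q}" if "a' < n" "\<not> (x < a' \<and> a' \<le> y)" for a'
      using sep[of y a'] inside[of y] X(4) that by auto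
    have "q \<le> y" "x < p" using outside[of q] outside[of p] pq by auto
    moreover have "y \<le> q" "p \<le> Suc x" using inside[of y] inside[of "Suc x"] X(4) by auto
    ultimately show ?thesis by simp
  qed
  show "refines {..<n} Q ?K"
    unfolding refines_def
  proof (intro conjI ballI partQ part)
    fix X assume X: "X \<in> Q"
    then obtain x where x: "x \<in> X" using partition_onD3[OF partQ] by (metis all_not_in_conv)
    have "x < n" using partition_onD1[OF partQ] X x by auto
    show "\<exists>Y\<in>?K. X \<subseteq> Y"
    proof (cases "X = {x}")
      case True
      then show ?thesis using \<open>x < n\<close> by auto
    next
      case False
      have "z \<in> {p - 1, q}" if z: "z \<in> X" for z
      proof -
        obtain w where "w \<in> X" "w \<noteq> z" using False x z by blast
        then consider "w < z" | "z < w" by linarith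
        then show ?thesis using pair[OF X \<open>w \<in> X\<close> z] pair[OF X z \<open>w \<in> X\<close>] by cases auto
      qed
      then show ?thesis by blast
    qed
  qed
qed

text \<open>The block without label 0 is an interval: an element of the other block between its
  extremes would cross it together with 0.\<close>

lemma noncrossing_two_blocks:
  assumes P: "noncrossing_partition {..<n} P" and "card P = 2"
  obtains (interval) p q where "1 \<le> p" "p \<le> q" "q < n" "P = {{p..q}, {..<n} - {p..q}}"
proof -
  note part = noncrossing_partitionD(1)[OF P]
  obtain B C where PBC: "P = {B, C}" "B \<noteq> C" using \<open>card P = 2\<close> by (meson card_2_iff)
  have gen: thesis if PBC: "P = {B, C}" "B \<noteq> C" and "0 \<in> C" for B C
  proof -
    have BC: "B \<union> C = {..<n}" "B \<inter> C = {}" "B \<noteq> {}"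
      using partition_onD1[OF part] partition_onD2[OF part] partition_onD3[OF part] PBC
      by (auto simp: disjoint_def)
    have fin: "finite B" using BC(1) by (metis finite_Un finite_lessThan)
    define p where "p = Min B"
    define q where "q = Max B"
    have pq: "p \<in> B" "q \<in> B" "\<And>x. x \<in> B \<Longrightarrow> p \<le> x \<and> x \<le> q"
      using fin BC(3) by (auto simp: p_def q_def)
    have "p \<noteq> 0" using pq BC(2) \<open>0 \<in> C\<close> by auto
    have "q < n" using pq BC(1) by auto
    have Beq: "B = {p..q}"
    proof (intro equalityI subsetI)
      fix x assume x: "x \<in> {p..q}"
      show "x \<in> B"
      proof (rule ccontr)
        assume "x \<notin> B"
        moreover from this have "x \<in> C" "x \<noteq> p" "x \<noteq> q" using x \<open>q < n\<close> BC(1) pq by auto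
        ultimately show False
          using noncrossing_partitionD(2)[OF P, of C B 0 p x q] PBC pq x \<open>p \<noteq> 0\<close> \<open>0 \<in> C\<close> by auto
      qed
    next
      fix x assume "x \<in> B"
      then show "x \<in> {p..q}" using pq(3) by simp
    qed
    have Ceq: "C = {..<n} - B" using BC by blast
    show thesis
    proof (rule interval)
      show "1 \<le> p" using \<open>p \<noteq> 0\<close> by simp
      show "p \<le> q" using pq(3)[OF pq(2)] by simp
      show "q < n" by fact
      show "P = {{p..q}, {..<n} - {p..q}}" unfolding PBC(1) Ceq by (simp only: Beq[symmetric])
    qed
  qed
  have "n \<noteq> 0"
  proof
    assume "n = 0"
    then have "B = {}" "C = {}" using partition_onD1[OF part] PBC by auto
    then show False using PBC by simp
  qed
  then have "0 \<in> B \<union> C" using partition_onD1[OF part] PBC by auto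
  then show thesis using gen[of B C] gen[of C B] PBC by (metis UnE insert_commute)
qed

text \<open>\<open>I\<close> picks one element from each block. The size of \<open>I\<close> thus
  tells how many blocks the partitions contributing to a Pluecker coordinate have.\<close>

lemma concordant_card:
  assumes "partition_on {..<n} P" "concordant n P I J"
  shows "card I = card P"
proof -
  have I: "I \<subseteq> {..<n}" "\<And>B. B \<in> P \<Longrightarrow> card (I \<inter> B) = 1"
    using assms(2) unfolding concordant_def by auto
  have finP: "finite P" using assms(1) by (rule finite_elements[rotated]) simp
  have "I = (\<Union>B\<in>P. I \<inter> B)" using I(1) partition_onD1[OF assms(1)] by blast
  then have "card I = card (\<Union>B\<in>P. I \<inter> B)" by simp
  also have "\<dots> = (\<Sum>B\<in>P. card (I \<inter> B))"
    using finP finite_subset[OF I(1)] disjointD[OF partition_onD2[OF assms(1)]]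
    by (intro card_UN_disjoint) auto
  also have "\<dots> = card P" using I(2) by simp
  finally show ?thesis .
qed

lemma concordant_one_block:
  assumes "n \<ge> 1" "noncrossing_partition {..<n} P" "k < n"
  shows "concordant n P {k} {..<n} \<longleftrightarrow> P = {{..<n}}"
proof
  note part = noncrossing_partitionD(1)[OF assms(2)]
  assume "concordant n P {k} {..<n}"
  then have "card P = 1" using concordant_card[OF part, of "{k}" "{..<n}"] by simp
  then obtain B where "P = {B}" by (rule card_1_singletonE)
  then show "P = {{..<n}}" using partition_onD1[OF part] by simp
next
  assume "P = {{..<n}}"
  then show "concordant n P {k} {..<n}"
    using assms by (auto simp: concordant_def kreweras_one_block)
qed

definition separated :: "'a set set \<Rightarrow> 'a \<Rightarrow> 'a \<Rightarrow> bool" where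
  "separated P x y \<longleftrightarrow> \<not> (\<exists>B\<in>P. x \<in> B \<and> y \<in> B)"

text \<open>Everything depends on whether \<open>a\<close> and \<open>b\<close> are cut positions,
  that is, whether passing to the successor changes the block. On the tilde side the omitted
  \<open>b\<close> must belong to the only block with two elements. Of the four indicators, two
  equal 1 when both positions are cuts: the negative ones if a = b, the positive ones
  otherwise.\<close>

lemma concordant_two_blocks:
  assumes n: "n \<ge> 2" and P: "noncrossing_partition {..<n} P" "card P = 2" and ab: "a < n" "b < n"
  defines "s \<equiv> \<lambda>i. (i + 1) mod n"
  shows "concordant n P {a, s a} ({..<n} - {b}) \<longleftrightarrow> separated P a (s a) \<and> separated P b (s b)"
    and "of_bool (separated P a b) + of_bool (separated P (s a) (s b)) - of_bool (separated P (s a) b) -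
      of_bool (separated P a (s b)) =
      (if a = b then - 2 else 2) * (of_bool (concordant n P {a, s a} ({..<n} - {b})) :: real)"
proof -
  obtain p q where pq: "1 \<le> p" "p \<le> q" "q < n" and Peq: "P = {{p..q}, {..<n} - {p..q}}"
    using noncrossing_two_blocks[OF P] by metis
  have sn: "s i < n" for i using n by (simp add: s_def)
  have sep: "separated P x y \<longleftrightarrow> (x \<in> {p..q}) \<noteq> (y \<in> {p..q})" if "x < n" "y < n" for x y
    using that unfolding separated_def Peq by auto
  have s: "s i = (if i = n - 1 then 0 else i + 1)" if "i < n" for i
    using that n by (auto simp: s_def)
  have ne: "s i \<noteq> i" if "i < n" for i using s[OF that] n by auto
  have cut: "(i \<in> {p..q}) \<noteq> (s i \<in> {p..q}) \<longleftrightarrow> i = p - 1 \<or> i = q" if "i < n" for i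
    using s[OF that] pq that by auto
  have K: "kreweras n P = insert {p - 1, q} ((\<lambda>i. {i}) ` ({..<n} - {p - 1, q}))"
    using kreweras_two_blocks[OF pq] P(1) unfolding Peq by blast
  have two: "card ({x, y} \<inter> S) = 1 \<longleftrightarrow> (x \<in> S) \<noteq> (y \<in> S)" if "x \<noteq> y" for x y :: nat and S
    using that by (cases "x \<in> S"; cases "y \<in> S") (auto simp: Int_insert_left)
  have blocks: "(\<forall>B\<in>P. card ({a, s a} \<inter> B) = 1) \<longleftrightarrow> (a \<in> {p..q}) \<noteq> (s a \<in> {p..q})"
    unfolding Peq using two[OF ne[OF ab(1), symmetric]] ab sn[of a] by auto
  have "card (({..<n} - {b}) \<inter> {p - 1, q}) = 1 \<longleftrightarrow> b = p - 1 \<or> b = q"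
  proof -
    have "card ({p - 1, q} \<inter> ({..<n} - {b})) = 1 \<longleftrightarrow> (p - 1 \<in> {..<n} - {b}) \<noteq> (q \<in> {..<n} - {b})"
      using pq by (intro two) auto
    then show ?thesis using pq by (auto simp: Int_commute)
  qed
  moreover have "card (({..<n} - {b}) \<inter> {i}) = 1 \<longleftrightarrow> i \<noteq> b" if "i < n" for i
    using that by (cases "i = b") auto
  ultimately have tilde: "(\<forall>B\<in>kreweras n P. card (({..<n} - {b}) \<inter> B) = 1) \<longleftrightarrow> b = p - 1 \<or> b = q"
    unfolding K by auto
  show conc: "concordant n P {a, s a} ({..<n} - {b}) \<longleftrightarrow> separated P a (s a) \<and> separated P b (s b)"
    unfolding concordant_def blocks tilde sep[OF ab(1) sn] sep[OF ab(2) sn] cut[OF ab(2)]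
    using ab sn[of a] by auto
  show "of_bool (separated P a b) + of_bool (separated P (s a) (s b)) - of_bool (separated P (s a) b) -
      of_bool (separated P a (s b)) =
      (if a = b then - 2 else 2) * (of_bool (concordant n P {a, s a} ({..<n} - {b})) :: real)"
  proof -
    \<comment> \<open>The cuts are p - 1, the last label before the interval, and q, the last label
      in it; two different cuts therefore lie on different sides.\<close>
    have key: "(a \<in> {p..q}) \<noteq> (b \<in> {p..q})"
      if "a \<noteq> b" "(a \<in> {p..q}) \<noteq> (s a \<in> {p..q})" "(b \<in> {p..q}) \<noteq> (s b \<in> {p..q})"
      using that cut[OF ab(1)] cut[OF ab(2)] pq by auto
    show ?thesis
      unfolding conc sep[OF ab(1,2)] sep[OF ab(1) sn] sep[OF ab(2) sn] sep[OF sn sn] sep[OF sn ab(2)]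
      using key
      by (cases "a = b"; cases "a \<in> {p..q}"; cases "s a \<in> {p..q}"; cases "b \<in> {p..q}"; cases "s b \<in> {p..q}")
        (simp_all del: atLeastAtMost_iff)
  qed
qed

section \<open>Affine charts of the Grassmannian\<close>

lemma row_span_iff:
  assumes A: "A \<in> carrier_mat m N"
  shows "x \<in> row_span N A \<longleftrightarrow> x \<in> carrier_vec N \<and> (\<exists>y. \<forall>c<N. x $ c = (\<Sum>r<m. y r * A $$ (r, c)))"
proof -
  interpret vec_space "TYPE(real)" N .
  have span: "row_span N A = {w \<in> carrier_vec N. \<exists>y\<in>carrier_vec m. A\<^sup>T *\<^sub>v y = w}"
    using row_space_eq[OF A] A by (simp add: row_span_def)
  have entry: "(A\<^sup>T *\<^sub>v y) $ c = (\<Sum>r<m. y $ r * A $$ (r, c))" if "y \<in> carrier_vec m" "c < N" for y c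
    using that A by (simp add: scalar_prod_def atLeast0LessThan mult.commute)
  show ?thesis
  proof
    assume "x \<in> row_span N A"
    then obtain y where "x \<in> carrier_vec N" "y \<in> carrier_vec m" "A\<^sup>T *\<^sub>v y = x"
      unfolding span by blast
    then show "x \<in> carrier_vec N \<and> (\<exists>y. \<forall>c<N. x $ c = (\<Sum>r<m. y r * A $$ (r, c)))"
      using entry by (intro conjI exI[of _ "\<lambda>r. y $ r"]) auto
  next
    assume "x \<in> carrier_vec N \<and> (\<exists>y. \<forall>c<N. x $ c = (\<Sum>r<m. y r * A $$ (r, c)))"
    then obtain y where x: "x \<in> carrier_vec N" and y: "\<And>c. c < N \<Longrightarrow> x $ c = (\<Sum>r<m. y r * A $$ (r, c))"
      by blast
    have "A\<^sup>T *\<^sub>v Matrix.vec m y = x"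
    proof (rule eq_vecI)
      show "dim_vec (A\<^sup>T *\<^sub>v Matrix.vec m y) = dim_vec x" using x A by simp
      fix c assume "c < dim_vec x"
      then show "(A\<^sup>T *\<^sub>v Matrix.vec m y) $ c = x $ c"
        using entry[of "Matrix.vec m y" c] y[of c] x by simp
    qed
    then show "x \<in> row_span N A" unfolding span using x by auto
  qed
qed

lemma row_in_row_span:
  assumes A: "A \<in> carrier_mat m N" and r: "r < m"
  shows "Matrix.row A r \<in> row_span N A"
proof -
  have "(\<Sum>r'<m. of_bool (r' = r) * A $$ (r', c)) = A $$ (r, c)" for c
  proof -
    have "(\<Sum>r'<m. of_bool (r' = r) * A $$ (r', c)) = (\<Sum>r'\<in>{r}. of_bool (r' = r) * A $$ (r', c))"
      using r by (intro sum.mono_neutral_right) auto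
    then show ?thesis by simp
  qed
  then show ?thesis
    unfolding row_span_iff[OF A] using A r by (intro conjI exI[of _ "\<lambda>r'. of_bool (r' = r)"]) auto
qed

text \<open>The elements of a maximal independent subset serve as rows. This guarantees that the
  choice in \<open>pluecker\<close> returns a matrix with row span \<open>X\<close>.\<close>

lemma grassmannian_matrix:
  assumes "X \<in> grassmannian k N"
  obtains A where "A \<in> carrier_mat k N" "row_span N A = X"
proof -
  interpret vec_space "TYPE(real)" N .
  have sub: "subspace class_ring X V" and dim: "vectorspace.dim class_ring (vs X) = k"
    using assms unfolding grassmannian_def by auto
  have mod: "submodule class_ring X V" using sub by (simp add: subspace_def)
  then have X: "X \<subseteq> carrier_vec N" by (simp add: submodule_def)
  let ?P = "\<lambda>S. S \<subseteq> X \<and> lin_indpt S"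
  have bound: "finite S \<and> card S \<le> N" if "?P S" for S
    using li_le_dim[of S] that X dim_is_n by auto
  have "?P {}" by (simp add: lin_dep_def)
  moreover have "\<forall>T. ?P T \<longrightarrow> card T < Suc N"
    using bound by (simp add: less_Suc_eq_le)
  ultimately have "\<exists>S. ?P S \<and> (\<forall>T. ?P T \<longrightarrow> card T \<le> card S)"
    by (rule ex_has_greatest_nat)
  then obtain S where S: "?P S" and max: "\<And>T. ?P T \<Longrightarrow> card T \<le> card S"
    by meson
  have finS: "finite S" and SV: "S \<subseteq> carrier_vec N" using bound[OF S] S X by auto
  have "x \<in> span S" if x: "x \<in> X" for x
  proof (cases "x \<in> S")
    case True
    then show ?thesis using in_own_span[OF SV] by blast
  next
    case False
    have "\<not> ?P (S \<union> {x})"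
      using max[of "S \<union> {x}"] False finS by auto
    then have "lin_dep (S \<union> {x})" using S x by blast
    then show ?thesis
      using lin_dep_iff_in_span[OF SV _ _ False] S x X by blast
  qed
  moreover have "span S \<subseteq> X" using S mod by (intro span_is_subset) auto
  ultimately have span: "span S = X" by blast
  have "maximal S (\<lambda>T. T \<subseteq> S \<and> lin_indpt T)"
    using S unfolding maximal_def by blast
  then have "card S = k" using dim_span[OF SV finS] dim unfolding span by simp
  obtain xs where xs: "set xs = S" "distinct xs" using finite_distinct_list[OF finS] by blast
  show thesis
  proof (rule that)
    show "mat_of_rows N xs \<in> carrier_mat k N"
      using distinct_card[OF xs(2)] xs(1) \<open>card S = k\<close> by auto
    show "row_span N (mat_of_rows N xs) = X"
      using xs SV span by (simp add: row_span_def row_space_def)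
  qed
qed

section \<open>Linear relations from maximal minors\<close>

lemma pick_Diff_singleton:
  assumes S: "finite S" "card S = Suc m" and j: "j < Suc m" and k: "k < m"
  shows "pick (S - {pick S j}) k = pick S (if k < j then k else Suc k)"
proof -
  define k' where "k' = (if k < j then k else Suc k)"
  let ?e = "pick S k'" and ?T = "S - {pick S j}"
  have k': "k' < card S" "k' \<noteq> j" "j < card S" using j k S by (auto simp: k'_def)
  have e: "?e \<in> S" using pick_in_set_le[OF k'(1)] .
  have cmp: "pick S j < ?e \<longleftrightarrow> j < k'" "?e \<noteq> pick S j"
    using pick_mono_le[OF k'(1), of j] pick_mono_le[OF k'(3), of k'] k'(2) by (metis linorder_neqE_nat order_less_asym)+
  have "{a \<in> ?T. a < ?e} = {a \<in> S. a < ?e} - {pick S j}" by blast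
  then have "card {a \<in> ?T. a < ?e} = card {a \<in> S. a < ?e} - of_bool (pick S j < ?e)"
    using pick_in_set_le[OF k'(3)] S by auto
  also have "\<dots> = k' - of_bool (j < k')" using card_pick_le[OF k'(1)] cmp by simp
  also have "\<dots> = k" by (auto simp: k'_def)
  finally have "card {a \<in> ?T. a < ?e} = k" .
  moreover have "pick ?T (card {a \<in> ?T. a < ?e}) = ?e"
    using e cmp by (intro pick_card_in_set) auto
  ultimately show ?thesis unfolding k'_def by simp
qed

text \<open>
  Expand along the first row the vanishing determinant of the matrix that consists of the columns
  \<open>S\<close> of \<open>A\<close> bordered by \<open>x\<close>.
\<close>

lemma minor_circuit:
  assumes A: "A \<in> carrier_mat m N" and x: "x \<in> row_span N A" and S: "S \<subseteq> {..<N}" "card S = Suc m"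
  shows "(\<Sum>s\<in>S. (- 1) ^ card {t \<in> S. t < s} * x $ s * Determinant.det (submatrix A UNIV (S - {s}))) = 0"
proof -
  have finS: "finite S" using S(1) finite_subset by blast
  obtain y where y: "\<And>c. c < N \<Longrightarrow> x $ c = (\<Sum>r<m. y r * A $$ (r, c))"
    using x unfolding row_span_iff[OF A] by blast
  have pick: "pick S j \<in> S" "pick S j < N" if "j < Suc m" for j
    using pick_in_set_le[of j S] that S by auto
  define E where "E = Matrix.mat (Suc m) (Suc m) (\<lambda>(i, j). if i = 0 then x $ pick S j else A $$ (i - 1, pick S j))"
  have E: "E \<in> carrier_mat (Suc m) (Suc m)" by (simp add: E_def)
  \<comment> \<open>The vector \<open>x\<close> is the combination of the rows of \<open>A\<close>
    with coefficients \<open>y\<close>, so \<open>w\<close> records a dependency among the rows of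
    the bordered matrix.\<close>
  define w where "w = Matrix.vec (Suc m) (\<lambda>i. if i = 0 then - 1 else y (i - 1))"
  have w: "w \<in> carrier_vec (Suc m)" by (simp add: w_def)
  have "w \<noteq> 0\<^sub>v (Suc m)"
  proof
    assume "w = 0\<^sub>v (Suc m)"
    then have "w $ 0 = 0\<^sub>v (Suc m) $ 0" by simp
    then show False by (simp add: w_def)
  qed
  moreover have "E\<^sup>T *\<^sub>v w = 0\<^sub>v (Suc m)"
  proof (rule eq_vecI)
    fix j assume "j < dim_vec (0\<^sub>v (Suc m) :: real vec)"
    then have j: "j < Suc m" by simp
    then have "(E\<^sup>T *\<^sub>v w) $ j = (\<Sum>i<Suc m. E $$ (i, j) * w $ i)"
      using E w by (simp add: scalar_prod_def atLeast0LessThan del: sum.lessThan_Suc)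
    also have "\<dots> = - x $ pick S j + (\<Sum>r<m. y r * A $$ (r, pick S j))"
      unfolding sum.lessThan_Suc_shift using j by (simp add: E_def w_def mult.commute)
    also have "\<dots> = 0" using y[OF pick(2)[OF j]] by simp
    finally show "(E\<^sup>T *\<^sub>v w) $ j = 0\<^sub>v (Suc m) $ j" using j by simp
  qed (use E in simp)
  ultimately have "Determinant.det (E\<^sup>T) = 0"
    using det_0_iff_vec_prod_zero[of "E\<^sup>T" "Suc m"] E w by auto
  then have "0 = Determinant.det E" using det_transpose[OF E] by simp
  also have "\<dots> = (\<Sum>j<Suc m. E $$ (0, j) * cofactor E 0 j)"
    by (rule laplace_expansion_row[OF E]) simp
  also have "\<dots> = (\<Sum>j<Suc m. (- 1) ^ j * x $ pick S j * Determinant.det (submatrix A UNIV (S - {pick S j})))"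
  proof (intro sum.cong refl)
    fix j assume "j \<in> {..<Suc m}"
    then have j: "j < Suc m" by simp
    have card: "card {c. c < N \<and> c \<in> S - {pick S j}} = m"
    proof -
      have "{c. c < N \<and> c \<in> S - {pick S j}} = S - {pick S j}" using S by auto
      then show ?thesis using finS S pick[OF j] by simp
    qed
    have "mat_delete E 0 j = submatrix A UNIV (S - {pick S j})"
    proof (rule eq_matI)
      show "dim_row (mat_delete E 0 j) = dim_row (submatrix A UNIV (S - {pick S j}))"
        "dim_col (mat_delete E 0 j) = dim_col (submatrix A UNIV (S - {pick S j}))"
        using E A card by (auto simp: dim_submatrix mat_delete_def)
      fix i k assume "i < dim_row (submatrix A UNIV (S - {pick S j}))" "k < dim_col (submatrix A UNIV (S - {pick S j}))"
      then have ik: "i < m" "k < m" using A card by (auto simp: dim_submatrix)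
      have "submatrix A UNIV (S - {pick S j}) $$ (i, k) = A $$ (i, pick S (if k < j then k else Suc k))"
        using ik A card submatrix_index[of i A UNIV k "S - {pick S j}"]
        by (simp add: pick_UNIV pick_Diff_singleton[OF finS S(2) j ik(2)])
      also have "\<dots> = mat_delete E 0 j $$ (i, k)"
        using ik j by (simp add: mat_delete_def E_def)
      finally show "mat_delete E 0 j $$ (i, k) = submatrix A UNIV (S - {pick S j}) $$ (i, k)" by simp
    qed
    then show "E $$ (0, j) * cofactor E 0 j =
        (- 1) ^ j * x $ pick S j * Determinant.det (submatrix A UNIV (S - {pick S j}))"
      using j by (simp add: cofactor_def E_def)
  qed
  also have "\<dots> = (\<Sum>s\<in>S. (- 1) ^ card {t \<in> S. t < s} * x $ s * Determinant.det (submatrix A UNIV (S - {s})))"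
  proof (rule sum.reindex_bij_witness[where i = "\<lambda>s. card {t \<in> S. t < s}" and j = "pick S"])
    fix j assume "j \<in> {..<Suc m}"
    then have j: "j < card S" using S by simp
    show "card {t \<in> S. t < pick S j} = j" by (rule card_pick_le[OF j])
    show "pick S j \<in> S" by (rule pick_in_set_le[OF j])
    show "(- 1) ^ card {t \<in> S. t < pick S j} * x $ pick S j * Determinant.det (submatrix A UNIV (S - {pick S j})) =
        (- 1) ^ j * x $ pick S j * Determinant.det (submatrix A UNIV (S - {pick S j}))"
      by (simp add: card_pick_le[OF j])
  next
    fix s assume s: "s \<in> S"
    show "pick S (card {t \<in> S. t < s}) = s" by (rule pick_card_in_set[OF s])
    have "card {t \<in> S. t < s} < card S" using s finS by (intro psubset_card_mono) auto
    then show "card {t \<in> S. t < s} \<in> {..<Suc m}" using S by simp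
  qed
  finally show ?thesis by simp
qed

text \<open>The circuit relation for the columns of \<open>k\<close>, \<open>l\<close> and all tilde
  labels. Tilde column \<open>i\<close> is preceded by \<open>i\<close> tilde columns and by those
  of the columns of \<open>k\<close>, \<open>l\<close> whose label is at most \<open>i\<close>; just
  one of these precedes it iff \<open>k \<le> i\<close> and \<open>i < l\<close>, which gives the
  extra sign.\<close>

lemma minor_circuit_tilde:
  assumes A: "A \<in> carrier_mat (n + 1) (2 * n)" and x: "x \<in> row_span (2 * n) A" and kl: "k < l" "l < n"
  shows "(- 1) ^ k * x $ (2 * k) * minor A {l} {..<n} - (- 1) ^ l * x $ (2 * l) * minor A {k} {..<n} +
    (\<Sum>i<n. (if k \<le> i \<and> i < l then - 1 else 1) * (- 1) ^ i * x $ (2 * i + 1) * minor A {k, l} ({..<n} - {i})) = 0"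
proof -
  let ?ev = "\<lambda>i::nat. 2 * i" and ?od = "\<lambda>i::nat. 2 * i + 1"
  let ?O = "?od ` {..<n}"
  define S where "S = insert (2 * k) (insert (2 * l) ?O)"
  have inj: "inj_on ?od I" for I by (auto simp: inj_on_def)
  have cardO: "card ((\<lambda>i. Suc (2 * i)) ` I) = card I" for I by (rule card_image) (auto simp: inj_on_def)
  have parity: "Suc (2 * a) \<noteq> 2 * b" "2 * b \<noteq> Suc (2 * a)" for a b by presburger+
  then have even: "2 * a \<notin> (\<lambda>i. Suc (2 * i)) ` I" for a I by blast
  have cardS: "card S = Suc (n + 1)" unfolding S_def using even kl by (simp add: cardO)
  have sub: "S \<subseteq> {..<2 * n}" using kl by (auto simp: S_def)
  let ?f = "\<lambda>s. (- 1) ^ card {t \<in> S. t < s} * x $ s * Determinant.det (submatrix A UNIV (S - {s}))"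
  have "sum ?f S = ?f (2 * k) + (?f (2 * l) + sum ?f ?O)"
    unfolding S_def[symmetric] using even kl by (subst (3) S_def) simp
  also have "?f (2 * k) = (- 1) ^ k * x $ (2 * k) * minor A {l} {..<n}"
  proof -
    have "{t \<in> S. t < 2 * k} = ?od ` {..<k}" using kl by (auto simp: S_def)
    moreover have "S - {2 * k} = ?ev ` {l} \<union> ?O" using kl by (auto simp: S_def parity)
    ultimately show ?thesis by (simp add: cardO minor_def)
  qed
  also have "?f (2 * l) = - ((- 1) ^ l * x $ (2 * l) * minor A {k} {..<n})"
  proof -
    have "{t \<in> S. t < 2 * l} = insert (2 * k) (?od ` {..<l})" using kl by (auto simp: S_def parity)
    moreover have "S - {2 * l} = ?ev ` {k} \<union> ?O" using kl by (auto simp: S_def parity)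
    ultimately show ?thesis using even by (simp add: cardO minor_def)
  qed
  also have "sum ?f ?O = (\<Sum>i<n. ?f (2 * i + 1))"
    by (subst sum.reindex[OF inj]) simp
  also have "\<dots> = (\<Sum>i<n. (if k \<le> i \<and> i < l then - 1 else 1) * (- 1) ^ i * x $ (2 * i + 1) *
      minor A {k, l} ({..<n} - {i}))"
  proof (intro sum.cong refl)
    fix i assume "i \<in> {..<n}"
    then have i: "i < n" by simp
    have "{t \<in> S. t < 2 * i + 1} = ?od ` {..<i} \<union> (?ev ` {a \<in> {k, l}. a \<le> i})"
      using kl i by (auto simp: S_def parity)
    moreover have "card (?od ` {..<i} \<union> (?ev ` {a \<in> {k, l}. a \<le> i})) = i + card {a \<in> {k, l}. a \<le> i}"
      by (subst card_Un_disjoint) (auto simp: cardO card_image inj_on_def parity)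
    moreover have "{a \<in> {k, l}. a \<le> i} = (if l \<le> i then {k, l} else if k \<le> i then {k} else {})"
      using kl by auto
    ultimately have "(- 1 :: real) ^ card {t \<in> S. t < 2 * i + 1} = (if k \<le> i \<and> i < l then - 1 else 1) * (- 1) ^ i"
      using kl by auto
    moreover have "S - {2 * i + 1} = ?ev ` {k, l} \<union> ?od ` ({..<n} - {i})"
      using kl by (auto simp: S_def parity)
    ultimately show "?f (2 * i + 1) = (if k \<le> i \<and> i < l then - 1 else 1) * (- 1) ^ i * x $ (2 * i + 1) *
        minor A {k, l} ({..<n} - {i})"
      by (simp add: minor_def)
  qed
  finally show ?thesis
    using minor_circuit[OF A x sub cardS] by simp
qed

section \<open>Coordinates on the row span of M'D\<close>

lemma M'D_carrier: "M'_mat n T * D_mat n \<in> carrier_mat (n + 1) (2 * n)"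
proof (rule mult_carrier_mat)
  show "M'_mat n T \<in> carrier_mat (n + 1) (2 * n)" by (simp add: M'_mat_def)
  show "D_mat n \<in> carrier_mat (2 * n) (2 * n)" by (simp add: D_mat_def)
qed

lemma M'D_index:
  assumes "r < n + 1" "c < 2 * n"
  shows "(M'_mat n T * D_mat n) $$ (r, c) = M'_mat n T $$ (r, c) * (- 1) ^ (c div 2)"
proof -
  have "M'_mat n T \<in> carrier_mat (n + 1) (2 * n)" by (simp add: M'_mat_def)
  then show ?thesis using assms unfolding D_mat_def by (subst mat_diag_mult_right) auto
qed

text \<open>\<open>\<xi>\<close> is the coefficient of the first row and \<open>u i\<close> that of
  the row of \<open>i\<close>; up to sign the latter can be read off from the tilde
  coordinates.\<close>

lemma M'D_row_span_iff:
  "x \<in> row_span (2 * n) (M'_mat n T * D_mat n) \<longleftrightarrow> x \<in> carrier_vec (2 * n) \<and>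
    (\<exists>\<xi> u. \<forall>l<n. x $ (2 * l) = (- 1) ^ l * (\<xi> + (\<Sum>i<n. u i * T $$ (i, l))) \<and> x $ (2 * l + 1) = (- 1) ^ l * u l)"
  (is "?L \<longleftrightarrow> ?C \<and> ?R")
proof -
  let ?N = "M'_mat n T * D_mat n"
  have even: "(\<Sum>r<n + 1. y r * ?N $$ (r, 2 * l)) = (- 1) ^ l * (y 0 + (\<Sum>i<n. y (Suc i) * T $$ (i, l)))"
    if l: "l < n" for y l
  proof -
    have "(\<Sum>r<n + 1. y r * ?N $$ (r, 2 * l)) = (\<Sum>r<Suc n. y r * (M'_mat n T $$ (r, 2 * l) * (- 1) ^ l))"
      using l by (intro sum.cong) (auto simp: M'D_index)
    also have "\<dots> = (- 1) ^ l * (y 0 + (\<Sum>i<n. y (Suc i) * T $$ (i, l)))"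
      unfolding sum.lessThan_Suc_shift distrib_left sum_distrib_left using l
      by (intro arg_cong2[where f = "(+)"] sum.cong) (auto simp: M'_mat_def)
    finally show ?thesis .
  qed
  have odd: "(\<Sum>r<n + 1. y r * ?N $$ (r, 2 * l + 1)) = (- 1) ^ l * y (Suc l)" if l: "l < n" for y l
  proof -
    have "(\<Sum>r<n + 1. y r * ?N $$ (r, 2 * l + 1)) = (\<Sum>r<Suc n. y r * (M'_mat n T $$ (r, 2 * l + 1) * (- 1) ^ l))"
      using l by (intro sum.cong) (auto simp: M'D_index)
    also have "\<dots> = (\<Sum>r\<in>{Suc l}. y r * (M'_mat n T $$ (r, 2 * l + 1) * (- 1) ^ l))"
      using l by (intro sum.mono_neutral_right) (auto simp: M'_mat_def)
    finally show ?thesis using l by (simp add: M'_mat_def)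
  qed
  have split: "(\<forall>c<2 * n. P c) \<longleftrightarrow> (\<forall>l<n. P (2 * l) \<and> P (2 * l + 1))" for P
  proof (intro iffI allI impI)
    fix c assume P: "\<forall>l<n. P (2 * l) \<and> P (2 * l + 1)" and c: "c < 2 * n"
    then have "c div 2 < n" "c = 2 * (c div 2) \<or> c = 2 * (c div 2) + 1" by auto
    then show "P c" using P by metis
  qed auto
  have "(\<exists>y. \<forall>c<2 * n. x $ c = (\<Sum>r<n + 1. y r * ?N $$ (r, c))) \<longleftrightarrow> ?R"
  proof
    assume "\<exists>y. \<forall>c<2 * n. x $ c = (\<Sum>r<n + 1. y r * ?N $$ (r, c))"
    then obtain y where y: "\<forall>l<n. x $ (2 * l) = (\<Sum>r<n + 1. y r * ?N $$ (r, 2 * l)) \<and>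
        x $ (2 * l + 1) = (\<Sum>r<n + 1. y r * ?N $$ (r, 2 * l + 1))"
      unfolding split by (elim exE)
    have "x $ (2 * l) = (- 1) ^ l * (y 0 + (\<Sum>i<n. y (Suc i) * T $$ (i, l))) \<and> x $ (2 * l + 1) = (- 1) ^ l * y (Suc l)"
      if l: "l < n" for l
      using y[rule_format, OF l] unfolding even[OF l] odd[OF l] .
    then show ?R by (intro exI[of _ "y 0"] exI[of _ "\<lambda>i. y (Suc i)"]) simp
  next
    assume ?R
    then obtain \<xi> u where u: "\<And>l. l < n \<Longrightarrow> x $ (2 * l) = (- 1) ^ l * (\<xi> + (\<Sum>i<n. u i * T $$ (i, l))) \<and>
        x $ (2 * l + 1) = (- 1) ^ l * u l" by blast
    let ?y = "\<lambda>r. if r = 0 then \<xi> else u (r - 1)"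
    have "x $ (2 * l) = (\<Sum>r<n + 1. ?y r * ?N $$ (r, 2 * l)) \<and>
        x $ (2 * l + 1) = (\<Sum>r<n + 1. ?y r * ?N $$ (r, 2 * l + 1))" if "l < n" for l
      using u[OF that] even[OF that, of ?y] odd[OF that, of ?y] by simp
    then show "\<exists>y. \<forall>c<2 * n. x $ c = (\<Sum>r<n + 1. y r * ?N $$ (r, c))"
      unfolding split by (intro exI[of _ ?y] allI impI)
  qed
  then show ?thesis by (simp only: row_span_iff[OF M'D_carrier])
qed

text \<open>Inclusion gives A = C B with a square matrix C. Determinants of the columns
  \<open>J\<close> multiply, so the nonzero minor of A makes C invertible.\<close>

lemma row_span_eq_of_subset:
  assumes A: "A \<in> carrier_mat m N" and B: "B \<in> carrier_mat m N"
    and sub: "row_span N A \<subseteq> row_span N B"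
    and J: "Determinant.det (submatrix A UNIV J) \<noteq> 0" "J \<subseteq> {..<N}" "card J = m"
  shows "row_span N A = row_span N B"
proof -
  interpret vec_space "TYPE(real)" N .
  have "\<exists>y. \<forall>c<N. A $$ (r, c) = (\<Sum>i<m. y i * B $$ (i, c))" if r: "r < m" for r
  proof -
    have "Matrix.row A r \<in> row_span N B" using row_in_row_span[OF A r] sub by blast
    then obtain y where "\<forall>c<N. Matrix.row A r $ c = (\<Sum>i<m. y i * B $$ (i, c))"
      unfolding row_span_iff[OF B] by (elim conjE exE)
    then show ?thesis using A r by (intro exI[of _ y]) simp
  qed
  then obtain y where y: "\<And>r c. r < m \<Longrightarrow> c < N \<Longrightarrow> A $$ (r, c) = (\<Sum>i<m. y r i * B $$ (i, c))"
    by metis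
  define C where "C = Matrix.mat m m (\<lambda>(r, i). y r i)"
  have C: "C \<in> carrier_mat m m" by (simp add: C_def)
  have AC: "A = C * B"
    using A B C by (intro eq_matI) (auto simp: y C_def scalar_prod_def atLeast0LessThan)
  have card: "card {c. c < N \<and> c \<in> J} = m"
    using J by (metis Collect_conj_eq Collect_mem_eq inf.absorb_iff2 lessThan_def)
  have B': "submatrix B UNIV J \<in> carrier_mat m m"
    using B card by (intro carrier_matI) (simp_all add: dim_submatrix)
  have "submatrix A UNIV J = C * submatrix B UNIV J"
  proof (rule eq_matI)
    show "dim_row (submatrix A UNIV J) = dim_row (C * submatrix B UNIV J)"
      "dim_col (submatrix A UNIV J) = dim_col (C * submatrix B UNIV J)"
      using A B C card by (auto simp: dim_submatrix)
    fix i j assume "i < dim_row (C * submatrix B UNIV J)" "j < dim_col (C * submatrix B UNIV J)"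
    then have ij: "i < m" "j < m" using B B' C by auto
    then have "pick J j < N" using pick_le[of j N J] card by simp
    then have "submatrix A UNIV J $$ (i, j) = (\<Sum>k<m. y i k * B $$ (k, pick J j))"
      using submatrix_index[of i A UNIV j J] ij A card y by (simp add: pick_UNIV)
    also have "\<dots> = (\<Sum>k<m. C $$ (i, k) * submatrix B UNIV J $$ (k, j))"
      using submatrix_index[of _ B UNIV j J] ij B card by (intro sum.cong) (simp_all add: pick_UNIV C_def)
    also have "\<dots> = (C * submatrix B UNIV J) $$ (i, j)"
      using ij C B' by (simp add: scalar_prod_def atLeast0LessThan)
    finally show "submatrix A UNIV J $$ (i, j) = (C * submatrix B UNIV J) $$ (i, j)" .
  qed
  then have "Determinant.det C \<noteq> 0" using J(1) det_mult[OF C B'] by auto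
  from det_non_zero_imp_unit[OF C this, of "()"]
  obtain C' where "C' \<in> carrier_mat m m" "C' * C = 1\<^sub>m m" "C * C' = 1\<^sub>m m"
    unfolding Units_def ring_mat_def by auto
  then have "invertible_mat C" using C unfolding invertible_mat_def inverts_mat_def by auto
  then show ?thesis
    unfolding row_span_def AC using row_space_is_preserved[OF _ C B] by simp
qed

text \<open>Separates the linear algebra from the groves: all that is kept of the network is a
  Pluecker vector with one common nonzero value at a single label together with all tilde
  labels.\<close>

locale connected_chart =
  fixes n :: nat and X :: "real vec set" and p :: wedge_coeffs and Z :: real
  assumes n: "n \<ge> 1"
    and X: "X \<in> grassmannian (n + 1) (2 * n)"
    and pluecker: "has_pluecker_vector n X p"
    and tree: "\<And>k. k < n \<Longrightarrow> p {k} {..<n} = Z" and Z: "Z \<noteq> 0"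
begin

lemma representing_matrix:
  obtains A s where "A \<in> carrier_mat (n + 1) (2 * n)" "row_span (2 * n) A = X" "pluecker n X = minor A" "s \<noteq> 0"
    "\<And>I J. I \<subseteq> {..<n} \<Longrightarrow> J \<subseteq> {..<n} \<Longrightarrow> card I + card J = n + 1 \<Longrightarrow> minor A I J = s * p I J"
proof -
  define A where "A = (SOME A. A \<in> carrier_mat (n + 1) (2 * n) \<and> row_span (2 * n) A = X)"
  have "\<exists>A. A \<in> carrier_mat (n + 1) (2 * n) \<and> row_span (2 * n) A = X"
    using grassmannian_matrix[OF X] by metis
  then have A: "A \<in> carrier_mat (n + 1) (2 * n) \<and> row_span (2 * n) A = X"
    unfolding A_def by (rule someI_ex)
  have P: "pluecker n X = minor A" by (simp add: pluecker_def A_def)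
  obtain s where s: "s \<noteq> 0" "\<forall>I J. I \<subseteq> {..<n} \<and> J \<subseteq> {..<n} \<and> card I + card J = n + 1 \<longrightarrow> minor A I J = s * p I J"
    using pluecker unfolding has_pluecker_vector_def P by (elim exE conjE)
  show thesis
    by (rule that[of A s]) (use A P s in simp_all)
qed

lemma pluecker_nonzero: "k < n \<Longrightarrow> pluecker n X {k} {..<n} \<noteq> 0"
  by (rule representing_matrix) (simp add: tree Z)

text \<open>The coefficient of tilde coordinate \<open>i\<close> when the coordinate of label
  \<open>l\<close> is expressed through that of label \<open>k\<close>, with the signs of
  \<open>D_mat\<close> removed. It will be the difference of the entries \<open>l\<close> and
  \<open>k\<close> in row \<open>i\<close> of any chart matrix.\<close>

definition slope :: "nat \<Rightarrow> nat \<Rightarrow> nat \<Rightarrow> real" where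
  "slope k l i = (if k \<le> i \<and> i < l then - 1 else 1) * p {k, l} ({..<n} - {i}) / Z"

lemma linear_relation:
  assumes x: "x \<in> X" and kl: "k < l" "l < n"
  shows "(- 1) ^ l * x $ (2 * l) = (- 1) ^ k * x $ (2 * k) + (\<Sum>i<n. slope k l i * (- 1) ^ i * x $ (2 * i + 1))"
proof -
  obtain A s where A: "A \<in> carrier_mat (n + 1) (2 * n)" "row_span (2 * n) A = X" "s \<noteq> 0"
    "\<And>I J. I \<subseteq> {..<n} \<Longrightarrow> J \<subseteq> {..<n} \<Longrightarrow> card I + card J = n + 1 \<Longrightarrow> minor A I J = s * p I J"
    using representing_matrix by metis
  have single: "minor A {j} {..<n} = s * Z" if "j < n" for j
    using A(4)[of "{j}" "{..<n}"] tree[OF that] that by simp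
  have pair: "minor A {k, l} ({..<n} - {i}) = s * p {k, l} ({..<n} - {i})" if "i < n" for i
    using A(4)[of "{k, l}" "{..<n} - {i}"] kl that by auto
  have slope: "(if k \<le> i \<and> i < l then - 1 else 1) * (- 1) ^ i * x $ (2 * i + 1) * minor A {k, l} ({..<n} - {i}) =
      s * Z * (slope k l i * (- 1) ^ i * x $ (2 * i + 1))" if "i < n" for i
    using pair[OF that] Z by (simp add: slope_def)
  have "(\<Sum>i<n. (if k \<le> i \<and> i < l then - 1 else 1) * (- 1) ^ i * x $ (2 * i + 1) * minor A {k, l} ({..<n} - {i})) =
      s * Z * (\<Sum>i<n. slope k l i * (- 1) ^ i * x $ (2 * i + 1))"
    unfolding sum_distrib_left by (intro sum.cong refl slope) simp
  then have "s * Z * ((- 1) ^ k * x $ (2 * k) - (- 1) ^ l * x $ (2 * l) +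
      (\<Sum>i<n. slope k l i * (- 1) ^ i * x $ (2 * i + 1))) = 0"
    using minor_circuit_tilde[OF A(1) _ kl, of x] x A(2) single[of k] single[of l] kl
    by (simp add: algebra_simps)
  then show ?thesis using \<open>s \<noteq> 0\<close> Z by simp
qed

lemma chart_exists: "\<exists>T\<in>carrier_mat n n. X = row_span (2 * n) (M'_mat n T * D_mat n)"
proof -
  obtain A s where A: "A \<in> carrier_mat (n + 1) (2 * n)" "row_span (2 * n) A = X" "pluecker n X = minor A"
    using representing_matrix by metis
  \<comment> \<open>Adding a multiple of the first row of M' to another row shifts a row of
    \<open>T\<close> by a constant, so column 0 may be normalized to 0; the other columns are then
    forced.\<close>
  define T where "T = Matrix.mat n n (\<lambda>(i, l). if l = 0 then 0 else slope 0 l i)"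
  have sq: "(- 1 :: real) ^ i * ((- 1) ^ i * a) = a" for i a
    by (simp add: power_add[symmetric] mult.assoc[symmetric] flip: power_mult_distrib)
  have "X \<subseteq> row_span (2 * n) (M'_mat n T * D_mat n)"
  proof
    fix x assume x: "x \<in> X"
    have "x $ (2 * l) = (- 1) ^ l * (x $ 0 + (\<Sum>i<n. (- 1) ^ i * x $ (2 * i + 1) * T $$ (i, l)))" if l: "l < n" for l
    proof (cases "l = 0")
      case True
      then show ?thesis using n by (simp add: T_def)
    next
      case False
      have "(- 1) ^ l * x $ (2 * l) = x $ 0 + (\<Sum>i<n. slope 0 l i * (- 1) ^ i * x $ (2 * i + 1))"
        using linear_relation[OF x, of 0 l] False l by simp
      also have "(\<Sum>i<n. slope 0 l i * (- 1) ^ i * x $ (2 * i + 1)) = (\<Sum>i<n. (- 1) ^ i * x $ (2 * i + 1) * T $$ (i, l))"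
        using False l by (intro sum.cong) (auto simp: T_def)
      finally show ?thesis by (metis sq)
    qed
    moreover have "x $ (2 * l + 1) = (- 1) ^ l * ((- 1) ^ l * x $ (2 * l + 1))" for l
      by (simp add: sq)
    moreover have "x \<in> carrier_vec (2 * n)"
      using x A row_span_iff[OF A(1)] by blast
    ultimately show "x \<in> row_span (2 * n) (M'_mat n T * D_mat n)"
      unfolding M'D_row_span_iff
      by (intro conjI exI[of _ "x $ 0"] exI[of _ "\<lambda>i. (- 1) ^ i * x $ (2 * i + 1)"]) auto
  qed
  moreover have "minor A {0} {..<n} \<noteq> 0" using pluecker_nonzero[of 0] n A(3) by simp
  then have "Determinant.det (submatrix A UNIV (insert 0 ((\<lambda>i. 2 * i + 1) ` {..<n}))) \<noteq> 0"
    by (simp add: minor_def)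
  moreover have "insert 0 ((\<lambda>i. 2 * i + 1) ` {..<n}) \<subseteq> {..<2 * n}" using n by auto
  moreover have "card (insert 0 ((\<lambda>i. 2 * i + 1) ` {..<n})) = n + 1"
    by (subst card_insert_disjoint) (auto simp: card_image inj_on_def)
  ultimately have "X = row_span (2 * n) (M'_mat n T * D_mat n)"
    using row_span_eq_of_subset[OF A(1) M'D_carrier] A(2) by metis
  moreover have "T \<in> carrier_mat n n" by (simp add: T_def)
  ultimately show ?thesis by blast
qed

text \<open>The row of M'D belonging to \<open>i\<close> has a single nonzero tilde coordinate, so
  the linear relation evaluated on it isolates one coefficient.\<close>

lemma chart_differences:
  assumes T: "X = row_span (2 * n) (M'_mat n T * D_mat n)" and kl: "k < l" "l < n" and i: "i < n"
  shows "T $$ (i, l) - T $$ (i, k) = slope k l i"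
proof -
  let ?N = "M'_mat n T * D_mat n"
  define x where "x = Matrix.row ?N (Suc i)"
  have x: "x \<in> X" unfolding T x_def using i by (intro row_in_row_span[OF M'D_carrier]) simp
  have carrier: "dim_row ?N = n + 1" "dim_col ?N = 2 * n" using M'D_carrier[of n T] by auto
  have ev: "x $ (2 * j) = (- 1) ^ j * T $$ (i, j)" if "j < n" for j
    using that i carrier M'D_index[of "Suc i" n "2 * j" T] by (simp add: x_def M'_mat_def)
  have od: "x $ (2 * j + 1) = (- 1) ^ j * of_bool (j = i)" if "j < n" for j
    using that i carrier M'D_index[of "Suc i" n "2 * j + 1" T] by (simp add: x_def M'_mat_def)
  have sq: "(- 1 :: real) ^ j * ((- 1) ^ j * a) = a" for j a
    by (simp add: power_add[symmetric] mult.assoc[symmetric] flip: power_mult_distrib)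
  have "(\<Sum>j<n. slope k l j * (- 1) ^ j * x $ (2 * j + 1)) = (\<Sum>j\<in>{i}. slope k l j * (- 1) ^ j * x $ (2 * j + 1))"
    using i by (intro sum.mono_neutral_right) (auto simp: od[simplified])
  also have "\<dots> = slope k l i" using od[OF i] sq[of i 1] by (simp add: mult.assoc)
  finally show ?thesis
    using linear_relation[OF x kl] ev[of k] ev[of l] kl by (simp add: sq)
qed

end

text \<open>Neighbouring labels carry opposite signs in \<open>D_mat\<close>, so the second sum of
  \<open>skew_form\<close> changes sign and combines with the first into cyclic differences. These
  cancel \<open>\<xi>\<close> and \<open>\<eta>\<close> and are the combinations with coefficients
  from \<open>Q_mat\<close>.\<close>

lemma skew_form_M'D:
  assumes n: "n \<ge> 1"
    and x: "\<And>l. l < n \<Longrightarrow> x $ (2 * l) = (- 1) ^ l * (\<xi> + (\<Sum>i<n. u i * T $$ (i, l))) \<and> x $ (2 * l + 1) = (- 1) ^ l * u l"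
    and y: "\<And>l. l < n \<Longrightarrow> y $ (2 * l) = (- 1) ^ l * (\<eta> + (\<Sum>i<n. v i * T $$ (i, l))) \<and> y $ (2 * l + 1) = (- 1) ^ l * v l"
  shows "skew_form n x y = (\<Sum>a<n. \<Sum>b<n. Q_mat n T $$ (a, b) * (u a * v b - v a * u b))"
proof -
  define X where "X l = \<xi> + (\<Sum>i<n. u i * T $$ (i, l))" for l
  define Y where "Y l = \<eta> + (\<Sum>i<n. v i * T $$ (i, l))" for l
  define s where "s i = (i + 1) mod n" for i
  have sq: "(- 1 :: real) ^ j * a * ((- 1) ^ j * b) = a * b" for j a b
  proof -
    have "(- 1 :: real) ^ j * (- 1) ^ j = 1" by (simp flip: power_mult_distrib)
    then show ?thesis by (metis (no_types, lifting) mult.assoc mult.commute mult_1)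
  qed
  have x': "x $ (2 * l) = (- 1) ^ l * X l" "x $ (2 * l + 1) = (- 1) ^ l * u l" if "l < n" for l
    using x[OF that] by (auto simp: X_def)
  have y': "y $ (2 * l) = (- 1) ^ l * Y l" "y $ (2 * l + 1) = (- 1) ^ l * v l" if "l < n" for l
    using y[OF that] by (auto simp: Y_def)
  obtain m where m: "n = Suc m" using n by (cases n) auto
  have first: "(\<Sum>i<n. x $ (2 * i) * y $ (2 * i + 1) - x $ (2 * i + 1) * y $ (2 * i)) = (\<Sum>i<n. X i * v i - u i * Y i)"
    by (intro sum.cong refl) (simp add: x' y' sq del: One_nat_def)
  have second: "(\<Sum>j<n - 1. x $ (2 * (j + 1)) * y $ (2 * j + 1) - x $ (2 * j + 1) * y $ (2 * (j + 1))) =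
      - (\<Sum>j<m. X (s j) * v j - u j * Y (s j))"
    unfolding sum_negf[symmetric]
  proof (rule sum.cong)
    fix j assume "j \<in> {..<m}"
    then have j: "j < n" "j + 1 < n" "s j = j + 1" by (auto simp: m s_def)
    have "(- 1 :: real) ^ (j + 1) * a * ((- 1) ^ j * b) = - (a * b)" for a b
      using sq[of j a b] by simp
    moreover have "(- 1 :: real) ^ j * a * ((- 1) ^ (j + 1) * b) = - (a * b)" for a b
      using sq[of j a b] by simp
    ultimately show "x $ (2 * (j + 1)) * y $ (2 * j + 1) - x $ (2 * j + 1) * y $ (2 * (j + 1)) =
        - (X (s j) * v j - u j * Y (s j))"
      unfolding x'[OF j(1)] x'[OF j(2)] y'[OF j(1)] y'[OF j(2)] j(3) by (simp add: sq)
  qed (simp add: m)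
  \<comment> \<open>At the wrap the factor \<open>(- 1) ^ n\<close> supplies the missing sign:
    together with the sign of the last label it gives -1, as for all other neighbours.\<close>
  have third: "(- 1) ^ n * (x $ 0 * y $ (2 * (n - 1) + 1) - x $ (2 * (n - 1) + 1) * y $ 0) =
      - (X (s m) * v m - u m * Y (s m))"
  proof -
    have "s m = 0" by (simp add: m s_def)
    moreover have "(- 1 :: real) ^ n * (a * ((- 1) ^ m * b) - (- 1) ^ m * c * d) = - (a * b - c * d)" for a b c d
      using sq[of m 1 1] unfolding m by (simp add: algebra_simps)
    ultimately show ?thesis
      using x'[of 0] x'(2)[of m] y'[of 0] y'(2)[of m] m by simp
  qed
  have "skew_form n x y = (\<Sum>i<n. X i * v i - u i * Y i) - (\<Sum>i<n. X (s i) * v i - u i * Y (s i))"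
    unfolding skew_form_def first second third by (simp add: m)
  also have "\<dots> = (\<Sum>a<n. u a * (Y (s a) - Y a) - v a * (X (s a) - X a))"
    unfolding sum_subtractf[symmetric] by (intro sum.cong refl) (simp add: algebra_simps)
  also have "\<dots> = (\<Sum>a<n. \<Sum>b<n. Q_mat n T $$ (a, b) * (u a * v b - v a * u b))"
  proof (rule sum.cong)
    fix a assume a: "a \<in> {..<n}"
    have Q: "Q_mat n T $$ (a, b) = T $$ (b, s a) - T $$ (b, a)" if "b < n" for b
      using a that by (simp add: Q_mat_def s_def)
    have diff: "(\<Sum>i<n. w i * T $$ (i, s a)) - (\<Sum>i<n. w i * T $$ (i, a)) = (\<Sum>b<n. Q_mat n T $$ (a, b) * w b)" for w
      unfolding sum_subtractf[symmetric] by (intro sum.cong refl) (simp add: Q algebra_simps)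
    have "Y (s a) - Y a = (\<Sum>b<n. Q_mat n T $$ (a, b) * v b)" "X (s a) - X a = (\<Sum>b<n. Q_mat n T $$ (a, b) * u b)"
      using diff[of v] diff[of u] by (auto simp: X_def Y_def)
    then show "u a * (Y (s a) - Y a) - v a * (X (s a) - X a) =
        (\<Sum>b<n. Q_mat n T $$ (a, b) * (u a * v b - v a * u b))"
      by (simp add: sum_distrib_left sum_subtractf[symmetric] algebra_simps)
  qed simp
  finally show ?thesis .
qed

lemma isotropic_of_symmetric:
  assumes n: "n \<ge> 1" and sym: "transpose_mat (Q_mat n T) = Q_mat n T"
    and x: "x \<in> row_span (2 * n) (M'_mat n T * D_mat n)" and y: "y \<in> row_span (2 * n) (M'_mat n T * D_mat n)"
  shows "skew_form n x y = 0"
proof -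
  obtain \<xi> u where u: "\<And>l. l < n \<Longrightarrow> x $ (2 * l) = (- 1) ^ l * (\<xi> + (\<Sum>i<n. u i * T $$ (i, l))) \<and>
      x $ (2 * l + 1) = (- 1) ^ l * u l"
    using x unfolding M'D_row_span_iff by blast
  obtain \<eta> v where v: "\<And>l. l < n \<Longrightarrow> y $ (2 * l) = (- 1) ^ l * (\<eta> + (\<Sum>i<n. v i * T $$ (i, l))) \<and>
      y $ (2 * l + 1) = (- 1) ^ l * v l"
    using y unfolding M'D_row_span_iff by blast
  let ?Q = "\<lambda>a b. Q_mat n T $$ (a, b)"
  have Q: "?Q a b = ?Q b a" if "a < n" "b < n" for a b
    using arg_cong[OF sym, of "\<lambda>M. M $$ (b, a)"] that by (simp add: Q_mat_def)
  have "(\<Sum>a<n. \<Sum>b<n. ?Q a b * (v a * u b)) = (\<Sum>a<n. \<Sum>b<n. ?Q b a * (v b * u a))"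
    by (rule sum.swap)
  also have "\<dots> = (\<Sum>a<n. \<Sum>b<n. ?Q a b * (u a * v b))"
    by (intro sum.cong refl) (simp add: Q mult.commute)
  finally have "(\<Sum>a<n. \<Sum>b<n. ?Q a b * (v a * u b)) = (\<Sum>a<n. \<Sum>b<n. ?Q a b * (u a * v b))" .
  moreover have "skew_form n x y = (\<Sum>a<n. \<Sum>b<n. ?Q a b * (u a * v b - v a * u b))"
    using u v by (intro skew_form_M'D[OF n, where \<xi> = \<xi> and \<eta> = \<eta>]) simp_all
  ultimately show ?thesis by (simp add: right_diff_distrib sum_subtractf)
qed

section \<open>Grove vectors\<close>

lemma finite_groves:
  assumes "is_cactus_network n G"
  shows "finite {F. grove n G F}"
  by (rule finite_subset[OF _ finite_Pow_iff[THEN iffD2, OF is_cactus_networkD(3)[OF assms]]])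
    (auto simp: grove_def)

text \<open>Regrouping by partitions. The definition sums over noncrossing partitions only, so
  planarity is what ensures that every grove is counted.\<close>

lemma grove_vector_eq:
  assumes G: "is_cactus_network n G"
  shows "grove_vector n G I J =
    (\<Sum>F | grove n G F. grove_weight G F * of_bool (concordant n (grove_partition n G F) I J))"
proof -
  let ?S = "{F. grove n G F}" and ?T = "{P. noncrossing_partition {..<n} P}"
  have "?T \<subseteq> Pow (Pow {..<n})"
    unfolding noncrossing_partition_def partition_on_def by auto
  then have finT: "finite ?T" using finite_subset by fastforce
  have "grove_vector n G I J = (\<Sum>P\<in>?T. \<Sum>F\<in>{F \<in> ?S. grove_partition n G F = P}.
      grove_weight G F * of_bool (concordant n (grove_partition n G F) I J))"
    unfolding grove_vector_def grove_measurement_def f_vec_def sum_distrib_right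
    by (intro sum.cong) auto
  also have "\<dots> = (\<Sum>F\<in>?S. grove_weight G F * of_bool (concordant n (grove_partition n G F) I J))"
    using noncrossing_grove_partition[OF G]
    by (intro sum.group finT finite_groves[OF G]) (auto simp: grove_def)
  finally show ?thesis .
qed

lemma separated_grove_partition:
  assumes "i < n" "j < n"
  shows "separated (grove_partition n G F) i j \<longleftrightarrow>
    \<not> same_component G F (boundary_vertex n G i) (boundary_vertex n G j)"
proof -
  have "i \<in> \<Union> (grove_partition n G F)"
    using partition_onD1[OF partition_on_grove_partition] assms(1) by blast
  then obtain B where "B \<in> grove_partition n G F" "i \<in> B" by blast
  then show ?thesis
    unfolding separated_def using grove_partition_same_block(1)[where i = i and j = j] assms by metis
qed

lemma grove_forest: "grove n G F \<longleftrightarrow> F \<subseteq> edges G \<and> forest G F \<and>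
    (\<forall>v\<in>verts G. \<exists>u\<in>boundary_verts n G. same_component G F v u)"
  unfolding grove_def forest_iff_no_cycle by blast

lemma spanning_tree_iff_grove:
  assumes G: "is_cactus_network n G" and n: "n \<ge> 1"
  shows "spanning_tree G F \<longleftrightarrow> grove n G F \<and> grove_partition n G F = {{..<n}}"
proof
  have bv: "boundary_vertex n G i \<in> verts G" if "i < n" for i
    using is_cactus_networkD(5)[OF G] that by (auto simp: boundary_verts_def)
  note part = partition_on_grove_partition[of n G F]
  {
    assume T: "spanning_tree G F"
    then have conn: "\<And>u v. u \<in> verts G \<Longrightarrow> v \<in> verts G \<Longrightarrow> same_component G F u v"
      and F: "F \<subseteq> edges G" "forest G F"
      by (auto simp: spanning_tree_def)
    have "grove n G F"
      unfolding grove_forest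
    proof (intro conjI F ballI)
      fix v assume "v \<in> verts G"
      then show "\<exists>u\<in>boundary_verts n G. same_component G F v u"
        using conn bv[of 0] n unfolding boundary_verts_def
        by (intro bexI[of _ "boundary_vertex n G 0"]) auto
    qed
    moreover have block: "B = {..<n}" if B: "B \<in> grove_partition n G F" for B
    proof -
      obtain i where i: "i \<in> B" using partition_onD3[OF part] B by (metis all_not_in_conv)
      have "j \<in> B \<longleftrightarrow> j < n" for j
        using grove_partition_same_block[OF B i] conn bv by blast
      then show ?thesis by auto
    qed
    moreover have "grove_partition n G F \<noteq> {}"
      using partition_onD1[OF part] n by (auto simp: lessThan_empty_iff)
    ultimately show "grove n G F \<and> grove_partition n G F = {{..<n}}" by blast
  next
    assume "grove n G F \<and> grove_partition n G F = {{..<n}}"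
    then have F: "F \<subseteq> edges G" "forest G F" and P: "grove_partition n G F = {{..<n}}"
      and b: "\<And>v. v \<in> verts G \<Longrightarrow> \<exists>u\<in>boundary_verts n G. same_component G F v u"
      unfolding grove_forest by auto
    have bb: "same_component G F (boundary_vertex n G i) (boundary_vertex n G j)" if "i < n" "j < n" for i j
      using separated_grove_partition[OF that, of G F] that unfolding separated_def P by auto
    have "same_component G F u v" if uv: "u \<in> verts G" "v \<in> verts G" for u v
    proof -
      obtain i where "i < n" "same_component G F u (boundary_vertex n G i)"
        using b[OF uv(1)] by (auto simp: boundary_verts_def)
      moreover obtain j where "j < n" "same_component G F v (boundary_vertex n G j)"
        using b[OF uv(2)] by (auto simp: boundary_verts_def)
      ultimately show ?thesis using bb same_component_trans same_component_sym by metis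
    qed
    then show "spanning_tree G F" using F unfolding spanning_tree_def by blast
  }
qed

text \<open>Each of the two components contains one of the two chosen boundary vertices, so such a
  forest is automatically a grove with a two-block partition.\<close>

lemma separating_forest_iff_grove:
  assumes G: "is_cactus_network n G" and ij: "i < n" "j < n"
  shows "separating_forest G (boundary_vertex n G i) (boundary_vertex n G j) F \<longleftrightarrow>
    grove n G F \<and> card (grove_partition n G F) = 2 \<and> separated (grove_partition n G F) i j"
proof
  let ?v = "boundary_vertex n G" and ?P = "grove_partition n G F"
  have bv: "?v k \<in> verts G" if "k < n" for k
    using is_cactus_networkD(5)[OF G] that by (auto simp: boundary_verts_def)
  note part = partition_on_grove_partition[of n G F]
  have cover: "\<exists>B\<in>?P. k \<in> B" if "k < n" for k
    using partition_onD1[OF part] that by blast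
  obtain B where B: "B \<in> ?P" "i \<in> B" using cover[OF ij(1)] by blast
  obtain C where C: "C \<in> ?P" "j \<in> C" using cover[OF ij(2)] by blast
  {
    assume F: "separating_forest G (?v i) (?v j) F"
    then have sep: "separated ?P i j"
      unfolding separated_grove_partition[OF ij] by (simp add: separating_forest_def)
    have conn: "same_component G F (?v i) w \<or> same_component G F (?v j) w" if "w \<in> verts G" for w
      using F that unfolding separating_forest_def by blast
    have "D = B \<or> D = C" if D: "D \<in> ?P" for D
    proof -
      obtain k where k: "k \<in> D" using partition_onD3[OF part] D by (metis all_not_in_conv)
      have "k < n" using grove_partition_same_block(2)[OF D k] .
      then have "k \<in> B \<or> k \<in> C"
        using conn[OF bv] grove_partition_same_block(1)[OF B] grove_partition_same_block(1)[OF C] by blast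
      then show ?thesis
        using disjointD[OF partition_onD2[OF part] D B(1)] disjointD[OF partition_onD2[OF part] D C(1)] k by blast
    qed
    then have "?P = {B, C}" using B C by blast
    moreover have "B \<noteq> C" using sep B C unfolding separated_def by blast
    moreover have "grove n G F"
      unfolding grove_forest
    proof (intro conjI ballI)
      fix w assume "w \<in> verts G"
      then show "\<exists>u\<in>boundary_verts n G. same_component G F w u"
        using conn[of w] ij same_component_sym unfolding boundary_verts_def by blast
    qed (use F in \<open>simp_all add: separating_forest_def\<close>)
    ultimately show "grove n G F \<and> card ?P = 2 \<and> separated ?P i j" using sep by simp
  next
    assume "grove n G F \<and> card ?P = 2 \<and> separated ?P i j"
    then have F: "F \<subseteq> edges G" "forest G F" and card: "card ?P = 2" and sep: "separated ?P i j"
      and b: "\<And>w. w \<in> verts G \<Longrightarrow> \<exists>u\<in>boundary_verts n G. same_component G F w u"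
      unfolding grove_forest by auto
    have "B \<noteq> C" using sep B C unfolding separated_def by blast
    have fin: "finite ?P" using card by (metis card.infinite zero_neq_numeral)
    have "{B, C} = ?P"
      using B C card \<open>B \<noteq> C\<close> by (intro card_subset_eq[OF fin]) auto
    have "same_component G F (?v i) w \<or> same_component G F (?v j) w" if "w \<in> verts G" for w
    proof -
      obtain k where k: "k < n" "same_component G F w (?v k)"
        using b[OF \<open>w \<in> verts G\<close>] by (auto simp: boundary_verts_def)
      have "k \<in> B \<or> k \<in> C" using cover[OF k(1)] \<open>{B, C} = ?P\<close> by blast
      then have "same_component G F (?v i) (?v k) \<or> same_component G F (?v j) (?v k)"
        using grove_partition_same_block(1)[OF B, of k] grove_partition_same_block(1)[OF C, of k] by blast
      then show ?thesis using k(2) same_component_trans same_component_sym by metis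
    qed
    then show "separating_forest G (?v i) (?v j) F"
      using F sep unfolding separating_forest_def separated_grove_partition[OF ij] by blast
  }
qed

section \<open>Pluecker coordinates and resistances as weights of groves\<close>

lemma grove_vector_spanning_trees:
  assumes G: "is_cactus_network n G" and n: "n \<ge> 1" and k: "k < n"
  shows "grove_vector n G {k} {..<n} = tree_weight G"
proof -
  have "grove_vector n G {k} {..<n} =
      (\<Sum>F | grove n G F. grove_weight G F * of_bool (grove_partition n G F = {{..<n}}))"
    unfolding grove_vector_eq[OF G]
    using concordant_one_block[OF n noncrossing_grove_partition[OF G] k]
    by (intro sum.cong refl) (simp add: grove_def)
  also have "\<dots> = (\<Sum>F | spanning_tree G F. grove_weight G F * of_bool (grove_partition n G F = {{..<n}}))"
    by (intro sum.mono_neutral_right finite_groves[OF G]) (auto simp: spanning_tree_iff_grove[OF G n])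
  also have "\<dots> = tree_weight G"
    unfolding tree_weight_def by (intro sum.cong refl) (simp add: spanning_tree_iff_grove[OF G n])
  finally show ?thesis .
qed

text \<open>The range of summation no longer depends on \<open>i\<close> and \<open>j\<close>, so
  second differences of the resistance can be taken grove by grove.\<close>

lemma resistance_eq_grove_sum:
  assumes G: "is_cactus_network n G" and conn: "network_connected G" and ij: "i < n" "j < n"
  shows "tree_weight G * resistance n G i j =
    (\<Sum>F | grove n G F \<and> card (grove_partition n G F) = 2.
      grove_weight G F * of_bool (separated (grove_partition n G F) i j))"
    (is "_ = sum ?f ?S")
proof -
  have fin: "finite ?S" by (rule finite_subset[OF _ finite_groves[OF G]]) auto
  have "tree_weight G * resistance n G i j =
      (\<Sum>F | separating_forest G (boundary_vertex n G i) (boundary_vertex n G j) F. grove_weight G F)"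
    using resistance_eq_forest_sum[OF G conn ij] tree_weight_pos[OF G conn] by simp
  also have "\<dots> = (\<Sum>F | separating_forest G (boundary_vertex n G i) (boundary_vertex n G j) F. ?f F)"
    by (intro sum.cong refl) (simp add: separating_forest_iff_grove[OF G ij])
  also have "\<dots> = sum ?f ?S"
    by (intro sum.mono_neutral_left fin) (auto simp: separating_forest_iff_grove[OF G ij])
  finally show ?thesis .
qed

lemma L_star_eq_grove_vector:
  assumes G: "is_cactus_network n G" and conn: "network_connected G" and n: "n \<ge> 2" and ab: "a < n" "b < n"
  shows "L_star n G $$ (a, b) =
    (if a = b then - 1 else 1) * grove_vector n G {a, (a + 1) mod n} ({..<n} - {b}) / tree_weight G"
proof -
  define s where "s i = (i + 1) mod n" for i
  let ?R = "resistance n G" and ?Z = "tree_weight G"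
  let ?S = "{F. grove n G F \<and> card (grove_partition n G F) = 2}"
  let ?P = "grove_partition n G" and ?w = "grove_weight G"
  have sn: "s i < n" for i using n by (simp add: s_def)
  have ne: "a \<noteq> s a" using n ab(1) by (cases "a + 1 = n") (auto simp: s_def)
  have Z: "?Z > 0" by (rule tree_weight_pos[OF G conn])
  note Rsum = resistance_eq_grove_sum[OF G conn]
  have "?Z * (?R a b + ?R (s a) (s b) - ?R (s a) b - ?R a (s b)) =
      (\<Sum>F\<in>?S. ?w F * (of_bool (separated (?P F) a b) + of_bool (separated (?P F) (s a) (s b)) -
        of_bool (separated (?P F) (s a) b) - of_bool (separated (?P F) a (s b))))"
    unfolding distrib_left right_diff_distrib Rsum[OF ab] Rsum[OF sn sn] Rsum[OF sn ab(2)] Rsum[OF ab(1) sn]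
      sum.distrib[symmetric] sum_subtractf[symmetric] ..
  also have "\<dots> = (\<Sum>F\<in>?S. (if a = b then - 2 else 2) * (?w F * of_bool (concordant n (?P F) {a, s a} ({..<n} - {b}))))"
  proof (rule sum.cong)
    fix F assume "F \<in> ?S"
    then have "noncrossing_partition {..<n} (?P F)" "card (?P F) = 2"
      using noncrossing_grove_partition[OF G] by (auto simp: grove_def)
    from concordant_two_blocks(2)[OF n this ab]
    show "?w F * (of_bool (separated (?P F) a b) + of_bool (separated (?P F) (s a) (s b)) -
        of_bool (separated (?P F) (s a) b) - of_bool (separated (?P F) a (s b))) =
        (if a = b then - 2 else 2) * (?w F * of_bool (concordant n (?P F) {a, s a} ({..<n} - {b})))"
      unfolding s_def by simp
  qed simp
  also have "\<dots> = (if a = b then - 2 else 2) * (\<Sum>F\<in>?S. ?w F * of_bool (concordant n (?P F) {a, s a} ({..<n} - {b})))"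
    by (rule sum_distrib_left[symmetric])
  \<comment> \<open>Concordance with a two-element set of labels forces two blocks, so the remaining
    groves contribute nothing.\<close>
  also have "(\<Sum>F\<in>?S. ?w F * of_bool (concordant n (?P F) {a, s a} ({..<n} - {b}))) =
      grove_vector n G {a, s a} ({..<n} - {b})"
    unfolding grove_vector_eq[OF G]
  proof (intro sum.mono_neutral_left finite_groves[OF G] ballI)
    fix F assume F: "F \<in> {F. grove n G F} - ?S"
    have "\<not> concordant n (?P F) {a, s a} ({..<n} - {b})"
    proof
      assume "concordant n (?P F) {a, s a} ({..<n} - {b})"
      then have "card {a, s a} = card (?P F)" by (rule concordant_card[OF partition_on_grove_partition])
      then show False using F ne by simp
    qed
    then show "?w F * of_bool (concordant n (?P F) {a, s a} ({..<n} - {b})) = 0" by simp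
  qed auto
  finally have "(?R a b + ?R (s a) (s b) - ?R (s a) b - ?R a (s b)) / 2 =
      (if a = b then - 1 else 1) * grove_vector n G {a, s a} ({..<n} - {b}) / ?Z"
    using Z by (simp add: field_simps split: if_splits)
  moreover have "L_star n G $$ (a, b) = (?R a b + ?R (s a) (s b) - ?R (s a) b - ?R a (s b)) / 2"
    using ab by (simp add: L_star_def Let_def s_def)
  ultimately show ?thesis by (simp add: s_def)
qed

lemma resistance_sym:
  assumes "is_cactus_network n G" "network_connected G" "i < n" "j < n"
  shows "resistance n G i j = resistance n G j i"
proof -
  have "separated P i j = separated P j i" for P :: "nat set set" by (auto simp: separated_def)
  then have "tree_weight G * resistance n G i j = tree_weight G * resistance n G j i"
    using resistance_eq_grove_sum[OF assms(1,2)] assms(3,4) by simp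
  then show ?thesis using tree_weight_pos[OF assms(1,2)] by simp
qed

lemma L_star_sym:
  assumes G: "is_cactus_network n G" and conn: "network_connected G"
  shows "transpose_mat (L_star n G) = L_star n G"
proof (rule eq_matI)
  fix i j assume "i < dim_row (L_star n G)" "j < dim_col (L_star n G)"
  then have ij: "i < n" "j < n" by (auto simp: L_star_def Let_def)
  then have s: "(i + 1) mod n < n" "(j + 1) mod n < n" by auto
  show "transpose_mat (L_star n G) $$ (i, j) = L_star n G $$ (i, j)"
    using ij s resistance_sym[OF G conn] by (simp add: L_star_def Let_def)
qed (simp_all add: L_star_def Let_def)

lemma connected_chart_grove_vector:
  assumes "n \<ge> 1" "is_cactus_network n G" "network_connected G"
    "X \<in> grassmannian (n + 1) (2 * n)" "has_pluecker_vector n X (grove_vector n G)"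
  shows "connected_chart n X (grove_vector n G) (tree_weight G)"
  using assms grove_vector_spanning_trees[OF assms(2,1)] tree_weight_pos[OF assms(2,3)]
  by (intro connected_chart.intro) auto

text \<open>Entry by entry, both sides are the same Pluecker quotient up to sign. The tilde label
  \<open>b\<close> lies in the sign interval of the columns \<open>a\<close> and
  \<open>a + 1\<close> exactly if a = b.\<close>

lemma Q_mat_eq_L_star:
  assumes n: "n \<ge> 1" and G: "is_cactus_network n G" and conn: "network_connected G"
    and X: "X \<in> grassmannian (n + 1) (2 * n)" "has_pluecker_vector n X (grove_vector n G)"
    and T: "X = row_span (2 * n) (M'_mat n T * D_mat n)"
  shows "Q_mat n T = L_star n G"
proof -
  interpret connected_chart n X "grove_vector n G" "tree_weight G"
    by (rule connected_chart_grove_vector[OF n G conn X])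
  show ?thesis
  proof (rule eq_matI)
    fix a b assume "a < dim_row (L_star n G)" "b < dim_col (L_star n G)"
    then have ab: "a < n" "b < n" by (auto simp: L_star_def Let_def)
    show "Q_mat n T $$ (a, b) = L_star n G $$ (a, b)"
    \<comment> \<open>With one label the successor of \<open>a\<close> is \<open>a\<close> itself,
      and both differences vanish.\<close>
    proof (cases "n = 1")
      case True
      then show ?thesis using ab by (simp add: Q_mat_def L_star_def Let_def)
    next
      case False
      then have n2: "n \<ge> 2" using n by simp
      have Q: "Q_mat n T $$ (a, b) = T $$ (b, (a + 1) mod n) - T $$ (b, a)"
        using ab by (simp add: Q_mat_def)
      show ?thesis
      \<comment> \<open>Here the successor of \<open>a\<close> is 0, so the chart difference runs
        from column 0 to column \<open>a\<close> and enters negatively. Its sign interval consists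
        of all \<open>b\<close> other than \<open>a\<close>, which flips the sign once more.\<close>
      proof (cases "a + 1 = n")
        case True
        then have "T $$ (b, a) - T $$ (b, 0) = slope 0 a b"
          using n2 ab by (intro chart_differences[OF T]) auto
        moreover have "(if 0 \<le> b \<and> b < a then - 1 else 1 :: real) = - (if a = b then - 1 else 1)"
          using True ab by auto
        ultimately show ?thesis
          unfolding Q L_star_eq_grove_vector[OF G conn n2 ab] slope_def using True
          by (simp add: insert_commute)
      next
        case False
        then have "T $$ (b, a + 1) - T $$ (b, a) = slope a (a + 1) b"
          using ab by (intro chart_differences[OF T]) auto
        moreover have "(if a \<le> b \<and> b < a + 1 then - 1 else 1 :: real) = (if a = b then - 1 else 1)"
          by auto
        ultimately show ?thesis
          unfolding Q L_star_eq_grove_vector[OF G conn n2 ab] slope_def using False ab by simp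
      qed
    qed
  qed (simp_all add: Q_mat_def L_star_def Let_def)
qed

text \<open>Existence of a chart matrix is part of the claim, so that the statement about all
  \<open>T\<close> is not vacuous. Although \<open>T\<close> is not unique, \<open>Q_mat n T\<close>
  is.\<close>

theorem theorem1p4:
  fixes n :: nat and G :: "'e cactus_network" and X :: "real vec set"
  assumes "n \<ge> 1"
    and "is_cactus_network n G"
    and "network_connected G"
    and "X \<in> grassmannian (n + 1) (2 * n)"
    and "has_pluecker_vector n X (grove_vector n G)"
  shows "X \<in> U_connected n \<and>
    (\<exists>T\<in>carrier_mat n n. X = row_span (2 * n) (M'_mat n T * D_mat n)) \<and>
    (\<forall>T\<in>carrier_mat n n. X = row_span (2 * n) (M'_mat n T * D_mat n) \<longrightarrow>
       transpose_mat (Q_mat n T) = Q_mat n T \<and> Q_mat n T = L_star n G)"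
proof -
  interpret connected_chart n X "grove_vector n G" "tree_weight G"
    by (rule connected_chart_grove_vector[OF assms])
  have Q: "transpose_mat (Q_mat n T) = Q_mat n T \<and> Q_mat n T = L_star n G"
    if "X = row_span (2 * n) (M'_mat n T * D_mat n)" for T
    using Q_mat_eq_L_star[OF assms that] L_star_sym[OF assms(2,3)] by simp
  obtain T where T: "X = row_span (2 * n) (M'_mat n T * D_mat n)"
    using chart_exists by blast
  \<comment> \<open>Isotropy is not verified on Pluecker coordinates but inherited from the symmetry
    of \<open>L_star\<close> through the chart.\<close>
  have "skew_form n x y = 0" if "x \<in> X" "y \<in> X" for x y
    using isotropic_of_symmetric[OF assms(1), of T x y] Q[OF T] that unfolding T by blast
  then have "X \<in> U_connected n"
    unfolding U_connected_def using assms(4) pluecker_nonzero by blast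
  then show ?thesis using chart_exists Q by blast
qed

end
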